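(* Let $\alpha\in\mathbb{R}\setminus\mathbb{Q}$ with denominators of best rational approximations $(q_s)$. Let $f\in C^2(\mathbb{T}\setminus\{a_1,\dots,a_k\})$, $f>0$, $f\in L^1(\mathbb{T})$, have singularities of type $h$ at $\{a_1,\dots,a_k\}$ with constants $A_i,B_i\ge 0$, and suppose $\{a_1,\dots,a_k\}$ is badly approximable by $\alpha$ with some associated constant $C>1$. Assume that $\sum_{i=1}^kA_i\ne\sum_{i=1}^kB_i$ and that there exist a constant $m_0>0$ and a sequence $(x_s)$ of positive reals such that for every $s\in\mathbb{N}$ we have $x_s<\frac1{q_s}$ and 1. $\displaystyle\lim_{s\to+\infty}\frac{h'(\frac{x_s}{4C})}{q_s\,h(\frac1{2q_s})}=0$ and $\displaystyle\lim_{s\to+\infty}x_s\,q_s\,h(\tfrac1{2q_s})=+\infty$; 2. $\displaystyle\sum_{i\notin K_\alpha}q_ix_i<+\infty$, where $K_\alpha:=\{s\in\mathbb{N}: q_{s+1}<\frac1{x_s}\}$; 3. $h(\frac1{2q_s})/h(\frac1{2q_{s+1}})>m_0$ for every $s\in\mathbb{N}$. Then the special flow $(T^f_t)_{t\in\mathbb{R}}$ above the rotation $R_\alpha$ and under $f$ has the SWR-property.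
   Context: $\mathbb{T}=\mathbb{R}/\mathbb{Z}$, with Lebesgue (Haar) measure $\lambda$ and metric $\|x-y\|$ (distance to the nearest integer); functions on $\mathbb{T}\setminus\{0\}$ are identified with functions on $(0,1)$; $R_\alpha x=x+\alpha$. Denominators: $(q_s)_{s\ge0}$ is the unique increasing sequence of integers with $q_0=1$ and $\|q_s\alpha\|<\|k\alpha\|$ for every $1\le k<q_{s+1}$, $k\ne q_s$. Singularities of type $h$: $h$ is a positive function in $C^2(\mathbb{T}\setminus\{0\})$, decreasing on $(0,1)$, with $\lim_{x\to0^+}h(x)=+\infty$ and $h'$ increasing on $(0,1)$. A function $f\in C^2(\mathbb{T}\setminus\{a_1,\dots,a_k\})$ has singularities of type $h$ at $\{a_1,\dots,a_k\}$ if for each $i$, $\lim_{x\to a_i^+}\frac{f'(x)}{h'(x-a_i)}=A_i$ and $\lim_{x\to a_i^-}\frac{f'(x)}{h'(a_i-x)}=-B_i$ for some numbers $A_i,B_i\ge0$. Badly approximable: $\{a_1,\dots,a_k\}\subset\mathbb{T}$ is badly approximable by $\alpha$ (with constant $C>1$) if for every $x\in\mathbb{T}$ and every $s\in\mathbb{N}$ there is at most one $i_0\in\{0,\dots,q_s-1\}$ with $x+i_0\alpha\in\bigcup_{i=1}^k\left[a_i-\frac1{2Cq_s},a_i+\frac1{2Cq_s}\right]$. Special flow: let $T$ be an automorphism of $(X,\mathscr{B},\mu)$, and let $f>0$, $f\in L^1(X,\mu)$. The special flow $(T^f_t)$ above $T$ and under $f$ acts on $X^f=\{(x,s): x\in X,\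 0\le s<f(x)\}$ (equivalently on $X\times\mathbb{R}$ modulo $(x,s+f(x))\sim(Tx,s)$) by $T^f_t(x,s)=(T^nx,\,t+s-f^{(n)}(x))$, where $n\in\mathbb{Z}$ is the unique integer with $f^{(n)}(x)\le t+s<f^{(n+1)}(x)$. Here $f^{(n)}(x)=f(x)+\dots+f(T^{n-1}x)$ for $n>0$, $f^{(0)}=0$, and $f^{(n)}(x)=-(f(T^nx)+\dots+f(T^{-1}x))$ for $n<0$. It preserves the normalized restriction of $\mu\otimes$Lebesgue to $X^f$. If $(X,d)$ is a metric space, $X^f$ carries the metric $d^f((x,s),(x',s'))=d(x,x')+|s-s'|$. SWR-property: let $(T_t)_{t\in\mathbb{R}}$ be an ergodic flow on a standard Borel probability space $(X,\mathscr{B},\mu)$, with $X$ a metric space with metric $d$. Let $t_0>0$ and $P\subset\mathbb{R}\setminus\{0\}$ compact. The flow has the switchable $R(t_0,P)$-property if for every $\epsilon>0$ and $N\in\mathbb{N}$ there exist $\kappa=\kappa(\epsilon)>0$, $\delta=\delta(\epsilon,N)>0$ and $Z=Z(\epsilon,N)\in\mathscr{B}$ with $\mu(Z)>1-\epsilon$ such that for any $x,y\in Z$ with $d(x,y)<\delta$ and $x$ not in the orbit of $y$, there exist $M,L\in\mathbb{N}$ with $M,L>N$ and $L/M\ge\kappa$, and $p\in P$, such that $\frac1L|\{n\in[M,M+L]\cap\mathbb{Z}: d(T_{nt_0}(x),T_{nt_0+p}(y))<\epsilon\}|>1-\epsilon$ or $\frac1L|\{n\in[M,M+L]\cap\mathbb{Z}: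 d(T_{-nt_0}(x),T_{-nt_0+p}(y))<\epsilon\}|>1-\epsilon$. The flow has the SWR-property if for some compact $P\subset\mathbb{R}\setminus\{0\}$ the set of $t_0>0$ for which it has the switchable $R(t_0,P)$-property is uncountable. *)

theory Defs
  imports "HOL-Probability.Probability"
begin

section \<open>The circle\<close>

text \<open>
  Points of the circle \<open>\<real>/\<int>\<close> are represented by their representatives in \<open>[0,1)\<close>, and
  \<^term>\<open>frac\<close> plays the role of the projection \<open>\<real> \<rightarrow> \<real>/\<int>\<close>. Functions on the circle are
  1-periodic functions on \<^typ>\<open>real\<close>. A function that is defined off a finite set of points
  only is a total function whose values at the excluded points are arbitrary.
\<close>

definition circle :: "real set" where
  "circle = {0..<1}"

definition circle_measure :: "real measure" where
  "circle_measure = restrict_space lborel circle"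

text \<open>Distance to the nearest integer.\<close>

definition int_dist :: "real \<Rightarrow> real" where
  "int_dist x = \<bar>x - of_int (round x)\<bar>"

definition circle_dist :: "real \<Rightarrow> real \<Rightarrow> real" where
  "circle_dist x y = int_dist (x - y)"

definition rotation :: "real \<Rightarrow> real \<Rightarrow> real" where
  "rotation \<alpha> x = frac (x + \<alpha>)"

text \<open>Twice continuously differentiable on an open set of reals.\<close>

definition C2_on :: "(real \<Rightarrow> real) \<Rightarrow> real set \<Rightarrow> bool" where
  "C2_on f S \<longleftrightarrow> f C1_differentiable_on S \<and> deriv f C1_differentiable_on S"

definition circle_C2_off :: "(real \<Rightarrow> real) \<Rightarrow> real set \<Rightarrow> bool" where
  "circle_C2_off f S \<longleftrightarrow> (\<forall>x. f (x + 1) = f x) \<and> C2_on f {x. frac x \<notin> S}"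


section \<open>Diophantine notions\<close>

definition is_denominators :: "real \<Rightarrow> (nat \<Rightarrow> nat) \<Rightarrow> bool" where
  "is_denominators \<alpha> q \<longleftrightarrow>
     strict_mono q \<and> q 0 = 1 \<and>
     (\<forall>s k. 1 \<le> k \<and> k < q (Suc s) \<and> k \<noteq> q s \<longrightarrow>
        int_dist (real (q s) * \<alpha>) < int_dist (real k * \<alpha>))"

text \<open>Here \<open>q\<close> is the sequence of denominators of \<open>\<alpha>\<close>.\<close>

definition badly_approximable ::
  "real \<Rightarrow> (nat \<Rightarrow> nat) \<Rightarrow> real \<Rightarrow> real set \<Rightarrow> bool" where
  "badly_approximable \<alpha> q C S \<longleftrightarrow>
     (\<forall>x\<in>circle. \<forall>s. \<exists>\<^sub>\<le>\<^sub>1 i\<^sub>0. i\<^sub>0 < q s \<and>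
        frac (x + real i\<^sub>0 * \<alpha>) \<in>
          (\<Union>a\<in>S. frac ` {a - 1 / (2 * C * real (q s)) .. a + 1 / (2 * C * real (q s))}))"


section \<open>Singularities of a given type\<close>

text \<open>
  A function on \<open>(\<real>/\<int>) - {0}\<close> is identified with a function on \<open>(0,1)\<close>; values of \<open>h\<close> outside
  \<open>(0,1)\<close> are irrelevant. Monotonicity is understood in the wide sense.
\<close>

definition singularity_type :: "(real \<Rightarrow> real) \<Rightarrow> bool" where
  "singularity_type h \<longleftrightarrow>
     C2_on h {0<..<1} \<and>
     (\<forall>x\<in>{0<..<1}. h x > 0) \<and>
     antimono_on {0<..<1} h \<and>
     filterlim h at_top (at_right 0) \<and>
     mono_on {0<..<1} (deriv h)"

definition has_singularities ::
  "(real \<Rightarrow> real) \<Rightarrow> (real \<Rightarrow> real) \<Rightarrow> nat \<Rightarrow> (nat \<Rightarrow> real) \<Rightarrow>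
   (nat \<Rightarrow> real) \<Rightarrow> (nat \<Rightarrow> real) \<Rightarrow> bool" where
  "has_singularities f h k a A B \<longleftrightarrow>
     (\<forall>i\<in>{1..k}. A i \<ge> 0 \<and> B i \<ge> 0 \<and>
        ((\<lambda>x. deriv f x / deriv h (x - a i)) \<longlongrightarrow> A i) (at_right (a i)) \<and>
        ((\<lambda>x. deriv f x / deriv h (a i - x)) \<longlongrightarrow> - B i) (at_left (a i)))"


section \<open>Special flows\<close>

text \<open>Integer iterates of a bijection \<open>T\<close> of the set \<open>X\<close>.\<close>

definition int_iterate :: "'a set \<Rightarrow> ('a \<Rightarrow> 'a) \<Rightarrow> int \<Rightarrow> 'a \<Rightarrow> 'a" where
  "int_iterate X T n =
     (if n \<ge> 0 then T ^^ nat n else inv_into X T ^^ nat (- n))"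

definition birkhoff_sum ::
  "'a set \<Rightarrow> ('a \<Rightarrow> 'a) \<Rightarrow> ('a \<Rightarrow> real) \<Rightarrow> int \<Rightarrow> 'a \<Rightarrow> real" where
  "birkhoff_sum X T f n x =
     (if n \<ge> 0 then \<Sum>i\<in>{0..<n}. f (int_iterate X T i x)
      else - (\<Sum>i\<in>{n..<0}. f (int_iterate X T i x)))"

definition special_flow_space :: "'a set \<Rightarrow> ('a \<Rightarrow> real) \<Rightarrow> ('a \<times> real) set" where
  "special_flow_space X f = {(x, s). x \<in> X \<and> 0 \<le> s \<and> s < f x}"

definition special_flow ::
  "'a set \<Rightarrow> ('a \<Rightarrow> 'a) \<Rightarrow> ('a \<Rightarrow> real) \<Rightarrow> real \<Rightarrow> 'a \<times> real \<Rightarrow> 'a \<times> real" where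
  "special_flow X T f t = (\<lambda>(x, s).
     let n = (THE n. birkhoff_sum X T f n x \<le> t + s \<and> t + s < birkhoff_sum X T f (n + 1) x)
     in (int_iterate X T n x, t + s - birkhoff_sum X T f n x))"

text \<open>The normalized restriction of \<open>M \<otimes> Lebesgue\<close> to the space under the graph of \<open>f\<close>.\<close>

definition special_flow_measure :: "'a measure \<Rightarrow> ('a \<Rightarrow> real) \<Rightarrow> ('a \<times> real) measure" where
  "special_flow_measure M f =
     (let N = restrict_space (M \<Otimes>\<^sub>M lborel) (special_flow_space (space M) f)
      in uniform_measure N (space N))"

definition special_flow_dist ::
  "('a \<Rightarrow> 'a \<Rightarrow> real) \<Rightarrow> 'a \<times> real \<Rightarrow> 'a \<times> real \<Rightarrow> real" where
  "special_flow_dist d = (\<lambda>(x, s) (x', s'). d x x' + \<bar>s - s'\<bar>)"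


section \<open>The SWR-property\<close>

text \<open>The \<open>\<sigma>\<close>-algebra is the Borel \<open>\<sigma>\<close>-algebra of some Polish topology.\<close>

definition standard_borel :: "'a measure \<Rightarrow> bool" where
  "standard_borel M \<longleftrightarrow>
     (\<exists>X. completely_metrizable_space X \<and> second_countable X \<and> topspace X = space M \<and>
        sets M = sigma_sets (space M) {U. openin X U})"

definition ergodic_flow :: "'a measure \<Rightarrow> (real \<Rightarrow> 'a \<Rightarrow> 'a) \<Rightarrow> bool" where
  "ergodic_flow M T \<longleftrightarrow>
     prob_space M \<and>
     (\<lambda>(t, x). T t x) \<in> borel \<Otimes>\<^sub>M M \<rightarrow>\<^sub>M M \<and>
     (\<forall>x\<in>space M. T 0 x = x) \<and>
     (\<forall>s t. \<forall>x\<in>space M. T (s + t) x = T s (T t x)) \<and>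
     (\<forall>t. distr M M (T t) = M) \<and>
     (\<forall>A\<in>sets M. (\<forall>t. T t -` A \<inter> space M = A) \<longrightarrow> measure M A = 0 \<or> measure M A = 1)"

definition switchable_R ::
  "'a measure \<Rightarrow> ('a \<Rightarrow> 'a \<Rightarrow> real) \<Rightarrow> (real \<Rightarrow> 'a \<Rightarrow> 'a) \<Rightarrow> real \<Rightarrow> real set \<Rightarrow> bool" where
  "switchable_R M d T t\<^sub>0 P \<longleftrightarrow>
     (\<forall>\<epsilon>>0. \<exists>\<kappa>>0. \<forall>N::nat. \<exists>\<delta>>0. \<exists>Z\<in>sets M. measure M Z > 1 - \<epsilon> \<and>
        (\<forall>x\<in>Z. \<forall>y\<in>Z. d x y < \<delta> \<and> (\<forall>t. x \<noteq> T t y) \<longrightarrow>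
           (\<exists>K L :: nat. \<exists>p\<in>P. K > N \<and> L > N \<and> real L / real K \<ge> \<kappa> \<and>
              (real (card {n \<in> {K..K + L}. d (T (real n * t\<^sub>0) x) (T (real n * t\<^sub>0 + p) y) < \<epsilon>})
                 / real L > 1 - \<epsilon> \<or>
               real (card {n \<in> {K..K + L}. d (T (- real n * t\<^sub>0) x) (T (- real n * t\<^sub>0 + p) y) < \<epsilon>})
                 / real L > 1 - \<epsilon>))))"

text \<open>
  The property is only meaningful for an ergodic flow on a standard Borel probability space
  that carries a metric, so these requirements are part of the definition.
\<close>

definition SWR_property ::
  "'a measure \<Rightarrow> ('a \<Rightarrow> 'a \<Rightarrow> real) \<Rightarrow> (real \<Rightarrow> 'a \<Rightarrow> 'a) \<Rightarrow> bool" where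
  "SWR_property M d T \<longleftrightarrow>
     standard_borel M \<and> Metric_space (space M) d \<and> ergodic_flow M T \<and>
     (\<exists>P. compact P \<and> 0 \<notin> P \<and> uncountable {t\<^sub>0. t\<^sub>0 > 0 \<and> switchable_R M d T t\<^sub>0 P})"

end

theory Submission
  imports Defs "HOL-Analysis.Kronecker_Approximation_Theorem"
begin


lemma int_dist_le: "int_dist x \<le> \<bar>x - of_int m\<bar>"
  unfolding int_dist_def by (rule round_diff_minimal)

lemma int_dist_nonneg [simp]: "0 \<le> int_dist x"
  by (simp add: int_dist_def)

lemma int_dist_attained: "\<exists>m::int. int_dist x = \<bar>x - of_int m\<bar>"
  by (auto simp: int_dist_def)

lemma int_dist_add_int [simp]: "int_dist (x + of_int m) = int_dist x"
proof (rule antisym)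
  obtain a b :: int where a: "int_dist x = \<bar>x - of_int a\<bar>"
    and b: "int_dist (x + of_int m) = \<bar>x + of_int m - of_int b\<bar>"
    using int_dist_attained by metis
  show "int_dist (x + of_int m) \<le> int_dist x"
    using int_dist_le[of "x + of_int m" "a + m"] a by simp
  show "int_dist x \<le> int_dist (x + of_int m)"
    using int_dist_le[of x "b - m"] b by (simp add: algebra_simps)
qed

lemma int_dist_minus [simp]: "int_dist (- x) = int_dist x"
proof -
  have "int_dist (- y) \<le> int_dist y" for y
    using int_dist_le[of "- y" "- round y"] by (simp add: int_dist_def abs_minus_commute)
  from this[of x] this[of "- x"] show ?thesis by simp
qed

lemma int_dist_commute: "int_dist (x - y) = int_dist (y - x)"
  using int_dist_minus[of "x - y"] by simp

lemma int_dist_triangle: "int_dist (x + y) \<le> int_dist x + int_dist y"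
  using int_dist_le[of "x + y" "round x + round y"] by (simp add: int_dist_def)

lemma int_dist_le_abs: "int_dist x \<le> \<bar>x\<bar>"
  using int_dist_le[of x 0] by simp

lemma frac_eq_minus_floor: "frac x = x + of_int (- \<lfloor>x\<rfloor>)"
  by (simp add: frac_def)

lemma int_dist_frac [simp]: "int_dist (frac x) = int_dist x"
  by (simp only: frac_eq_minus_floor int_dist_add_int)

lemma int_dist_le_frac: "int_dist x \<le> frac x" "int_dist x \<le> frac (- x)"
  using int_dist_le_abs[of "frac x"] int_dist_le_abs[of "frac (- x)"] by auto

locale denominators =
  fixes \<alpha> :: real and q :: "nat \<Rightarrow> nat"
  assumes irrational: "\<alpha> \<notin> \<rat>" and denom: "is_denominators \<alpha> q"
begin

lemma q_strict_mono: "strict_mono q" and q_0: "q 0 = 1"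
  using denom by (auto simp: is_denominators_def)

lemma best_approx:
  "1 \<le> k \<Longrightarrow> k < q (Suc s) \<Longrightarrow> k \<noteq> q s \<Longrightarrow> int_dist (real (q s) * \<alpha>) < int_dist (real k * \<alpha>)"
  using denom by (auto simp: is_denominators_def)

lemma q_ge: "Suc s \<le> q s"
proof (induction s)
  case (Suc s)
  then show ?case using strict_monoD[OF q_strict_mono, of s "Suc s"] by simp
qed (simp add: q_0)

lemma q_pos: "0 < q s" using q_ge[of s] by simp

lemma q_mono: "r \<le> s \<Longrightarrow> q r \<le> q s"
  using q_strict_mono by (simp add: strict_mono_less_eq)

lemma filterlim_q: "filterlim (\<lambda>s. real (q s)) at_top sequentially"
  using filterlim_subseq[OF q_strict_mono] filterlim_real_sequentially
  by (rule filterlim_compose[rotated])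

lemma int_dist_mult_pos: "1 \<le> k \<Longrightarrow> 0 < int_dist (real k * \<alpha>)"
proof (rule ccontr)
  assume k: "1 \<le> k" and "\<not> 0 < int_dist (real k * \<alpha>)"
  then have "int_dist (real k * \<alpha>) = 0" using int_dist_nonneg[of "real k * \<alpha>"] by linarith
  then obtain m :: int where "real k * \<alpha> = of_int m" by (auto simp: int_dist_def)
  then have "\<alpha> = of_int m / of_nat k" using k by (simp add: field_simps)
  then show False using irrational by (simp add: Rats_divide)
qed

lemma int_dist_q_decreasing:
  "int_dist (real (q (Suc s)) * \<alpha>) < int_dist (real (q s) * \<alpha>)"
  using best_approx[of "q s" "Suc s"] q_pos[of s] strict_monoD[OF q_strict_mono, of s "Suc s"]
    strict_monoD[OF q_strict_mono, of s "Suc (Suc s)"] by simp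

lemma int_dist_q_le: "int_dist (real (q s) * \<alpha>) < 2 / real (q (Suc s))"
proof -
  define N where "N = q (Suc s) - 1"
  have q2: "2 \<le> q (Suc s)" using q_ge[of "Suc s"] by simp
  then have N: "0 < N" "real N = real (q (Suc s)) - 1" by (auto simp: N_def)
  obtain p k :: int where k: "0 < k" "k \<le> int N" "\<bar>of_int k * \<alpha> - of_int p\<bar> < 1 / N"
    using Dirichlet_approx[OF N(1)] by blast
  have "int_dist (real (q s) * \<alpha>) \<le> int_dist (real (nat k) * \<alpha>)"
  proof (cases "nat k = q s")
    case False
    have "1 \<le> nat k" "nat k < q (Suc s)" using k N by (auto simp: N_def)
    then show ?thesis using best_approx[of "nat k" s] False by simp
  qed simp
  also have "\<dots> < 1 / N" using int_dist_le[of "real (nat k) * \<alpha>" p] k by simp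
  also have "1 / N \<le> 2 / real (q (Suc s))" using N q2 by (simp add: field_simps)
  finally show ?thesis .
qed

lemma q_double: "2 * q s \<le> q (s + 2)"
proof -
  define \<beta> where "\<beta> j = real (q j) * \<alpha> - of_int (round (real (q j) * \<alpha>))" for j
  have b: "int_dist (real (q j) * \<alpha>) = \<bar>\<beta> j\<bar>" for j by (simp add: int_dist_def \<beta>_def)
  have pos: "0 < \<bar>\<beta> j\<bar>" for j using int_dist_mult_pos[of "q j"] q_pos[of j] b[of j] by simp
  have dec: "\<bar>\<beta> (Suc j)\<bar> < \<bar>\<beta> j\<bar>" for j using int_dist_q_decreasing[of j] by (simp add: b)
  have key: "2 * q i \<le> q j" if ij: "i < j" "\<bar>\<beta> j\<bar> < \<bar>\<beta> i\<bar>" "0 < \<beta> i \<longleftrightarrow> 0 < \<beta> j" for i j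
  proof -
    have lt: "q i < q j" using ij q_strict_mono by (simp add: strict_mono_less)
    define d where "d = q j - q i"
    have d: "1 \<le> d" "real d = real (q j) - real (q i)" using lt by (auto simp: d_def)
    have "int_dist (real d * \<alpha>) \<le> \<bar>\<beta> j - \<beta> i\<bar>"
      using int_dist_le[of "real d * \<alpha>" "round (real (q j) * \<alpha>) - round (real (q i) * \<alpha>)"]
      by (simp add: d \<beta>_def algebra_simps)
    also have "\<dots> < \<bar>\<beta> i\<bar>" using ij pos[of i] pos[of j] by linarith
    finally have "int_dist (real d * \<alpha>) < int_dist (real (q i) * \<alpha>)" by (simp add: b)
    then have "q (Suc i) \<le> d" using best_approx[OF d(1), of i] by (metis linorder_not_less order_less_asym)
    then show ?thesis using q_mono[of i "Suc i"] by (simp add: d_def)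
  qed
  have lt: "\<bar>\<beta> (Suc (Suc s))\<bar> < \<bar>\<beta> s\<bar>" using dec[of s] dec[of "Suc s"] by simp
  consider "0 < \<beta> s \<longleftrightarrow> 0 < \<beta> (Suc s)" | "0 < \<beta> s \<longleftrightarrow> 0 < \<beta> (Suc (Suc s))"
    | "0 < \<beta> (Suc s) \<longleftrightarrow> 0 < \<beta> (Suc (Suc s))" by blast
  then have "2 * q s \<le> q (Suc (Suc s))"
  proof cases
    case 1
    from key[OF _ dec 1] q_mono[of "Suc s" "Suc (Suc s)"] show ?thesis by simp
  next
    case 2
    from key[OF _ lt 2] show ?thesis by simp
  next
    case 3
    from key[OF _ dec 3] q_mono[of s "Suc s"] show ?thesis by simp
  qed
  then show ?thesis by simp
qed

lemma q_growth: "2 ^ m * q s \<le> q (s + 2 * m)"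
proof (induction m)
  case (Suc m)
  then show ?case using q_double[of "s + 2 * m"] by (simp add: algebra_simps)
qed simp

lemma orbit_labelling:
  obtains \<kappa> :: "nat \<Rightarrow> nat" where "bij_betw \<kappa> {..<q s} {..<q s}"
    and "\<And>i. i < q s \<Longrightarrow> \<exists>m::int. \<exists>e. \<theta> + real i * \<alpha> = (real (\<kappa> i) + e) / real (q s) + of_int m
           \<and> -2 < e \<and> e < 3"
proof -
  define p where "p = round (real (q s) * \<alpha>)"
  define b where "b = real (q s) * \<alpha> - of_int p"
  define t where "t = \<lfloor>\<theta> * real (q s)\<rfloor>"
  define u where "u = \<theta> * real (q s) - of_int t"
  define \<kappa> where "\<kappa> i = nat ((int i * p + t) mod int (q s))" for i
  have qp: "0 < real (q s)" using q_pos[of s] by simp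
  have u: "0 \<le> u" "u < 1" unfolding u_def t_def by linarith+
  have bd: "\<bar>b\<bar> = int_dist (real (q s) * \<alpha>)" by (simp add: b_def p_def int_dist_def)
  have "\<bar>b\<bar> < 2 / real (q (Suc s))" using int_dist_q_le[of s] bd by simp
  also have "\<dots> \<le> 2 / real (q s)" using q_mono[of s "Suc s"] qp by (intro divide_left_mono) auto
  finally have bl: "\<bar>b\<bar> * real (q s) < 2" using qp by (simp add: field_simps)
  have kl: "\<kappa> i < q s" and kk: "int (\<kappa> i) = (int i * p + t) mod int (q s)" for i
    using q_pos[of s] by (auto simp: \<kappa>_def nat_less_iff)
  have noteq: "\<kappa> i \<noteq> \<kappa> j" if ij: "i < j" "j < q s" for i j
  proof
    assume "\<kappa> i = \<kappa> j"
    then have "(int i * p + t) mod int (q s) = (int j * p + t) mod int (q s)"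
      using kk[of i] kk[of j] by simp
    then have "int (q s) dvd (int j * p + t) - (int i * p + t)"
      by (metis mod_eq_dvd_iff)
    then obtain m where m: "(int j * p + t) - (int i * p + t) = int (q s) * m" by (auto simp: dvd_def)
    define d where "d = j - i"
    have d: "1 \<le> d" "d < q s" "int d = int j - int i" using ij by (auto simp: d_def)
    have "int d * p = int j * p - int i * p" by (simp add: d(3) algebra_simps)
    also have "\<dots> = int (q s) * m" using m by simp
    finally have "int d * p = int (q s) * m" .
    then have "of_int (int d * p) = (of_int (int (q s) * m) :: real)" by simp
    then have "real d * of_int p = real (q s) * of_int m" by simp
    then have "real d * \<alpha> - of_int m = real d / real (q s) * b" using qp by (simp add: b_def field_simps)
    then have "int_dist (real d * \<alpha>) \<le> real d / real (q s) * \<bar>b\<bar>"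
      using int_dist_le[of "real d * \<alpha>" m] by (simp add: abs_mult)
    also have "\<dots> \<le> 1 * \<bar>b\<bar>" using d qp by (intro mult_right_mono) auto
    finally have "int_dist (real d * \<alpha>) \<le> int_dist (real (q s) * \<alpha>)" by (simp add: bd)
    moreover have "int_dist (real (q s) * \<alpha>) < int_dist (real d * \<alpha>)"
      using d q_mono[of s "Suc s"] by (intro best_approx) auto
    ultimately show False by simp
  qed
  have inj: "inj_on \<kappa> {..<q s}"
    by (rule linorder_inj_onI') (use noteq in auto)
  have "\<kappa> ` {..<q s} = {..<q s}"
    by (rule card_subset_eq) (use kl inj in \<open>auto simp: card_image\<close>)
  then have bij: "bij_betw \<kappa> {..<q s} {..<q s}" using inj by (simp add: bij_betw_def)
  have "\<exists>m::int. \<exists>e. \<theta> + real i * \<alpha> = (real (\<kappa> i) + e) / real (q s) + of_int m \<and> -2 < e \<and> e < 3"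
    if i: "i < q s" for i
  proof (intro exI conjI)
    define m where "m = (int i * p + t) div int (q s)"
    have "int i * p + t = int (q s) * m + int (\<kappa> i)" by (simp add: m_def kk)
    then have "of_int (int i * p + t) = (of_int (int (q s) * m + int (\<kappa> i)) :: real)" by simp
    then have *: "real i * of_int p + of_int t = real (q s) * of_int m + real (\<kappa> i)" by simp
    show "\<theta> + real i * \<alpha> = (real (\<kappa> i) + (u + real i * b)) / real (q s) + of_int m"
      using * qp by (simp add: u_def b_def field_simps)
    have "\<bar>real i * b\<bar> \<le> real (q s) * \<bar>b\<bar>" using i by (auto simp: abs_mult intro!: mult_right_mono)
    then have "\<bar>real i * b\<bar> < 2" using bl by (simp add: mult.commute)
    then show "-2 < u + real i * b" "u + real i * b < 3" using u by linarith+
  qed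
  with bij that show thesis by blast
qed

lemma frac_label:
  assumes "y = (real k + e) / real n + of_int m" "-2 < e" "e < 3" "2 \<le> k" "k + 3 \<le> n"
  shows "(real k - 2) / real n < frac y" "frac y < (real k + 3) / real n"
proof -
  have n: "0 < real n" "real k + 3 \<le> real n" "2 \<le> real k" using assms(4,5) by linarith+
  have "frac y = (real k + e) / real n"
    using assms n by (subst frac_unique_iff) (auto simp: field_simps)
  then show "(real k - 2) / real n < frac y" "frac y < (real k + 3) / real n"
    using assms n by (auto simp: divide_strict_right_mono)
qed

lemma denjoy_koksma_upper:
  fixes \<Phi> :: "real \<Rightarrow> real"
  assumes nonneg: "\<And>u. 0 \<le> \<Phi> u"
    and anti: "\<And>u v. 0 < u \<Longrightarrow> u \<le> v \<Longrightarrow> v < 1 \<Longrightarrow> \<Phi> v \<le> \<Phi> (u::real)"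
    and T: "\<And>i. i < q s \<Longrightarrow> \<Phi> (frac (\<theta> + real i * \<alpha>)) \<le> T"
  shows "(\<Sum>i<q s. \<Phi> (frac (\<theta> + real i * \<alpha>))) \<le> 5 * T + (\<Sum>k\<in>{1..<q s}. \<Phi> (real k / real (q s)))"
proof -
  obtain \<kappa> where bij: "bij_betw \<kappa> {..<q s} {..<q s}"
    and lab: "\<And>i. i < q s \<Longrightarrow> \<exists>m::int. \<exists>e. \<theta> + real i * \<alpha> = (real (\<kappa> i) + e) / real (q s) + of_int m
           \<and> -2 < e \<and> e < 3" using orbit_labelling[of s \<theta>] by blast
  define I where "I = {3..<q s - 2}"
  define \<Psi> where "\<Psi> k = (if k \<in> I then \<Phi> (real (k - 2) / real (q s)) else T)" for k
  have T0: "0 \<le> T" using order_trans[OF nonneg T[OF q_pos]] .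
  have "\<Phi> (frac (\<theta> + real i * \<alpha>)) \<le> \<Psi> (\<kappa> i)" if i: "i < q s" for i
  proof (cases "\<kappa> i \<in> I")
    case True
    obtain m :: int and e where e: "\<theta> + real i * \<alpha> = (real (\<kappa> i) + e) / real (q s) + of_int m"
      "-2 < e" "e < 3" using lab[OF i] by blast
    have k: "3 \<le> \<kappa> i" "\<kappa> i + 3 \<le> q s" using True by (auto simp: I_def)
    have "(real (\<kappa> i) - 2) / real (q s) < frac (\<theta> + real i * \<alpha>)"
      using frac_label[OF e] k by simp
    moreover have "0 < (real (\<kappa> i) - 2) / real (q s)" using k q_pos[of s] by simp
    ultimately show ?thesis using True k
      by (auto simp: \<Psi>_def of_nat_diff frac_lt_1 intro!: anti)
  next
    case False
    then show ?thesis using T[OF i] by (simp add: \<Psi>_def)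
  qed
  then have "(\<Sum>i<q s. \<Phi> (frac (\<theta> + real i * \<alpha>))) \<le> (\<Sum>i<q s. \<Psi> (\<kappa> i))"
    by (intro sum_mono) auto
  also have "\<dots> = (\<Sum>k<q s. \<Psi> k)" by (rule sum.reindex_bij_betw[OF bij])
  also have "\<dots> = (\<Sum>k\<in>{..<q s} - I. \<Psi> k) + (\<Sum>k\<in>I. \<Psi> k)"
    by (rule sum.subset_diff) (auto simp: I_def)
  also have "(\<Sum>k\<in>{..<q s} - I. \<Psi> k) \<le> 5 * T"
  proof -
    have "{..<q s} - I \<subseteq> {..<3} \<union> {q s - 2..<q s}" by (auto simp: I_def)
    then have "card ({..<q s} - I) \<le> card ({..<3} \<union> {q s - 2..<q s})" by (rule card_mono[rotated]) simp
    also have "\<dots> \<le> 3 + 2" by (rule order_trans[OF card_Un_le]) simp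
    finally have "real (card ({..<q s} - I)) \<le> 5" by simp
    then have "real (card ({..<q s} - I)) * T \<le> 5 * T" using T0 by (rule mult_right_mono)
    then show ?thesis by (simp add: \<Psi>_def)
  qed
  also have "(\<Sum>k\<in>I. \<Psi> k) = (\<Sum>k\<in>I. \<Phi> (real (k - 2) / real (q s)))"
    by (rule sum.cong) (auto simp: \<Psi>_def)
  also have "\<dots> = (\<Sum>k\<in>(\<lambda>k. k - 2) ` I. \<Phi> (real k / real (q s)))"
    by (subst sum.reindex) (auto simp: I_def inj_on_def)
  also have "\<dots> \<le> (\<Sum>k\<in>{1..<q s}. \<Phi> (real k / real (q s)))"
    using nonneg by (intro sum_mono2) (auto simp: I_def)
  finally show ?thesis by simp
qed

lemma denjoy_koksma_lower:
  fixes \<Phi> :: "real \<Rightarrow> real"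
  assumes nonneg: "\<And>u. 0 \<le> \<Phi> u"
    and anti: "\<And>u v. 0 < u \<Longrightarrow> u \<le> v \<Longrightarrow> v < 1 \<Longrightarrow> \<Phi> v \<le> \<Phi> (u::real)"
  shows "(\<Sum>k\<in>{5..<q s}. \<Phi> (real k / real (q s))) \<le> (\<Sum>i<q s. \<Phi> (frac (\<theta> + real i * \<alpha>)))"
proof -
  obtain \<kappa> where bij: "bij_betw \<kappa> {..<q s} {..<q s}"
    and lab: "\<And>i. i < q s \<Longrightarrow> \<exists>m::int. \<exists>e. \<theta> + real i * \<alpha> = (real (\<kappa> i) + e) / real (q s) + of_int m
           \<and> -2 < e \<and> e < 3" using orbit_labelling[of s \<theta>] by blast
  define I where "I = {2..<q s - 3}"
  define \<Psi> where "\<Psi> k = (if k \<in> I then \<Phi> (real (k + 3) / real (q s)) else 0)" for k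
  have "\<Psi> (\<kappa> i) \<le> \<Phi> (frac (\<theta> + real i * \<alpha>))" if i: "i < q s" for i
  proof (cases "\<kappa> i \<in> I")
    case True
    obtain m :: int and e where e: "\<theta> + real i * \<alpha> = (real (\<kappa> i) + e) / real (q s) + of_int m"
      "-2 < e" "e < 3" using lab[OF i] by blast
    have k: "2 \<le> \<kappa> i" "\<kappa> i + 3 < q s" using True by (auto simp: I_def)
    have "(real (\<kappa> i) - 2) / real (q s) < frac (\<theta> + real i * \<alpha>)"
      "frac (\<theta> + real i * \<alpha>) < (real (\<kappa> i) + 3) / real (q s)"
      using frac_label[OF e] k by simp_all
    moreover have "0 \<le> (real (\<kappa> i) - 2) / real (q s)" "(real (\<kappa> i) + 3) / real (q s) < 1"
      using k by (simp_all add: field_simps)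
    ultimately have "0 < frac (\<theta> + real i * \<alpha>)" "frac (\<theta> + real i * \<alpha>) \<le> (real (\<kappa> i) + 3) / real (q s)"
      "(real (\<kappa> i) + 3) / real (q s) < 1" by linarith+
    from anti[OF this] show ?thesis using True by (simp add: \<Psi>_def add.commute)
  next
    case False
    then show ?thesis using nonneg by (simp add: \<Psi>_def)
  qed
  then have "(\<Sum>i<q s. \<Psi> (\<kappa> i)) \<le> (\<Sum>i<q s. \<Phi> (frac (\<theta> + real i * \<alpha>)))"
    by (intro sum_mono) auto
  also have "(\<Sum>i<q s. \<Psi> (\<kappa> i)) = (\<Sum>k<q s. \<Psi> k)" by (rule sum.reindex_bij_betw[OF bij])
  also have "\<dots> = (\<Sum>k\<in>I. \<Psi> k)"
    by (rule sum.mono_neutral_right) (auto simp: \<Psi>_def I_def)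
  also have "\<dots> = (\<Sum>k\<in>I. \<Phi> (real (k + 3) / real (q s)))"
    by (rule sum.cong) (auto simp: \<Psi>_def)
  also have "\<dots> = (\<Sum>k\<in>(\<lambda>k. k + 3) ` I. \<Phi> (real k / real (q s)))"
    by (subst sum.reindex) (auto simp: inj_on_def)
  also have "(\<lambda>k. k + 3) ` I = {5..<q s}"
    by (auto simp: I_def image_add_atLeastLessThan')
  finally show ?thesis .
qed

lemma uniformly_recurrent:
  assumes "0 \<le> c" "c < d" "d \<le> 1"
  obtains Q where "\<And>\<theta>. \<exists>i<Q. c < frac (\<theta> + real i * \<alpha>) \<and> frac (\<theta> + real i * \<alpha>) < d"
proof -
  have "\<forall>\<^sub>F s in sequentially. 6 / (d - c) < real (q s)"
    using filterlim_q by (auto simp: filterlim_at_top_dense)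
  then obtain s where "6 / (d - c) < real (q s)" by (auto simp: eventually_sequentially)
  then have s: "6 < real (q s) * (d - c)" using assms by (simp add: field_simps)
  define k where "k = nat \<lfloor>c * real (q s)\<rfloor> + 3"
  have fl: "real (nat \<lfloor>c * real (q s)\<rfloor>) = of_int \<lfloor>c * real (q s)\<rfloor>" using assms by simp
  have k1: "c * real (q s) < real k - 2" "real k + 3 \<le> c * real (q s) + 6"
    unfolding k_def of_nat_add fl by (auto) linarith+
  have k2: "real k + 3 < d * real (q s)" using k1 s by (simp add: algebra_simps)
  also have "\<dots> \<le> 1 * real (q s)" using assms by (intro mult_right_mono) auto
  finally have k3: "k + 3 < q s" by simp
  have "\<exists>i<q s. c < frac (\<theta> + real i * \<alpha>) \<and> frac (\<theta> + real i * \<alpha>) < d" for \<theta>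
  proof -
    obtain \<kappa> where bij: "bij_betw \<kappa> {..<q s} {..<q s}"
      and lab: "\<And>i. i < q s \<Longrightarrow> \<exists>m::int. \<exists>e. \<theta> + real i * \<alpha> = (real (\<kappa> i) + e) / real (q s) + of_int m
             \<and> -2 < e \<and> e < 3" using orbit_labelling[of s \<theta>] by blast
    obtain i where i: "i < q s" "\<kappa> i = k"
      using bij k3 by (metis add_lessD1 bij_betw_iff_bijections lessThan_iff)
    obtain m :: int and e where e: "\<theta> + real i * \<alpha> = (real k + e) / real (q s) + of_int m"
      "-2 < e" "e < 3" using lab[OF i(1)] i(2) by blast
    have "(real k - 2) / real (q s) < frac (\<theta> + real i * \<alpha>)"
      "frac (\<theta> + real i * \<alpha>) < (real k + 3) / real (q s)"
      using frac_label[OF e] k3 by (simp_all add: k_def)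
    moreover have "c < (real k - 2) / real (q s)" "(real k + 3) / real (q s) < d"
      using k1 k2 q_pos[of s] by (simp_all add: field_simps)
    ultimately show ?thesis using i by (intro exI[of _ i]) auto
  qed
  then show thesis by (rule that)
qed

end

lemma denominators_minus: "denominators \<alpha> q \<Longrightarrow> denominators (- \<alpha>) q"
  by (auto simp: denominators_def is_denominators_def)


definition ergodic_sum :: "('a \<Rightarrow> 'a) \<Rightarrow> ('a \<Rightarrow> real) \<Rightarrow> nat \<Rightarrow> 'a \<Rightarrow> real" where
  "ergodic_sum T g n x = (\<Sum>i<n. g ((T ^^ i) x))"

primrec ergodic_max :: "('a \<Rightarrow> 'a) \<Rightarrow> ('a \<Rightarrow> real) \<Rightarrow> nat \<Rightarrow> 'a \<Rightarrow> real" where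
  "ergodic_max T g 0 x = 0"
| "ergodic_max T g (Suc n) x = max 0 (g x + ergodic_max T g n (T x))"

lemma ergodic_sum_0 [simp]: "ergodic_sum T g 0 x = 0"
  by (simp add: ergodic_sum_def)

lemma ergodic_sum_Suc: "ergodic_sum T g (Suc n) x = g x + ergodic_sum T g n (T x)"
  by (simp only: ergodic_sum_def sum.lessThan_Suc_shift) (simp add: funpow_swap1)

lemma ergodic_sum_Suc': "ergodic_sum T g (Suc n) x = ergodic_sum T g n x + g ((T ^^ n) x)"
  by (simp add: ergodic_sum_def)

lemma ergodic_max_nonneg: "0 \<le> ergodic_max T g n x"
  by (cases n) auto

lemma ergodic_max_mono: "ergodic_max T g n x \<le> ergodic_max T g (Suc n) x"
proof (induction n arbitrary: x)
  case (Suc n)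
  show ?case using Suc.IH[of "T x"] by auto
qed simp

lemma ergodic_max_ge: "k \<le> n \<Longrightarrow> ergodic_sum T g k x \<le> ergodic_max T g n x"
proof (induction n arbitrary: k x)
  case (Suc n)
  show ?case
  proof (cases k)
    case (Suc j)
    then show ?thesis using Suc.IH[of j "T x"] Suc.prems by (auto simp: ergodic_sum_Suc)
  qed (simp add: ergodic_max_nonneg)
qed simp

lemma ergodic_max_attained: "\<exists>k\<le>n. ergodic_max T g n x = ergodic_sum T g k x"
proof (induction n arbitrary: x)
  case (Suc n)
  obtain k where k: "k \<le> n" "ergodic_max T g n (T x) = ergodic_sum T g k (T x)"
    using Suc.IH by blast
  show ?case
  proof (cases "0 \<le> g x + ergodic_max T g n (T x)")
    case True
    then show ?thesis using k by (intro exI[of _ "Suc k"]) (simp add: ergodic_sum_Suc)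
  next
    case False
    then show ?thesis by (intro exI[of _ 0]) simp
  qed
qed auto

lemma ergodic_max_pos_iff: "0 < ergodic_max T g n x \<longleftrightarrow> (\<exists>k\<le>n. 0 < ergodic_sum T g k x)"
proof
  assume "0 < ergodic_max T g n x"
  then show "\<exists>k\<le>n. 0 < ergodic_sum T g k x" using ergodic_max_attained[of n T g x] by auto
next
  assume "\<exists>k\<le>n. 0 < ergodic_sum T g k x"
  then obtain k where "k \<le> n" "0 < ergodic_sum T g k x" by blast
  with ergodic_max_ge[of k n T g x] show "0 < ergodic_max T g n x" by linarith
qed

locale pmpt = prob_space M for M :: "'a measure" +
  fixes T :: "'a \<Rightarrow> 'a"
  assumes T_measurable [measurable]: "T \<in> M \<rightarrow>\<^sub>M M" and T_preserves: "distr M M T = M"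
begin

lemma T_space: "x \<in> space M \<Longrightarrow> T x \<in> space M"
  using measurable_space[OF T_measurable] .

lemma funpow_T_measurable: "(T ^^ n) \<in> M \<rightarrow>\<^sub>M M"
proof (induction n)
  case (Suc n)
  show ?case using measurable_comp[OF Suc T_measurable] by simp
qed simp

lemma integrable_T: "integrable M g \<Longrightarrow> integrable M (\<lambda>x. g (T x))" for g :: "'a \<Rightarrow> real"
  using integrable_distr_eq[OF T_measurable, of g] T_preserves by simp

lemma integral_T: "g \<in> borel_measurable M \<Longrightarrow> (\<integral>x. g (T x) \<partial>M) = integral\<^sup>L M g" for g :: "'a \<Rightarrow> real"
  using integral_distr[OF T_measurable, of g] T_preserves by simp

lemma ergodic_sum_measurable [measurable]:
  "g \<in> borel_measurable M \<Longrightarrow> ergodic_sum T g n \<in> borel_measurable M"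
  unfolding ergodic_sum_def[abs_def]
  by (intro borel_measurable_sum measurable_compose[OF funpow_T_measurable])

lemma ergodic_max_measurable [measurable]:
  "g \<in> borel_measurable M \<Longrightarrow> ergodic_max T g n \<in> borel_measurable M"
proof (induction n)
  case (Suc n)
  have [measurable]: "ergodic_max T g n \<in> borel_measurable M" "g \<in> borel_measurable M" using Suc by auto
  show ?case unfolding ergodic_max.simps(2)[abs_def] by measurable
qed (simp add: ergodic_max.simps(1)[abs_def])

lemma ergodic_max_integrable: "integrable M g \<Longrightarrow> integrable M (ergodic_max T g n)"
proof (induction n)
  case (Suc n)
  then have "integrable M (\<lambda>x. max 0 (g x + ergodic_max T g n (T x)))"
    using integrable_max[OF integrable_zero Bochner_Integration.integrable_add[OF _ integrable_T]]
    by simp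
  then show ?case by simp
qed (simp add: ergodic_max.simps(1)[abs_def])

lemma maximal_ergodic:
  assumes g: "integrable M g"
  shows "0 \<le> (\<integral>x. indicator {x \<in> space M. \<exists>n. 0 < ergodic_sum T g n x} x * g x \<partial>M)"
proof -
  have [measurable]: "g \<in> borel_measurable M" using g by auto
  define E where "E n = {x \<in> space M. 0 < ergodic_max T g n x}" for n
  have [measurable]: "E n \<in> sets M" for n unfolding E_def by measurable
  have ind: "integrable M (\<lambda>x. indicator (E n) x * g x)" for n
    using integrable_mult_indicator[OF _ g, of "E n"] by simp
  have nonneg: "0 \<le> (\<integral>x. indicator (E n) x * g x \<partial>M)" for n
  proof (cases n)
    case 0
    then have "E n = {}" by (simp add: E_def)
    then show ?thesis by simp
  next
    case (Suc j)
    define m where "m = ergodic_max T g n"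
    have mi: "integrable M m" unfolding m_def using ergodic_max_integrable[OF g] .
    then have miT: "integrable M (\<lambda>x. m (T x))" by (rule integrable_T)
    have "0 = (\<integral>x. m x - m (T x) \<partial>M)"
      using mi miT integral_T[of m] by (simp add: Bochner_Integration.integral_diff)
    also have "\<dots> \<le> (\<integral>x. indicator (E n) x * g x \<partial>M)"
    proof (rule integral_mono)
      fix x assume x: "x \<in> space M"
      show "m x - m (T x) \<le> indicator (E n) x * g x"
      proof (cases "x \<in> E n")
        case True
        then have "m x = g x + ergodic_max T g j (T x)"
          by (auto simp: E_def m_def Suc max_def split: if_splits)
        also have "\<dots> \<le> g x + m (T x)" unfolding m_def Suc using ergodic_max_mono by (rule add_left_mono)
        finally show ?thesis using True by simp
      next
        case False
        then have "m x \<le> 0" using x by (auto simp: E_def m_def)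
        then show ?thesis using False ergodic_max_nonneg[of T g n "T x"] by (simp add: m_def)
      qed
    qed (use mi miT ind in auto)
    finally show ?thesis .
  qed
  have "(\<lambda>n. \<integral>x. indicator (E n) x * g x \<partial>M) \<longlonglongrightarrow>
      (\<integral>x. indicator {x \<in> space M. \<exists>n. 0 < ergodic_sum T g n x} x * g x \<partial>M)"
  proof (rule integral_dominated_convergence[where w = "\<lambda>x. \<bar>g x\<bar>"])
    show "AE x in M. (\<lambda>n. indicator (E n) x * g x) \<longlonglongrightarrow>
        indicator {x \<in> space M. \<exists>n. 0 < ergodic_sum T g n x} x * g x"
    proof (rule AE_I2)
      fix x assume x: "x \<in> space M"
      show "(\<lambda>n. indicator (E n) x * g x) \<longlonglongrightarrow>
          indicator {x \<in> space M. \<exists>n. 0 < ergodic_sum T g n x} x * g x"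
      proof (cases "\<exists>n. 0 < ergodic_sum T g n x")
        case True
        then obtain k where "0 < ergodic_sum T g k x" by blast
        then have "x \<in> E n" if "k \<le> n" for n using that x by (auto simp: E_def ergodic_max_pos_iff)
        then have "\<forall>\<^sub>F n in sequentially. indicator (E n) x * g x =
          indicator {x \<in> space M. \<exists>n. 0 < ergodic_sum T g n x} x * g x"
          using True x by (auto simp: eventually_sequentially intro!: exI[of _ k])
        then show ?thesis by (rule tendsto_eventually)
      next
        case False
        then have "x \<notin> E n" for n by (auto simp: E_def ergodic_max_pos_iff)
        then show ?thesis using False by simp
      qed
    qed
  qed (use g in \<open>auto simp: abs_mult indicator_def\<close>)
  then show ?thesis using nonneg by (intro LIMSEQ_le_const) auto
qed

lemma maximal_inequality:
  assumes g: "integrable M g" and nonneg: "\<And>x. x \<in> space M \<Longrightarrow> 0 \<le> g x" and R: "0 < R"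
  shows "measure M {x \<in> space M. \<exists>n. R * real n < ergodic_sum T g n x} \<le> integral\<^sup>L M g / R"
proof -
  have [measurable]: "g \<in> borel_measurable M" using g by auto
  define E where "E = {x \<in> space M. \<exists>n. R * real n < ergodic_sum T g n x}"
  have [measurable]: "E \<in> sets M" unfolding E_def by measurable
  have sub: "ergodic_sum T (\<lambda>x. g x - R) n x = ergodic_sum T g n x - R * real n" for n x
    by (simp add: ergodic_sum_def sum_subtractf)
  have Eg: "integrable M (\<lambda>x. indicator E x * g x)"
    using integrable_mult_indicator[OF _ g, of E] by simp
  have "0 \<le> (\<integral>x. indicator E x * (g x - R) \<partial>M)"
    using maximal_ergodic[of "\<lambda>x. g x - R"] g by (simp add: E_def sub)
  also have "\<dots> = (\<integral>x. indicator E x * g x - R * indicator E x \<partial>M)"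
    by (simp add: algebra_simps)
  also have "\<dots> = (\<integral>x. indicator E x * g x \<partial>M) - R * measure M E"
    using Eg by (subst Bochner_Integration.integral_diff) (auto intro!: integrable_real_indicator simp: emeasure_eq_measure)
  also have "(\<integral>x. indicator E x * g x \<partial>M) \<le> integral\<^sup>L M g"
    using Eg g nonneg by (intro integral_mono) (auto simp: indicator_def)
  finally show ?thesis using R by (simp add: E_def field_simps)
qed

lemma birkhoff_ae_convergent:
  assumes g [measurable]: "g \<in> borel_measurable M" and bnd: "\<And>x. 0 \<le> g x" "\<And>x. g x \<le> 1"
  shows "AE x in M. convergent (\<lambda>n. ergodic_sum T g n x / real n)"
proof -
  have gi: "integrable M g" using bnd by (intro integrable_const_bound[where B = 1]) auto
  define A where "A n x = ergodic_sum T g n x / real n" for n x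
  have [measurable]: "A n \<in> borel_measurable M" for n unfolding A_def[abs_def] by measurable
  define U where "U x = limsup (\<lambda>n. ereal (A n x))" for x
  define V where "V x = liminf (\<lambda>n. ereal (A n x))" for x
  have [measurable]: "U \<in> borel_measurable M" "V \<in> borel_measurable M"
    unfolding U_def[abs_def] V_def[abs_def] by measurable
  have A01: "0 \<le> A n x" "A n x \<le> 1" for n x
  proof -
    have "0 \<le> ergodic_sum T g n x" "ergodic_sum T g n x \<le> real n"
      using bnd sum_bounded_above[of "{..<n}" "\<lambda>i. g ((T ^^ i) x)" 1]
      by (auto simp: ergodic_sum_def intro!: sum_nonneg)
    then show "0 \<le> A n x" "A n x \<le> 1" by (auto simp: A_def divide_le_eq)
  qed
  have AT: "A n (T x) = (g ((T ^^ n) x) - g x) / real n + A n x" for n x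
    using ergodic_sum_Suc[of T g n x] ergodic_sum_Suc'[of T g n x]
    by (simp add: A_def flip: add_divide_distrib)
  have lim0: "(\<lambda>n. ereal ((g ((T ^^ n) x) - g x) / real n)) \<longlonglongrightarrow> ereal 0" for x
  proof (subst lim_ereal, rule Lim_null_comparison)
    show "\<forall>\<^sub>F n in sequentially. norm ((g ((T ^^ n) x) - g x) / real n) \<le> 1 / real n"
    proof (rule always_eventually, rule allI)
      fix n
      have "\<bar>g ((T ^^ n) x) - g x\<bar> \<le> 1" using bnd[of x] bnd[of "(T ^^ n) x"] by linarith
      then show "norm ((g ((T ^^ n) x) - g x) / real n) \<le> 1 / real n"
        by (simp add: divide_right_mono)
    qed
    show "(\<lambda>n. 1 / real n) \<longlonglongrightarrow> 0" by (rule lim_1_over_n)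
  qed
  have UT: "U (T x) = U x" for x
    unfolding U_def AT plus_ereal.simps(1)[symmetric]
    by (subst ereal_limsup_lim_add[OF lim0]) simp_all
  have VT: "V (T x) = V x" for x
    unfolding V_def AT plus_ereal.simps(1)[symmetric]
    by (subst ereal_liminf_lim_add[OF lim0]) simp_all
  have null: "measure M {x \<in> space M. V x < ereal a \<and> ereal b < U x} = 0" if ab: "a < b" for a b
  proof -
    define E where "E = {x \<in> space M. V x < ereal a \<and> ereal b < U x}"
    have [measurable]: "E \<in> sets M" unfolding E_def by measurable
    have iter: "(T ^^ i) x \<in> E \<longleftrightarrow> x \<in> E" if "x \<in> space M" for i x
    proof (induction i)
      case (Suc i)
      have "(T ^^ i) x \<in> space M" using measurable_space[OF funpow_T_measurable that] .
      then show ?case using Suc by (auto simp: E_def UT VT T_space)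
    qed simp
    have key: "0 \<le> (\<integral>x. indicator E x * (\<sigma> * (g x - c)) \<partial>M)"
      if ex: "\<And>x. x \<in> E \<Longrightarrow> \<exists>n. 0 < \<sigma> * (ergodic_sum T g n x - c * real n)" for \<sigma> c
    proof -
      define g1 where "g1 x = indicator E x * (\<sigma> * (g x - c))" for x
      have bs: "ergodic_sum T g1 n x = indicator E x * (\<sigma> * (ergodic_sum T g n x - c * real n))"
        if "x \<in> space M" for n x
        using iter[OF that] by (cases "x \<in> E")
          (simp_all add: ergodic_sum_def g1_def sum_subtractf flip: sum_distrib_left)
      have "{x \<in> space M. \<exists>n. 0 < ergodic_sum T g1 n x} = E"
      proof (intro set_eqI iffI)
        fix x assume "x \<in> {x \<in> space M. \<exists>n. 0 < ergodic_sum T g1 n x}"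
        then show "x \<in> E" by (cases "x \<in> E") (auto simp: bs)
      next
        fix x assume x: "x \<in> E"
        then have "x \<in> space M" by (simp add: E_def)
        then show "x \<in> {x \<in> space M. \<exists>n. 0 < ergodic_sum T g1 n x}"
          using ex[OF x] x by (auto simp: bs)
      qed
      moreover have "integrable M g1"
        unfolding g1_def using gi integrable_mult_indicator[of E M "\<lambda>x. \<sigma> * (g x - c)"] by simp
      ultimately have "0 \<le> (\<integral>x. indicator E x * g1 x \<partial>M)" using maximal_ergodic[of g1] by simp
      also have "\<dots> = (\<integral>x. indicator E x * (\<sigma> * (g x - c)) \<partial>M)"
        by (rule arg_cong[where f = "integral\<^sup>L M"]) (auto simp: g1_def indicator_def)
      finally show ?thesis .
    qed
    have 1: "0 \<le> (\<integral>x. indicator E x * (1 * (g x - b)) \<partial>M)"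
    proof (rule key)
      fix x assume "x \<in> E"
      then have lb: "ereal b < limsup (\<lambda>n. ereal (A n x))" by (simp add: E_def U_def)
      have "\<exists>n>0. b < A n x"
      proof (rule ccontr)
        assume "\<not> (\<exists>n>0. b < A n x)"
        then have "ereal (A n x) \<le> ereal b" if "1 \<le> n" for n
          using that by (cases n) (auto simp: not_less)
        then have "\<forall>\<^sub>F n in sequentially. ereal (A n x) \<le> ereal b"
          by (auto simp: eventually_sequentially)
        then have "limsup (\<lambda>n. ereal (A n x)) \<le> ereal b" by (rule Limsup_bounded)
        then show False using lb by simp
      qed
      then obtain n where "0 < n" "b < A n x" by blast
      then show "\<exists>n. 0 < 1 * (ergodic_sum T g n x - b * real n)"
        by (intro exI[of _ n]) (simp add: A_def field_simps)
    qed
    have 2: "0 \<le> (\<integral>x. indicator E x * ((- 1) * (g x - a)) \<partial>M)"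
    proof (rule key)
      fix x assume "x \<in> E"
      then have la: "liminf (\<lambda>n. ereal (A n x)) < ereal a" by (simp add: E_def V_def)
      have "\<exists>n>0. A n x < a"
      proof (rule ccontr)
        assume "\<not> (\<exists>n>0. A n x < a)"
        then have "ereal a \<le> ereal (A n x)" if "1 \<le> n" for n
          using that by (cases n) (auto simp: not_less)
        then have "\<forall>\<^sub>F n in sequentially. ereal a \<le> ereal (A n x)"
          by (auto simp: eventually_sequentially)
        then have "ereal a \<le> liminf (\<lambda>n. ereal (A n x))" by (rule Liminf_bounded)
        then show False using la by simp
      qed
      then obtain n where "0 < n" "A n x < a" by blast
      then show "\<exists>n. 0 < (- 1) * (ergodic_sum T g n x - a * real n)"
        by (intro exI[of _ n]) (simp add: A_def field_simps)
    qed
    have ii: "integrable M (\<lambda>x. indicator E x * (\<sigma> * (g x - c)))" for \<sigma> c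
      using gi integrable_mult_indicator[of E M "\<lambda>x. \<sigma> * (g x - c)"] by simp
    have "0 \<le> (\<integral>x. indicator E x * (1 * (g x - b)) \<partial>M) + (\<integral>x. indicator E x * ((- 1) * (g x - a)) \<partial>M)"
      using 1 2 by simp
    also have "\<dots> = (\<integral>x. indicator E x * (1 * (g x - b)) + indicator E x * ((- 1) * (g x - a)) \<partial>M)"
      by (rule Bochner_Integration.integral_add[symmetric]) (rule ii)+
    also have "\<dots> = (\<integral>x. (a - b) * indicator E x \<partial>M)"
      by (rule arg_cong[where f = "integral\<^sup>L M"]) (auto simp: algebra_simps)
    also have "\<dots> = (a - b) * measure M E" by simp
    finally have "measure M E \<le> 0" using ab by (simp add: zero_le_mult_iff)
    then have "measure M E = 0" using measure_nonneg[of M E] by linarith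
    then show ?thesis by (simp add: E_def)
  qed
  have "AE x in M. \<forall>a\<in>\<rat>. \<forall>b\<in>\<rat>. a < b \<longrightarrow> \<not> (V x < ereal a \<and> ereal b < U x)"
  proof (subst AE_ball_countable, rule countable_rat, rule ballI,
      subst AE_ball_countable, rule countable_rat, rule ballI)
    fix a b :: real
    show "AE x in M. a < b \<longrightarrow> \<not> (V x < ereal a \<and> ereal b < U x)"
    proof (cases "a < b")
      case True
      have "{x \<in> space M. V x < ereal a \<and> ereal b < U x} \<in> null_sets M"
        using null[OF True] by (auto simp: emeasure_eq_measure)
      then show ?thesis by (rule AE_I') auto
    qed simp
  qed
  then show ?thesis
  proof (eventually_elim)
    fix x assume nn: "\<forall>a\<in>\<rat>. \<forall>b\<in>\<rat>. a < b \<longrightarrow> \<not> (V x < ereal a \<and> ereal b < U x)"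
    have V0: "0 \<le> V x" unfolding V_def
      by (rule Liminf_bounded) (simp add: A01 always_eventually)
    have U1: "U x \<le> 1" unfolding U_def
      by (rule Limsup_bounded) (simp add: A01 always_eventually)
    have VU: "V x \<le> U x" unfolding U_def V_def by (rule Liminf_le_Limsup) simp
    have "\<not> V x < U x"
    proof
      assume lt: "V x < U x"
      obtain v where v: "V x = ereal v" using V0 VU U1 by (cases "V x") auto
      obtain u where u: "U x = ereal u" using V0 VU U1 by (cases "U x") auto
      have "v < u" using lt u v by simp
      then obtain a where a: "a \<in> \<rat>" "v < a" "a < u" using Rats_dense_in_real by blast
      then obtain b where "b \<in> \<rat>" "a < b" "b < u" using Rats_dense_in_real by blast
      then show False using nn a u v by auto
    qed
    with VU have eq: "V x = U x" by simp
    obtain u where u: "U x = ereal u" using V0 VU U1 by (cases "U x") auto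
    have "(\<lambda>n. ereal (A n x)) \<longlonglongrightarrow> ereal u"
      using eq u by (intro Liminf_eq_Limsup) (auto simp: U_def V_def)
    then show "convergent (\<lambda>n. ergodic_sum T g n x / real n)"
      by (auto simp: A_def convergent_def)
  qed
qed

lemma window_frequency:
  assumes W [measurable]: "W \<in> sets M" and e: "0 < \<epsilon>" "0 < \<kappa>" and small: "measure M W < \<epsilon>\<^sup>2 / 4"
  shows "\<exists>N. \<exists>G\<in>sets M. measure M G > 1 - \<epsilon> \<and> (\<forall>x\<in>G. \<forall>K L :: nat. N \<le> K \<longrightarrow> \<kappa> * real K \<le> real L \<longrightarrow>
            real (card {n \<in> {K..K + L}. (T ^^ n) x \<in> W}) \<le> \<epsilon> * real L)"
proof -
  define g where "g = (indicator W :: 'a \<Rightarrow> real)"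
  have [measurable]: "g \<in> borel_measurable M" unfolding g_def by measurable
  define A where "A n x = ergodic_sum T g n x / real n" for n x
  have [measurable]: "A n \<in> borel_measurable M" for n unfolding A_def[abs_def] by measurable
  define \<phi> where "\<phi> x = lim (\<lambda>n. A n x)" for x
  have [measurable]: "\<phi> \<in> borel_measurable M" unfolding \<phi>_def[abs_def] by measurable
  have A01: "0 \<le> A n x" "A n x \<le> 1" for n x
  proof -
    have "0 \<le> ergodic_sum T g n x" "ergodic_sum T g n x \<le> real n"
      using sum_bounded_above[of "{..<n}" "\<lambda>i. g ((T ^^ i) x)" 1]
      by (auto simp: ergodic_sum_def g_def intro!: sum_nonneg)
    then show "0 \<le> A n x" "A n x \<le> 1" by (auto simp: A_def divide_le_eq)
  qed
  have conv: "AE x in M. (\<lambda>n. A n x) \<longlonglongrightarrow> \<phi> x"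
    using birkhoff_ae_convergent[of g]
    by (simp add: g_def A_def \<phi>_def convergent_LIMSEQ_iff)
  have iA: "integral\<^sup>L M (A n) = measure M W" if "0 < n" for n
  proof -
    have giT: "(\<integral>x. g ((T ^^ i) x) \<partial>M) = measure M W" for i
    proof (induction i)
      case (Suc i)
      have "(\<integral>x. g ((T ^^ Suc i) x) \<partial>M) = (\<integral>x. (g \<circ> (T ^^ i)) (T x) \<partial>M)"
        by (simp add: funpow_swap1)
      also have "\<dots> = (\<integral>x. g ((T ^^ i) x) \<partial>M)" 
        using measurable_compose[OF funpow_T_measurable, of g borel i]
        by (subst integral_T) (auto simp: comp_def)
      finally show ?case using Suc by simp
    qed (simp add: g_def)
    have "integral\<^sup>L M (A n) = (\<Sum>i<n. (\<integral>x. g ((T ^^ i) x) \<partial>M)) / real n"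
      unfolding A_def ergodic_sum_def
      by (simp, subst Bochner_Integration.integral_sum)
        (auto intro!: integrable_const_bound[where B = 1] measurable_compose[OF funpow_T_measurable] simp: g_def)
    then show ?thesis using that by (simp add: giT)
  qed
  have "(\<lambda>n. integral\<^sup>L M (A n)) \<longlonglongrightarrow> integral\<^sup>L M \<phi>"
    by (rule integral_dominated_convergence[where w = "\<lambda>_. 1"]) (use conv A01 in auto)
  moreover have "(\<lambda>n. integral\<^sup>L M (A n)) \<longlonglongrightarrow> measure M W"
    by (rule tendsto_eventually) (use iA in \<open>auto simp: eventually_sequentially intro!: exI[of _ 1]\<close>)
  ultimately have i\<phi>: "integral\<^sup>L M \<phi> = measure M W" by (rule LIMSEQ_unique)
  have \<phi>01: "AE x in M. 0 \<le> \<phi> x \<and> \<phi> x \<le> 1"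
    using conv by eventually_elim
      (auto intro: LIMSEQ_le_const LIMSEQ_le_const2 simp: A01)
  have \<phi>i: "integrable M \<phi>"
    using \<phi>01 by (intro integrable_const_bound[where B = 1]) (auto elim: eventually_mono)
  define B where "B = {x \<in> space M. \<phi> x \<ge> \<epsilon> / 2}"
  have [measurable]: "B \<in> sets M" unfolding B_def by measurable
  have "measure M B \<le> integral\<^sup>L M \<phi> / (\<epsilon> / 2)"
    unfolding B_def using \<phi>i \<phi>01 e by (intro integral_Markov_inequality_measure[where A = "{}"]) auto
  also have "\<dots> < \<epsilon> / 2"
    using small e by (simp add: i\<phi> field_simps power2_eq_square)
  finally have Bm: "measure M B < \<epsilon> / 2" .
  define \<rho> where "\<rho> = \<epsilon> / (8 * (2 / \<kappa> + 2))"
  have \<rho>: "0 < \<rho>" using e by (simp add: \<rho>_def add_pos_pos)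
  define H where "H N = {x \<in> space M. \<forall>n\<ge>N. \<bar>A n x - \<phi> x\<bar> \<le> \<rho>}" for N
  have [measurable]: "H N \<in> sets M" for N unfolding H_def by measurable
  have inc: "incseq H" by (auto simp: incseq_def H_def intro: order_trans)
  have "(\<lambda>N. measure M (H N)) \<longlonglongrightarrow> measure M (\<Union>N. H N)"
    using inc by (intro finite_Lim_measure_incseq) auto
  also have "measure M (\<Union>N. H N) = 1"
  proof (subst prob_eq_1)
    show "AE x in M. x \<in> (\<Union>N. H N)"
      using conv AE_space
    proof eventually_elim
      fix x assume "(\<lambda>n. A n x) \<longlonglongrightarrow> \<phi> x" "x \<in> space M"
      from LIMSEQ_D[OF this(1) \<rho>] this(2) show "x \<in> (\<Union>N. H N)"
        by (auto simp: H_def intro: less_imp_le)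
    qed
  qed auto
  finally have "\<forall>\<^sub>F N in sequentially. 1 - \<epsilon> / 2 < measure M (H N)"
    using e by (intro order_tendstoD) auto
  then obtain N1 where N1: "1 - \<epsilon> / 2 < measure M (H N1)" by (auto simp: eventually_sequentially)
  define G where "G = H N1 - B"
  have [measurable]: "G \<in> sets M" unfolding G_def by measurable
  have "measure M (H N1) \<le> measure M (G \<union> B)"
    by (rule finite_measure_mono) (unfold G_def, blast, measurable)
  also have "\<dots> \<le> measure M G + measure M B" by (rule measure_Un_le) measurable
  finally have "measure M (H N1) \<le> measure M G + measure M B" .
  then have G1: "measure M G > 1 - \<epsilon>" using N1 Bm by linarith
  define N where "N = max 1 (max N1 (nat \<lceil>4 / (\<epsilon> * \<kappa>)\<rceil>))"
  have "real (card {n \<in> {K..K + L}. (T ^^ n) x \<in> W}) \<le> \<epsilon> * real L"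
    if x: "x \<in> G" and K: "N \<le> K" and L: "\<kappa> * real K \<le> real L" for x K L
  proof -
    have xs: "\<phi> x < \<epsilon> / 2" "\<And>n. N1 \<le> n \<Longrightarrow> \<bar>A n x - \<phi> x\<bar> \<le> \<rho>"
      using x by (auto simp: G_def H_def B_def)
    have KN: "1 \<le> K" "N1 \<le> K" "nat \<lceil>4 / (\<epsilon> * \<kappa>)\<rceil> \<le> K" using K by (auto simp: N_def)
    then have "4 / (\<epsilon> * \<kappa>) \<le> real K" by linarith
    then have "4 \<le> \<epsilon> * (\<kappa> * real K)" using e by (simp add: field_simps)
    also have "\<dots> \<le> \<epsilon> * real L" using L e by (intro mult_left_mono) auto
    finally have L4: "4 \<le> \<epsilon> * real L" .
    have KL: "real K \<le> real L / \<kappa>" using L e by (simp add: field_simps)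
    have nA: "ergodic_sum T g n x = real n * A n x" for n by (cases "n = 0") (auto simp: A_def)
    have "real (card {n \<in> {K..K + L}. (T ^^ n) x \<in> W}) = (\<Sum>n\<in>{K..K+L}. g ((T ^^ n) x))"
      by (simp add: g_def indicator_def sum.If_cases Int_def)
    also have "\<dots> = ergodic_sum T g (K + L + 1) x - ergodic_sum T g K x"
    proof -
      have eq: "{..<K + L + 1} = {..<K} \<union> {K..K+L}" by auto
      have "ergodic_sum T g (K + L + 1) x = ergodic_sum T g K x + (\<Sum>n\<in>{K..K+L}. g ((T ^^ n) x))"
        unfolding ergodic_sum_def eq by (rule sum.union_disjoint) auto
      then show ?thesis by simp
    qed
    also have "\<dots> = real (K + L + 1) * A (K + L + 1) x - real K * A K x" by (simp only: nA)
    also have "\<dots> \<le> real (K + L + 1) * (\<phi> x + \<rho>) - real K * (\<phi> x - \<rho>)"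
    proof -
      have a: "A (K + L + 1) x \<le> \<phi> x + \<rho>" "\<phi> x - \<rho> \<le> A K x"
        using xs(2)[of "K + L + 1"] xs(2)[of K] KN by auto
      show ?thesis using mult_left_mono[OF a(1), of "real (K + L + 1)"] mult_left_mono[OF a(2), of "real K"]
        by linarith
    qed
    also have "\<dots> = (real L + 1) * \<phi> x + \<rho> * (2 * real K + real L + 1)"
      by (simp add: algebra_simps)
    also have "\<dots> \<le> (real L + 1) * (\<epsilon> / 2) + \<rho> * ((2 / \<kappa> + 2) * real L)"
    proof (intro add_mono mult_left_mono)
      have "1 \<le> real L"
      proof (rule ccontr)
        assume "\<not> 1 \<le> real L"
        then have "L = 0" by simp
        then show False using L4 by simp
      qed
      moreover have "(2 / \<kappa> + 2) * real L = 2 * (real L / \<kappa>) + 2 * real L" by (simp add: algebra_simps)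
      ultimately show "2 * real K + real L + 1 \<le> (2 / \<kappa> + 2) * real L" using KL by linarith
    qed (use xs \<rho> in auto)
    also have "\<rho> * ((2 / \<kappa> + 2) * real L) = \<epsilon> * real L / 8"
    proof -
      define b where "b = 2 / \<kappa> + 2"
      have "0 < b" using e by (simp add: b_def add_pos_pos)
      moreover have "\<rho> = \<epsilon> / (8 * b)" by (simp add: \<rho>_def b_def)
      ultimately show ?thesis unfolding b_def[symmetric] by simp
    qed
    also have "(real L + 1) * (\<epsilon> / 2) + \<epsilon> * real L / 8 = 5 / 8 * (\<epsilon> * real L) + \<epsilon> / 2"
      by (simp add: field_simps)
    finally have fin: "real (card {n \<in> {K..K + L}. (T ^^ n) x \<in> W}) \<le> 5 / 8 * (\<epsilon> * real L) + \<epsilon> / 2" .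
    show ?thesis
    proof (cases "\<epsilon> \<le> 2")
      case True
      then show ?thesis using fin L4 by linarith
    next
      case False
      have "L \<noteq> 0" using L4 by (intro notI) simp
      then have "1 \<le> real L" by simp
      then have "\<epsilon> * 4 \<le> \<epsilon> * (4 * real L)" using e by (intro mult_left_mono) auto
      have "real (card {n \<in> {K..K + L}. (T ^^ n) x \<in> W}) \<le> real (card {K..K+L})"
        by (intro of_nat_mono card_mono) auto
      also have "\<dots> = real L + 1" by simp
      also have "\<dots> \<le> 2 * real L" using \<open>1 \<le> real L\<close> by simp
      also have "\<dots> \<le> \<epsilon> * real L" using False by (intro mult_right_mono) auto
      finally show ?thesis .
    qed
  qed
  with G1 show ?thesis by (intro exI[of _ N] bexI[of _ G]) auto
qed

end


lemma circle_iff: "x \<in> circle \<longleftrightarrow> 0 \<le> x \<and> x < 1" by (auto simp: circle_def)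

lemma frac_in_circle [simp]: "frac x \<in> circle" by (simp add: circle_iff frac_lt_1)

lemma frac_circle: "x \<in> circle \<Longrightarrow> frac x = x" by (simp add: circle_iff frac_eq)

lemma circle_borel [measurable]: "circle \<in> sets borel" by (simp add: circle_def)

lemma space_circle_measure [simp]: "space circle_measure = circle"
  by (simp add: circle_measure_def space_restrict_space)

lemma sets_circle_measure: "sets circle_measure = sets (restrict_space borel circle)"
  by (simp add: circle_measure_def sets_restrict_space)

lemma sets_circle_iff: "A \<in> sets circle_measure \<longleftrightarrow> A \<in> sets borel \<and> A \<subseteq> circle"
  unfolding sets_circle_measure by (subst sets_restrict_space_iff) auto

lemma emeasure_circle: "A \<subseteq> circle \<Longrightarrow> emeasure circle_measure A = emeasure lborel A"
  unfolding circle_measure_def by (rule emeasure_restrict_space) auto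

lemma prob_space_circle: "prob_space circle_measure"
  by (rule prob_spaceI) (simp add: emeasure_circle, simp add: circle_def)

lemma measurable_into_circle:
  "g \<in> M \<rightarrow>\<^sub>M borel \<Longrightarrow> (\<And>x. x \<in> space M \<Longrightarrow> g x \<in> circle) \<Longrightarrow> g \<in> M \<rightarrow>\<^sub>M circle_measure"
  by (subst measurable_cong_sets[OF refl sets_circle_measure]) (auto intro!: measurable_restrict_space2)

lemma measurable_from_circle: "g \<in> borel \<rightarrow>\<^sub>M M \<Longrightarrow> g \<in> circle_measure \<rightarrow>\<^sub>M M"
  by (subst measurable_cong_sets[OF sets_circle_measure refl]) (rule measurable_restrict_space1)

lemma frac_borel [measurable]: "frac \<in> borel_measurable (borel :: real measure)"
  unfolding frac_def[abs_def] by measurable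

lemma emeasure_lborel_shift: "B \<in> sets borel \<Longrightarrow> emeasure lborel {x. x + c \<in> B} = emeasure lborel (B :: real set)"
proof -
  assume [measurable]: "B \<in> sets borel"
  have "emeasure lborel B = emeasure (distr lborel borel ((+) c)) B" by (simp add: lborel_distr_plus)
  also have "\<dots> = emeasure lborel {x. x + c \<in> B}"
    by (subst emeasure_distr) (auto simp: vimage_def add.commute)
  finally show ?thesis by simp
qed

lemma rotation_measurable [measurable]: "(\<lambda>x. frac (x + \<beta>)) \<in> circle_measure \<rightarrow>\<^sub>M circle_measure"
  by (rule measurable_into_circle, rule measurable_from_circle) auto

lemma rotation_preserves: "distr circle_measure circle_measure (\<lambda>x. frac (x + \<beta>)) = circle_measure"
proof (rule measure_eqI)
  fix A assume "A \<in> sets (distr circle_measure circle_measure (\<lambda>x. frac (x + \<beta>)))"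
  then have A: "A \<in> sets circle_measure" by simp
  then have [measurable]: "A \<in> sets borel" and sub: "A \<subseteq> circle" by (auto simp: sets_circle_iff)
  define b where "b = frac \<beta>"
  have b: "0 \<le> b" "b < 1" by (auto simp: b_def frac_lt_1)
  have fb: "frac (x + \<beta>) = frac (x + b)" for x by (simp add: b_def)
  define A1 where "A1 = A \<inter> {b..<1}"
  define A2 where "A2 = A \<inter> {0..<b}"
  have [measurable]: "A1 \<in> sets borel" "A2 \<in> sets borel" by (auto simp: A1_def A2_def)
  have frc: "x \<in> circle \<Longrightarrow> frac (x + b) = (if x + b < 1 then x + b else x + (b - 1))" for x
    using b by (auto simp: circle_iff frac_unique_iff)
  have pre: "(\<lambda>x. frac (x + \<beta>)) -` A \<inter> space circle_measure = {x. x + b \<in> A1} \<union> {x. x + (b - 1) \<in> A2}"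
  proof (intro set_eqI iffI)
    fix x assume "x \<in> (\<lambda>x. frac (x + \<beta>)) -` A \<inter> space circle_measure"
    then show "x \<in> {x. x + b \<in> A1} \<union> {x. x + (b - 1) \<in> A2}"
      using b by (auto simp: fb frc A1_def A2_def circle_iff split: if_splits)
  next
    fix x assume "x \<in> {x. x + b \<in> A1} \<union> {x. x + (b - 1) \<in> A2}"
    moreover from this have "x \<in> circle" using b by (auto simp: A1_def A2_def circle_iff)
    ultimately show "x \<in> (\<lambda>x. frac (x + \<beta>)) -` A \<inter> space circle_measure"
      using b by (auto simp: fb frc A1_def A2_def circle_iff split: if_splits)
  qed
  have m: "{x. x + b \<in> A1} \<in> sets borel" "{x. x + (b - 1) \<in> A2} \<in> sets borel" by measurable
  have "emeasure (distr circle_measure circle_measure (\<lambda>x. frac (x + \<beta>))) A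
      = emeasure circle_measure ({x. x + b \<in> A1} \<union> {x. x + (b - 1) \<in> A2})"
    using A by (subst emeasure_distr) (simp_all add: pre[symmetric])
  also have "\<dots> = emeasure lborel ({x. x + b \<in> A1} \<union> {x. x + (b - 1) \<in> A2})"
    using pre by (intro emeasure_circle) auto
  also have "\<dots> = emeasure lborel {x. x + b \<in> A1} + emeasure lborel {x. x + (b - 1) \<in> A2}"
    using m by (intro plus_emeasure[symmetric]) (auto simp: A1_def A2_def)
  also have "\<dots> = emeasure lborel A1 + emeasure lborel A2" by (simp only: emeasure_lborel_shift[OF \<open>A1 \<in> sets borel\<close>] emeasure_lborel_shift[OF \<open>A2 \<in> sets borel\<close>])
  also have "\<dots> = emeasure lborel (A1 \<union> A2)" by (intro plus_emeasure) (auto simp: A1_def A2_def)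
  also have "A1 \<union> A2 = A" using sub b by (auto simp: A1_def A2_def circle_iff)
  finally show "emeasure (distr circle_measure circle_measure (\<lambda>x. frac (x + \<beta>))) A = emeasure circle_measure A"
    using sub by (simp add: emeasure_circle)
qed simp

lemma nn_integral_rotation:
  "g \<in> borel_measurable circle_measure \<Longrightarrow>
    (\<integral>\<^sup>+x. g (frac (x + \<beta>)) \<partial>circle_measure) = (\<integral>\<^sup>+x. g x \<partial>circle_measure)"
  by (subst (2) rotation_preserves[of \<beta>, symmetric]) (simp add: nn_integral_distr)

context denominators
begin

text \<open>Rotation ergodicity\<close>

lemma rotation_ergodic:
  assumes A: "A \<in> sets circle_measure" and inv: "\<And>x. x \<in> circle \<Longrightarrow> rotation \<alpha> x \<in> A \<longleftrightarrow> x \<in> A"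
  shows "measure circle_measure A = 0 \<or> measure circle_measure A = 1"
proof -
  have [measurable]: "A \<in> sets borel" and sub: "A \<subseteq> circle" using A by (auto simp: sets_circle_iff)
  define E where "E = {x. frac x \<in> A}"
  have [measurable]: "E \<in> sets borel" unfolding E_def by measurable
  have E1: "x + \<alpha> \<in> E \<longleftrightarrow> x \<in> E" for x
    using inv[of "frac x"] by (simp add: E_def rotation_def)
  have Eint: "x + of_int m \<in> E \<longleftrightarrow> x \<in> E" for x m by (simp add: E_def)
  have Ek: "x + (real k * \<alpha> + of_int m) \<in> E \<longleftrightarrow> x \<in> E" for x k m
  proof -
    have "x + real k * \<alpha> \<in> E \<longleftrightarrow> x \<in> E"
    proof (induction k)
      case (Suc k)
      then show ?case using E1[of "x + real k * \<alpha>"] by (simp add: algebra_simps)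
    qed simp
    then show ?thesis using Eint[of "x + real k * \<alpha>" m] by (simp add: add.assoc)
  qed
  define I where "I u t = measure lborel (E \<inter> {u..<u+t})" for u t
  have fin: "emeasure lborel (E \<inter> {u..<v}) < \<infinity>" for u v
    by (rule le_less_trans[OF emeasure_mono[of _ "{u..v}"]]) (auto simp: emeasure_lborel_Icc_eq)
  have fm: "E \<inter> {u..<v} \<in> fmeasurable lborel" for u v using fin by (auto simp: fmeasurable_def)
  have I_split: "I u (s + t) = I u s + I (u + s) t" if "0 \<le> s" "0 \<le> t" for u s t
  proof -
    have "E \<inter> {u..<u+(s+t)} = (E \<inter> {u..<u+s}) \<union> (E \<inter> {u+s..<u+s+t})" using that by auto
    moreover have "(E \<inter> {u..<u+s}) \<inter> (E \<inter> {u+s..<u+s+t}) = {}" by auto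
    ultimately show ?thesis
      using measure_Un3[OF fm fm, of u "u + s" "u + s" "u + s + t"] by (simp add: I_def)
  qed
  have I_nonneg: "0 \<le> I u t" for u t by (simp add: I_def)
  have I_le: "I u t \<le> t" if "0 \<le> t" for u t
  proof -
    have "I u t \<le> measure lborel {u..<u+t}" unfolding I_def
      using that by (intro measure_mono_fmeasurable) (auto simp: fmeasurable_def)
    then show ?thesis using that by simp
  qed
  have I_shift: "I (u + (real k * \<alpha> + of_int m)) t = I u t" for u t k m
  proof -
    define c where "c = real k * \<alpha> + of_int m"
    have "{x. x + c \<in> E \<inter> {u + c..<u + c + t}} = E \<inter> {u..<u+t}" using Ek[of _ k m] by (auto simp: c_def)
    then show ?thesis
      using emeasure_lborel_shift[of "E \<inter> {u + c..<u + c + t}" c] by (simp add: I_def measure_def flip: c_def)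
  qed
  have I_lip: "\<bar>I u t - I v t\<bar> \<le> 2 * \<bar>u - v\<bar>" if "0 \<le> t" for u v t
  proof -
    have "\<bar>I u t - I v t\<bar> \<le> 2 * (v - u)" if "u \<le> v" for u v
    proof -
      have "I u ((v - u) + t) = I u (v - u) + I v t" using I_split[of "v - u" t u] that \<open>0 \<le> t\<close> by simp
      moreover have "I u (t + (v - u)) = I u t + I (u + t) (v - u)" using I_split[of t "v - u" u] that \<open>0 \<le> t\<close> by simp
      ultimately show ?thesis
        using I_nonneg[of u "v - u"] I_nonneg[of "u + t" "v - u"] I_le[of "v - u" u] I_le[of "v - u" "u + t"] that
        by (simp add: add.commute)
    qed
    from this[of u v] this[of v u] show ?thesis by (cases "u \<le> v") (auto simp: abs_minus_commute)
  qed
  have I_const: "I u t = I 0 t" if t: "0 \<le> t" for u t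
  proof -
    have "\<bar>I u t - I 0 t\<bar> \<le> e" if "0 < e" for e
    proof -
      obtain h k where hk: "k > 0" "\<bar>of_int k * \<alpha> - of_int h - u\<bar> < e / 2"
        by (rule sequence_of_fractional_parts_is_dense[OF irrational, of "e / 2" u]) (use \<open>0 < e\<close> in auto)
      have "I (0 + (real (nat k) * \<alpha> + of_int (- h))) t = I 0 t" by (rule I_shift)
      moreover have "\<bar>I u t - I (real (nat k) * \<alpha> + of_int (- h)) t\<bar> \<le> 2 * \<bar>u - (real (nat k) * \<alpha> + of_int (- h))\<bar>"
        by (rule I_lip[OF t])
      ultimately show ?thesis using hk by (simp add: abs_minus_commute)
    qed
    then have "\<bar>I u t - I 0 t\<bar> \<le> 0" by (rule field_le_epsilon[where y = 0, simplified]) 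
    then show ?thesis by simp
  qed
  define c where "c = I 0 1"
  have add: "I 0 (s + t) = I 0 s + I 0 t" if "0 \<le> s" "0 \<le> t" for s t
    using I_split[OF that, of 0] I_const[OF that(2), of s] by simp
  have mult: "I 0 (real n * t) = real n * I 0 t" if "0 \<le> t" for n t
  proof (induction n)
    case (Suc n)
    then show ?case using add[of t "real n * t"] that by (simp add: algebra_simps)
  qed (simp add: I_def)
  have lin: "I 0 t = c * t" if t: "0 \<le> t" for t
  proof -
    have c01: "0 \<le> c" "c \<le> 1" using I_nonneg[of 0 1] I_le[of 1 0] by (auto simp: c_def)
    have b: "\<bar>I 0 t - c * t\<bar> \<le> 1" if "0 \<le> t" for t
    proof -
      define k where "k = nat \<lfloor>t\<rfloor>"
      have k: "real k \<le> t" "t - real k \<le> 1" unfolding k_def using that by linarith+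
      have "I 0 t = I 0 (real k) + I 0 (t - real k)" using add[of "real k" "t - real k"] k by simp
      moreover have "I 0 (real k) = real k * c" using mult[of 1 k] by (simp add: c_def)
      moreover have "0 \<le> I 0 (t - real k)" "I 0 (t - real k) \<le> 1"
        using I_nonneg I_le[of "t - real k" 0] k by (auto intro: order_trans)
      moreover have "0 \<le> c * (t - real k)" "c * (t - real k) \<le> 1"
        using c01 k by (auto intro: mult_nonneg_nonneg mult_le_one)
      ultimately show ?thesis by (simp add: algebra_simps)
    qed
    have "real n * \<bar>I 0 t - c * t\<bar> \<le> 1" for n
    proof -
      have "real n * \<bar>I 0 t - c * t\<bar> = \<bar>real n * I 0 t - c * (real n * t)\<bar>"
        by (subst abs_of_nat[symmetric], subst abs_mult[symmetric]) (simp add: algebra_simps)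
      also have "\<dots> \<le> 1" using b[of "real n * t"] mult[OF t, of n] t by simp
      finally show ?thesis .
    qed
    then have "\<bar>I 0 t - c * t\<bar> \<le> 0"
      by (metis abs_ge_zero ex_less_of_nat_mult linorder_not_less)
    then show ?thesis by simp
  qed
  have AE: "E \<inter> circle = A" using sub by (auto simp: E_def frac_circle)
  have cA: "measure circle_measure A = c"
    using sub AE by (simp add: c_def I_def measure_def emeasure_circle circle_def)
  show ?thesis
  proof (cases "c = 0")
    case False
    then have c: "0 < c" using I_nonneg[of 0 1] by (simp add: c_def)
    define M' where "M' = density lborel (\<lambda>x. ennreal (1 / c) * indicator E x)"
    have em: "emeasure M' B = ennreal (1 / c) * emeasure lborel (E \<inter> B)" if "B \<in> sets borel" for B
      using that by (simp add: M'_def emeasure_density nn_integral_cmult mult.assoc flip: indicator_inter_arith)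
    have "lborel = M'"
    proof (rule lborel_eqI)
      fix l u :: real assume "\<And>b. b \<in> Basis \<Longrightarrow> l \<bullet> b \<le> u \<bullet> b"
      then have lu: "l \<le> u" by simp
      have "emeasure lborel (E \<inter> {l<..<u}) = emeasure lborel (E \<inter> {l..<l + (u - l)})"
        by (rule emeasure_eq_AE) (use AE_lborel_singleton[of l] in \<open>auto elim: eventually_mono\<close>)
      also have "\<dots> = ennreal (I l (u - l))" unfolding I_def
        using fin[of l "l + (u - l)"] by (intro emeasure_eq_ennreal_measure) (metis infinity_ennreal_def less_irrefl)
      also have "I l (u - l) = c * (u - l)" using I_const[of "u - l" l] lin[of "u - l"] lu by simp
      finally have "emeasure M' {l<..<u} = ennreal (1 / c) * ennreal (c * (u - l))" by (simp add: em)
      also have "\<dots> = ennreal (u - l)" using c lu by (simp flip: ennreal_mult)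
      finally show "emeasure M' (box l u) = ennreal (\<Prod>b\<in>Basis. (u - l) \<bullet> b)" by (simp add: box_real)
    qed (simp add: M'_def)
    then have "emeasure lborel (circle - A) = emeasure M' (circle - A)" by simp
    also have "\<dots> = ennreal (1 / c) * emeasure lborel (E \<inter> (circle - A))" by (intro em) auto
    also have "E \<inter> (circle - A) = {}" using AE by auto
    finally have "measure circle_measure (circle - A) = 0"
      by (simp add: measure_def emeasure_circle)
    then show ?thesis using prob_space.prob_compl[OF prob_space_circle A] by simp
  qed (simp add: cA)
qed

end


lemma borel_pair_Collect:
  "Measurable.pred (borel \<Otimes>\<^sub>M borel) (\<lambda>z. P (fst z) (snd z)) \<Longrightarrow>
    {(x, s). P x s} \<in> sets (borel :: (real \<times> real) measure)"
proof -
  assume "Measurable.pred (borel \<Otimes>\<^sub>M borel) (\<lambda>z. P (fst z) (snd z))"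
  then have "{z. P (fst z) (snd z)} \<in> sets (borel :: (real \<times> real) measure)"
    by (simp add: pred_def space_pair_measure borel_prod)
  moreover have "{(x, s). P x s} = {z. P (fst z) (snd z)}" by auto
  ultimately show ?thesis by simp
qed

locale roof_flow = denominators +
  fixes f :: "real \<Rightarrow> real" and S :: "real set"
  assumes periodic: "\<And>x. f (x + 1) = f x"
    and pos: "\<And>x. 0 < f x"
    and finite_S: "finite S"
    and cont: "\<And>x. frac x \<notin> S \<Longrightarrow> isCont f x"
    and f_integrable: "integrable circle_measure f"
begin

lemma f_add_int [simp]: "f (x + of_int m) = f x"
proof -
  have nat: "f (x + real n) = f x" for x n
  proof (induction n)
    case (Suc n)
    then show ?case using periodic[of "x + real n"] by (simp add: add_ac)
  qed simp
  show ?thesis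
  proof (cases "0 \<le> m")
    case True
    then show ?thesis using nat[of x "nat m"] by simp
  next
    case False
    then show ?thesis using nat[of "x + of_int m" "nat (- m)"] by simp
  qed
qed

lemma f_frac [simp]: "f (frac x) = f x"
  by (simp only: frac_eq_minus_floor f_add_int)

lemma f_frac_add [simp]: "f (frac x + y) = f (x + y)"
  by (metis f_frac frac_add_simps(1))

lemma f_measurable [measurable]: "f \<in> borel_measurable borel"
proof -
  have "frac \<in> borel \<rightarrow>\<^sub>M circle_measure" by (rule measurable_into_circle) auto
  moreover have "f \<in> borel_measurable circle_measure" using f_integrable by auto
  ultimately have "(\<lambda>x. f (frac x)) \<in> borel_measurable borel" by (rule measurable_compose)
  then show ?thesis by simp
qed

subsection \<open>Cocycle\<close>

definition bsum :: "int \<Rightarrow> real \<Rightarrow> real" where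
  "bsum n x = (if 0 \<le> n then \<Sum>i\<in>{0..<n}. f (x + of_int i * \<alpha>)
               else - (\<Sum>i\<in>{n..<0}. f (x + of_int i * \<alpha>)))"

lemma bsum_0 [simp]: "bsum 0 x = 0" by (simp add: bsum_def)

lemma bsum_Suc: "bsum (n + 1) x = bsum n x + f (x + of_int n * \<alpha>)"
proof (cases "0 \<le> n")
  case True
  then have "{0..<n + 1} = insert n {0..<n}" by auto
  then show ?thesis using True by (simp add: bsum_def)
next
  case False
  then have "{n..<0} = insert n {n + 1..<0}" by auto
  then show ?thesis using False by (cases "n = - 1") (auto simp: bsum_def)
qed

lemma bsum_add: "bsum (m + n) x = bsum m x + bsum n (x + of_int m * \<alpha>)"
proof (induction n rule: int_induct[where k = 0])
  case (step1 i)
  then show ?case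
    using bsum_Suc[of "m + i" x] bsum_Suc[of i "x + of_int m * \<alpha>"] by (simp add: algebra_simps)
next
  case (step2 i)
  then show ?case
    using bsum_Suc[of "m + (i - 1)" x] bsum_Suc[of "i - 1" "x + of_int m * \<alpha>"]
    by (simp add: algebra_simps)
qed simp

lemma bsum_frac [simp]: "bsum n (frac x) = bsum n x"
  by (simp add: bsum_def)

lemma bsum_frac_add [simp]: "bsum n (frac x + y) = bsum n (x + y)"
  by (metis bsum_frac frac_add_simps(1))

lemma bsum_minus: "bsum (- n) (x + of_int n * \<alpha>) = - bsum n x"
  using bsum_add[of n "- n" x] by simp

lemma bsum_minus_Suc: "bsum (- n + 1) (x + of_int n * \<alpha>) = f x - bsum n x"
  using bsum_Suc[of "- n" "x + of_int n * \<alpha>"] by (simp add: bsum_minus)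

lemma bsum_mono_strict: "m < n \<Longrightarrow> bsum m x < bsum n x"
proof -
  assume "m < n"
  then have "0 < bsum (n - m) (x + of_int m * \<alpha>)" by (auto simp: bsum_def pos intro!: sum_pos)
  then show ?thesis using bsum_add[of m "n - m" x] by simp
qed

lemma bsum_mono: "m \<le> n \<Longrightarrow> bsum m x \<le> bsum n x"
  using bsum_mono_strict[of m n x] by (cases "m = n") auto

lemma bsum_less_iff: "bsum m x < bsum n x \<longleftrightarrow> m < n"
  using bsum_mono_strict[of m n x] bsum_mono[of n m x] by linarith

lemma bsum_measurable [measurable]: "bsum n \<in> borel_measurable borel"
  unfolding bsum_def[abs_def] by (cases "0 \<le> n") (simp_all, measurable)

lemma bsum_growth:
  obtains c :: real and Q :: nat where "0 < c" "0 < Q"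
    and "\<And>m j x. bsum m x + real j * c \<le> bsum (m + int (j * Q)) x"
proof -
  have "infinite ({0<..<1::real} - S)" using finite_S by (simp add: Diff_infinite_finite)
  then obtain y where y: "0 < y" "y < 1" "y \<notin> S" by (metis Diff_iff finite.emptyI greaterThanLessThan_iff ex_in_conv)
  then have "isCont f y" by (intro cont) (simp add: frac_eq[THEN iffD2])
  then have "f \<midarrow>y\<rightarrow> f y" by (simp add: isCont_def)
  then have "\<forall>\<^sub>F z in at y. f y / 2 < f z" by (rule order_tendstoD) (use pos[of y] in simp)
  then obtain e where e0: "0 < e" "\<And>z. z \<noteq> y \<Longrightarrow> \<bar>z - y\<bar> < e \<Longrightarrow> f y / 2 < f z"
    by (auto simp: eventually_at dist_real_def)
  have e: "0 < e" "\<And>z. \<bar>z - y\<bar> < e \<Longrightarrow> f y / 2 < f z"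
    using e0 pos[of y] by (metis, metis half_gt_zero less_add_same_cancel1 field_sum_of_halves)
  define e' where "e' = min e (min y (1 - y))"
  have e': "0 < e'" "e' \<le> e" "e' \<le> y" "e' \<le> 1 - y" using e y by (auto simp: e'_def)
  obtain Q where Q: "\<And>\<theta>. \<exists>i<Q. y - e' < frac (\<theta> + real i * \<alpha>) \<and> frac (\<theta> + real i * \<alpha>) < y + e'"
    by (rule uniformly_recurrent[of "y - e'" "y + e'"]) (use e' in auto)
  have Q0: "0 < Q" using Q[of 0] by auto
  have one: "f y / 2 \<le> bsum (int Q) x" for x
  proof -
    obtain i where i: "i < Q" "\<bar>frac (x + real i * \<alpha>) - y\<bar> < e" using Q[of x] e' by fastforce
    have "f y / 2 \<le> f (x + of_int (int i) * \<alpha>)" using e(2)[OF i(2)] by simp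
    also have "\<dots> \<le> (\<Sum>i\<in>{0..<int Q}. f (x + of_int i * \<alpha>))"
      using i pos by (intro member_le_sum) (auto intro: less_imp_le)
    finally show ?thesis by (simp add: bsum_def)
  qed
  have "bsum m x + real j * (f y / 2) \<le> bsum (m + int (j * Q)) x" for m j x
  proof (induction j)
    case (Suc j)
    have "bsum (m + int (Suc j * Q)) x = bsum (m + int (j * Q)) x + bsum (int Q) (x + of_int (m + int (j * Q)) * \<alpha>)"
      using bsum_add[of "m + int (j * Q)" "int Q" x] by (simp add: algebra_simps)
    moreover have "real (Suc j) * (f y / 2) = real j * (f y / 2) + f y / 2" by (simp add: field_simps)
    ultimately show ?case using Suc one[of "x + of_int (m + int (j * Q)) * \<alpha>"] by linarith
  qed simp
  with Q0 pos[of y] show thesis by (intro that[of "f y / 2" Q]) auto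
qed

lemma height_index: "\<exists>!n. bsum n x \<le> t \<and> t < bsum (n + 1) x"
proof (rule ex_ex1I)
  obtain c Q where c: "0 < c" "0 < Q" "\<And>m j x. bsum m x + real j * c \<le> bsum (m + int (j * Q)) x"
    using bsum_growth by blast
  obtain j :: nat where j: "\<bar>t\<bar> < real j * c" using ex_less_of_nat_mult[OF c(1)] by blast
  have lo: "bsum (- int (j * Q)) x \<le> t" using c(3)[of "- int (j * Q)" x j] j by simp
  have hi: "t < bsum (int (j * Q)) x" using c(3)[of 0 x j] j by simp
  define F where "F = {n \<in> {- int (j * Q)..int (j * Q)}. bsum n x \<le> t}"
  have "- int (j * Q) \<in> F" using lo by (simp add: F_def)
  moreover have "finite F" unfolding F_def by (rule finite_subset[of _ "{- int (j * Q)..int (j * Q)}"]) auto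
  ultimately have F: "finite F" "F \<noteq> {}" by auto
  define n where "n = Max F"
  have n: "n \<in> F" unfolding n_def using F by (rule Max_in)
  have "n + 1 \<notin> F" using Max_ge[OF F(1), of "n + 1"] by (auto simp: n_def)
  moreover have "n \<noteq> int (j * Q)" using n hi by (auto simp: F_def)
  ultimately have "t < bsum (n + 1) x" using n by (auto simp: F_def)
  then show "\<exists>n. bsum n x \<le> t \<and> t < bsum (n + 1) x" using n by (auto simp: F_def)
next
  fix m n assume "bsum m x \<le> t \<and> t < bsum (m + 1) x" "bsum n x \<le> t \<and> t < bsum (n + 1) x"
  then have "bsum m x < bsum (n + 1) x" "bsum n x < bsum (m + 1) x" by linarith+
  then show "m = n" by (simp add: bsum_less_iff)
qed

definition idx :: "real \<Rightarrow> real \<Rightarrow> int" where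
  "idx x t = (THE n. bsum n x \<le> t \<and> t < bsum (n + 1) x)"

lemma idx:
  fixes x t :: real
  shows "bsum (idx x t) x \<le> t \<and> t < bsum (idx x t + 1) x"
  using theI'[OF height_index[of x t]] by (auto simp: idx_def)

lemma idx_eq_iff: "idx x t = n \<longleftrightarrow> bsum n x \<le> t \<and> t < bsum (n + 1) x"
  using height_index[of x t] idx[of x t] by auto

subsection \<open>The flow\<close>

lemma rotation_funpow: "x \<in> circle \<Longrightarrow> (rotation \<alpha> ^^ n) x = frac (x + real n * \<alpha>)"
  by (induction n) (simp_all add: frac_circle rotation_def algebra_simps)

lemma rotation_inj: "inj_on (rotation \<alpha>) circle"
proof (rule inj_onI)
  fix x y assume xy: "x \<in> circle" "y \<in> circle" "rotation \<alpha> x = rotation \<alpha> y"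
  have "frac (frac (x + \<alpha>) + - \<alpha>) = frac (frac (y + \<alpha>) + - \<alpha>)" using xy by (simp add: rotation_def)
  then show "x = y" using xy unfolding frac_add_simps by (simp add: frac_circle)
qed

lemma inv_rotation: "y \<in> circle \<Longrightarrow> inv_into circle (rotation \<alpha>) y = frac (y - \<alpha>)"
proof (rule inv_into_f_eq[OF rotation_inj])
  assume y: "y \<in> circle"
  have "rotation \<alpha> (frac (y - \<alpha>)) = frac (frac (y - \<alpha>) + \<alpha>)" by (simp add: rotation_def)
  also have "\<dots> = frac y" unfolding frac_add_simps by simp
  finally show "rotation \<alpha> (frac (y - \<alpha>)) = y" using y by (simp add: frac_circle)
qed simp

lemma inv_rotation_funpow:
  "x \<in> circle \<Longrightarrow> (inv_into circle (rotation \<alpha>) ^^ n) x = frac (x - real n * \<alpha>)"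
proof (induction n)
  case (Suc n)
  have "frac (frac (x - real n * \<alpha>) - \<alpha>) = frac (x - real (Suc n) * \<alpha>)"
    using frac_add_simps(1)[of "x - real n * \<alpha>" "- \<alpha>"] by (simp add: algebra_simps)
  then show ?case using Suc by (simp add: inv_rotation)
qed (simp add: frac_circle)

lemma int_iterate_rotation: "x \<in> circle \<Longrightarrow> int_iterate circle (rotation \<alpha>) n x = frac (x + of_int n * \<alpha>)"
  by (simp add: int_iterate_def rotation_funpow inv_rotation_funpow)

lemma birkhoff_sum_eq: "x \<in> circle \<Longrightarrow> birkhoff_sum circle (rotation \<alpha>) f n x = bsum n x"
  by (simp add: birkhoff_sum_def bsum_def int_iterate_rotation)

abbreviation "Xf \<equiv> special_flow_space circle f"
abbreviation "Fl \<equiv> special_flow circle (rotation \<alpha>) f"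
abbreviation "MF \<equiv> special_flow_measure circle_measure f"

lemma Xf_iff: "(x, s) \<in> Xf \<longleftrightarrow> x \<in> circle \<and> 0 \<le> s \<and> s < f x"
  by (simp add: special_flow_space_def)

definition flow_at :: "int \<Rightarrow> real \<Rightarrow> real \<times> real \<Rightarrow> real \<times> real" where
  "flow_at n t = (\<lambda>(x, s). (frac (x + of_int n * \<alpha>), t + s - bsum n x))"

lemma flow_idx: "x \<in> circle \<Longrightarrow> Fl t (x, s) = flow_at (idx x (t + s)) t (x, s)"
  by (simp add: special_flow_def birkhoff_sum_eq int_iterate_rotation idx_def flow_at_def Let_def)

lemma flow_eq:
  assumes "x \<in> circle" "bsum n x \<le> t + s" "t + s < bsum (n + 1) x"
  shows "Fl t (x, s) = (frac (x + of_int n * \<alpha>), t + s - bsum n x)"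
proof -
  have "idx x (t + s) = n" using assms by (simp add: idx_eq_iff)
  then show ?thesis using assms by (simp add: flow_idx flow_at_def)
qed

lemma flow_in_space: "z \<in> Xf \<Longrightarrow> Fl t z \<in> Xf"
proof (cases z)
  case (Pair x s)
  assume "z \<in> Xf"
  then show ?thesis
    using idx[of x "t + s"] Pair bsum_Suc[of "idx x (t + s)" x]
    by (simp add: flow_idx flow_at_def Xf_iff)
qed

lemma flow_vertical: "(x, s) \<in> Xf \<Longrightarrow> 0 \<le> s + t \<Longrightarrow> s + t < f x \<Longrightarrow> Fl t (x, s) = (x, s + t)"
  using flow_eq[of x 0 t s] bsum_Suc[of 0 x] by (simp add: Xf_iff frac_circle add.commute)

lemma flow_0: "z \<in> Xf \<Longrightarrow> Fl 0 z = z"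
  using flow_vertical[of "fst z" "snd z" 0] by (cases z) (simp add: Xf_iff)

lemma flow_add: "z \<in> Xf \<Longrightarrow> Fl (r + t) z = Fl r (Fl t z)"
proof (cases z)
  case (Pair x s)
  assume z: "z \<in> Xf"
  then have x: "x \<in> circle" using Pair by (simp add: Xf_iff)
  define n where "n = idx x (t + s)"
  define x' where "x' = frac (x + of_int n * \<alpha>)"
  define s' where "s' = t + s - bsum n x"
  define m where "m = idx x' (r + s')"
  have F1: "Fl t z = (x', s')" using x Pair by (simp add: flow_idx flow_at_def n_def x'_def s'_def)
  have m: "bsum m x' \<le> r + s'" "r + s' < bsum (m + 1) x'" using idx[of x' "r + s'"] by (simp_all add: m_def)
  have bx: "bsum j x' = bsum (n + j) x - bsum n x" for j
    by (simp add: x'_def bsum_add[of n j x])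
  have "Fl (r + t) (x, s) = (frac (x + of_int (n + m) * \<alpha>), r + t + s - bsum (n + m) x)"
  proof (rule flow_eq[OF x])
    show "bsum (n + m) x \<le> r + t + s" using m bx[of m] by (simp add: s'_def)
    show "r + t + s < bsum (n + m + 1) x" using m bx[of "m + 1"] by (simp add: s'_def add.assoc)
  qed
  moreover have "Fl r (x', s') = (frac (x' + of_int m * \<alpha>), r + s' - bsum m x')"
    by (rule flow_eq[OF _ m]) (simp add: x'_def)
  moreover have "frac (x' + of_int m * \<alpha>) = frac (x + of_int (n + m) * \<alpha>)"
    by (simp add: x'_def algebra_simps)
  ultimately show ?thesis using F1 Pair bx[of m] by (simp add: s'_def)
qed

subsection \<open>The measure\<close>

abbreviation "PM \<equiv> circle_measure \<Otimes>\<^sub>M (lborel :: real measure)"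

lemma space_PM [simp]: "space PM = circle \<times> UNIV" by (simp add: space_pair_measure)

lemma sets_PM_iff: "A \<in> sets PM \<longleftrightarrow> A \<in> sets (borel :: (real \<times> real) measure) \<and> A \<subseteq> circle \<times> UNIV"
proof -
  have cU: "circle \<times> (UNIV :: real set) \<in> sets (borel :: (real \<times> real) measure)"
    unfolding borel_prod[symmetric] by (rule pair_measureI) auto
  have 1: "(\<lambda>x. x) \<in> PM \<rightarrow>\<^sub>M (borel :: (real \<times> real) measure)"
  proof -
    have "(\<lambda>z. (fst z, snd z)) \<in> PM \<rightarrow>\<^sub>M (borel \<Otimes>\<^sub>M borel :: (real \<times> real) measure)"
    proof (rule measurable_Pair)
      show "fst \<in> PM \<rightarrow>\<^sub>M borel"
        using measurable_compose[OF measurable_fst measurable_from_circle[of "\<lambda>x. x" borel]] by simp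
      show "snd \<in> PM \<rightarrow>\<^sub>M borel" using measurable_snd[of circle_measure lborel] by simp
    qed
    then show ?thesis by (simp add: borel_prod)
  qed
  have 2: "(\<lambda>x. x) \<in> restrict_space (borel :: (real \<times> real) measure) (circle \<times> UNIV) \<rightarrow>\<^sub>M PM"
  proof -
    have "(\<lambda>z. (fst z, snd z)) \<in> restrict_space (borel :: (real \<times> real) measure) (circle \<times> UNIV) \<rightarrow>\<^sub>M PM"
    proof (rule measurable_Pair)
      have f: "fst \<in> restrict_space (borel :: (real \<times> real) measure) (circle \<times> UNIV) \<rightarrow>\<^sub>M borel"
        by (rule measurable_restrict_space1) (simp add: borel_measurable_continuous_onI continuous_on_fst)
      show "fst \<in> restrict_space (borel :: (real \<times> real) measure) (circle \<times> UNIV) \<rightarrow>\<^sub>M circle_measure"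
        by (rule measurable_into_circle[OF f]) (auto simp: space_restrict_space)
      show "snd \<in> restrict_space (borel :: (real \<times> real) measure) (circle \<times> UNIV) \<rightarrow>\<^sub>M lborel"
        by (simp, rule measurable_restrict_space1) (simp add: borel_measurable_continuous_onI continuous_on_snd)
    qed
    then show ?thesis by simp
  qed
  show ?thesis
  proof
    assume A: "A \<in> sets PM"
    have "A \<subseteq> circle \<times> UNIV" using sets.sets_into_space[OF A] by simp
    moreover have "A \<in> sets (restrict_space (borel :: (real \<times> real) measure) (circle \<times> UNIV))"
      using measurable_sets[OF 2 A] \<open>A \<subseteq> circle \<times> UNIV\<close> by (simp add: space_restrict_space Int_absorb2)
    ultimately show "A \<in> sets (borel :: (real \<times> real) measure) \<and> A \<subseteq> circle \<times> UNIV"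
      using cU by (simp add: sets_restrict_space_iff)
  next
    assume "A \<in> sets (borel :: (real \<times> real) measure) \<and> A \<subseteq> circle \<times> UNIV"
    then show "A \<in> sets PM" using measurable_sets[OF 1, of A] by (simp add: Int_absorb2)
  qed
qed

lemma sets_PM_iff': "A \<in> sets (circle_measure \<Otimes>\<^sub>M borel) \<longleftrightarrow>
    A \<in> sets (borel :: (real \<times> real) measure) \<and> A \<subseteq> circle \<times> (UNIV :: real set)"
  using sets_PM_iff[of A] by simp

lemma Xf_borel [measurable]: "Xf \<in> sets (borel :: (real \<times> real) measure)"
  unfolding special_flow_space_def by (rule borel_pair_Collect) measurable

lemma Xf_sub: "Xf \<subseteq> circle \<times> UNIV" by (auto simp: Xf_iff)

lemma Xf_PM: "Xf \<in> sets PM" by (simp add: sets_PM_iff' Xf_sub)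

lemma space_MF [simp]: "space MF = Xf"
  using Xf_sub by (auto simp: special_flow_measure_def Let_def space_restrict_space)

lemma sets_MF_iff: "A \<in> sets MF \<longleftrightarrow> A \<in> sets (borel :: (real \<times> real) measure) \<and> A \<subseteq> Xf"
proof -
  have "A \<in> sets MF \<longleftrightarrow> A \<in> sets (restrict_space PM Xf)"
    by (simp add: special_flow_measure_def Let_def)
  also have "\<dots> \<longleftrightarrow> A \<in> sets PM \<and> A \<subseteq> Xf"
    using Xf_PM by (subst sets_restrict_space_iff) (auto simp: Int_absorb2 Xf_sub)
  finally show ?thesis using Xf_sub by (auto simp: sets_PM_iff')
qed

definition vol :: "(real \<times> real) set \<Rightarrow> ennreal" where
  "vol A = (\<integral>\<^sup>+x. emeasure lborel (Pair x -` A) \<partial>circle_measure)"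

lemma emeasure_PM: "A \<in> sets PM \<Longrightarrow> emeasure PM A = vol A"
  unfolding vol_def by (rule lborel.emeasure_pair_measure_alt)

definition mass :: real where "mass = integral\<^sup>L circle_measure f"

lemma vol_over: "B \<subseteq> circle \<Longrightarrow> B \<in> sets borel \<Longrightarrow>
   vol {(x, s) \<in> Xf. x \<in> B} = (\<integral>\<^sup>+x. ennreal (f x) * indicator B x \<partial>circle_measure)"
  unfolding vol_def
proof (rule nn_integral_cong)
  fix x assume "x \<in> space circle_measure"
  then have "Pair x -` {(x, s) \<in> Xf. x \<in> B} = (if x \<in> B then {0..<f x} else {})"
    by (auto simp: Xf_iff)
  then show "emeasure lborel (Pair x -` {(x, s) \<in> Xf. x \<in> B}) = ennreal (f x) * indicator B x"
    using pos[of x] by simp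
qed

lemma vol_Xf: "vol Xf = ennreal mass"
proof -
  have "Xf = {(x, s) \<in> Xf. x \<in> circle}" by (auto simp: Xf_iff)
  then have "vol Xf = (\<integral>\<^sup>+x. ennreal (f x) * indicator circle x \<partial>circle_measure)"
    using vol_over[of circle] by simp
  also have "\<dots> = (\<integral>\<^sup>+x. ennreal (f x) \<partial>circle_measure)" by (rule nn_integral_cong) simp
  also have "\<dots> = ennreal mass" unfolding mass_def
    using f_integrable pos by (intro nn_integral_eq_integral) (auto intro: less_imp_le)
  finally show ?thesis .
qed

lemma mass_pos: "0 < mass"
proof (rule ccontr)
  assume "\<not> 0 < mass"
  then have "integral\<^sup>L circle_measure f = 0"
    using Bochner_Integration.integral_nonneg[of circle_measure f] less_imp_le[OF pos]
    unfolding mass_def by (meson linorder_not_le order_antisym)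
  then have "AE x in circle_measure. f x = 0"
    using integral_nonneg_eq_0_iff_AE[OF f_integrable] pos by (auto intro: less_imp_le)
  then have "AE x in circle_measure. False" by eventually_elim (use pos in \<open>metis less_irrefl\<close>)
  then show False using prob_space.AE_False[OF prob_space_circle] by blast
qed

lemma emeasure_MF: "A \<in> sets MF \<Longrightarrow> emeasure MF A = vol A / ennreal mass"
proof -
  assume A: "A \<in> sets MF"
  have N: "space (restrict_space PM Xf) = Xf" using Xf_sub by (auto simp: space_restrict_space)
  have res: "emeasure (restrict_space PM Xf) B = vol B" if "B \<in> sets MF" for B
    using that Xf_PM Xf_sub
    by (subst emeasure_restrict_space) (auto simp: Int_absorb2 sets_MF_iff emeasure_PM sets_PM_iff')
  have A': "A \<subseteq> Xf" "A \<in> sets (restrict_space PM Xf)"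
    using A by (simp add: sets_MF_iff, simp add: special_flow_measure_def Let_def)
  have "Xf \<in> sets MF" by (simp add: sets_MF_iff)
  have "emeasure MF A = emeasure (restrict_space PM Xf) (Xf \<inter> A) / emeasure (restrict_space PM Xf) Xf"
    using A'(2) sets.top[of "restrict_space PM Xf"]
    by (simp add: special_flow_measure_def Let_def N emeasure_uniform_measure del: sets.top)
  also have "Xf \<inter> A = A" using A' by auto
  finally show ?thesis using res[OF A] res[OF \<open>Xf \<in> sets MF\<close>] by (simp add: vol_Xf)
qed

lemma prob_space_MF: "prob_space MF"
proof (rule prob_spaceI)
  have "Xf \<in> sets MF" by (simp add: sets_MF_iff)
  then have "emeasure MF Xf = ennreal mass / ennreal mass" by (simp add: emeasure_MF vol_Xf)
  then show "emeasure MF (space MF) = 1" using mass_pos by simp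
qed

lemma measurable_into_MF:
  "g \<in> N \<rightarrow>\<^sub>M (borel :: (real \<times> real) measure) \<Longrightarrow> (\<And>x. x \<in> space N \<Longrightarrow> g x \<in> Xf) \<Longrightarrow> g \<in> N \<rightarrow>\<^sub>M MF"
proof (rule measurableI)
  fix A assume g: "g \<in> N \<rightarrow>\<^sub>M (borel :: (real \<times> real) measure)" and "A \<in> sets MF"
  then show "g -` A \<inter> space N \<in> sets N" by (intro measurable_sets[OF g]) (simp add: sets_MF_iff)
qed simp

lemma measurable_from_MF: "g \<in> (borel :: (real \<times> real) measure) \<rightarrow>\<^sub>M N \<Longrightarrow> g \<in> MF \<rightarrow>\<^sub>M N"
proof (rule measurableI)
  fix x assume "g \<in> borel \<rightarrow>\<^sub>M N" then show "g x \<in> space N" using measurable_space[of g borel N x] by simp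
next
  fix A assume g: "g \<in> (borel :: (real \<times> real) measure) \<rightarrow>\<^sub>M N" and A: "A \<in> sets N"
  have "g -` A \<in> sets (borel :: (real \<times> real) measure)" using measurable_sets[OF g A] by simp
  then show "g -` A \<inter> space MF \<in> sets MF" by (simp add: sets_MF_iff)
qed

lemma idx_measurable: "(\<lambda>(x, t). idx x t) \<in> (borel \<Otimes>\<^sub>M borel) \<rightarrow>\<^sub>M count_space UNIV"
proof (subst measurable_count_space_eq2_countable, intro conjI ballI)
  fix n :: int
  have "(\<lambda>(x, t). idx x t) -` {n} \<inter> space (borel \<Otimes>\<^sub>M borel) = {z. bsum n (fst z) \<le> snd z \<and> snd z < bsum (n + 1) (fst z)}"
    by (auto simp: space_pair_measure idx_eq_iff idx)
  also have "\<dots> \<in> sets (borel \<Otimes>\<^sub>M borel)"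
  proof -
    have "Measurable.pred (borel \<Otimes>\<^sub>M borel) (\<lambda>z. bsum n (fst z) \<le> snd z \<and> snd z < bsum (n + 1) (fst z))"
      by measurable
    then show ?thesis by (simp add: pred_def space_pair_measure)
  qed
  finally show "(\<lambda>(x, t). idx x t) -` {n} \<inter> space (borel \<Otimes>\<^sub>M borel) \<in> sets (borel \<Otimes>\<^sub>M borel)" .
qed auto

lemma flow_measurable: "(\<lambda>(t, z). Fl t z) \<in> borel \<Otimes>\<^sub>M MF \<rightarrow>\<^sub>M MF"
proof (rule measurable_into_MF)
  let ?N = "borel \<Otimes>\<^sub>M MF :: (real \<times> real \<times> real) measure"
  have id: "(\<lambda>z. z) \<in> MF \<rightarrow>\<^sub>M (borel :: (real \<times> real) measure)" by (rule measurable_from_MF) simp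
  have m1: "fst \<in> ?N \<rightarrow>\<^sub>M borel" by simp
  have m2': "snd \<in> ?N \<rightarrow>\<^sub>M (borel :: (real \<times> real) measure)"
    by (rule measurable_compose[OF measurable_snd id])
  have m2: "(\<lambda>w. fst (snd w)) \<in> ?N \<rightarrow>\<^sub>M borel" "(\<lambda>w. snd (snd w)) \<in> ?N \<rightarrow>\<^sub>M borel"
    using measurable_compose[OF m2', of fst borel] measurable_compose[OF m2', of snd borel]
    by (simp_all add: borel_measurable_continuous_onI continuous_on_fst continuous_on_snd)
  note [measurable] = m1 m2
  have ix: "(\<lambda>w. idx (fst (snd w)) (fst w + snd (snd w))) \<in> ?N \<rightarrow>\<^sub>M count_space UNIV"
    using measurable_compose[OF measurable_Pair[OF m2(1) borel_measurable_add[OF m1 m2(2)]] idx_measurable] by simp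
  have at: "(\<lambda>w. flow_at n (fst w) (snd w)) \<in> ?N \<rightarrow>\<^sub>M (borel :: (real \<times> real) measure)" for n
    unfolding flow_at_def split_beta borel_prod[symmetric] by measurable
  have "(\<lambda>w. flow_at (idx (fst (snd w)) (fst w + snd (snd w))) (fst w) (snd w)) \<in> ?N \<rightarrow>\<^sub>M borel"
    by (rule measurable_compose_countable[OF at ix])
  then show "(\<lambda>(t, z). Fl t z) \<in> ?N \<rightarrow>\<^sub>M borel"
    by (rule measurable_cong[THEN iffD1, rotated]) (auto simp: space_pair_measure Xf_iff flow_idx)
qed (auto simp: space_pair_measure intro: flow_in_space)

lemma flow_t_measurable: "Fl t \<in> MF \<rightarrow>\<^sub>M MF"
  using measurable_compose[OF measurable_Pair1'[of t borel MF] flow_measurable] by simp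

lemma flow_preserves: "distr MF MF (Fl t) = MF"
proof (rule measure_eqI)
  fix A assume "A \<in> sets (distr MF MF (Fl t))"
  then have A: "A \<in> sets MF" by simp
  then have Ab [measurable]: "A \<in> sets (borel :: (real \<times> real) measure)" and AX: "A \<subseteq> Xf" by (auto simp: sets_MF_iff)
  have Ab2 [measurable]: "A \<in> sets (borel \<Otimes>\<^sub>M borel)" unfolding borel_prod by (rule Ab)
  define B where "B n = {(x, s). x \<in> circle \<and> 0 \<le> s \<and> s < f x \<and> bsum n x \<le> t + s \<and> t + s < bsum (n + 1) x
      \<and> (frac (x + of_int n * \<alpha>), t + s - bsum n x) \<in> A}" for n
  define A' where "A' n = {(x, v). x \<in> circle \<and> (x, v) \<in> A \<and> bsum (- n) x \<le> v - t \<and> v - t < bsum (- n + 1) x}" for n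
  have B_PM: "B n \<in> sets PM" for n
  proof -
    have "B n \<in> sets (borel :: (real \<times> real) measure)"
      unfolding B_def by (rule borel_pair_Collect) measurable
    then show ?thesis by (auto simp: sets_PM_iff' B_def)
  qed
  have A_PM: "A' n \<in> sets PM" for n
  proof -
    have "A' n \<in> sets (borel :: (real \<times> real) measure)"
      unfolding A'_def by (rule borel_pair_Collect) measurable
    then show ?thesis by (auto simp: sets_PM_iff' A'_def)
  qed
  have eq: "vol (B n) = vol (A' n)" for n
  proof -
    have "vol (B n) = (\<integral>\<^sup>+x. emeasure lborel (Pair (frac (x + of_int n * \<alpha>)) -` A' n) \<partial>circle_measure)"
      unfolding vol_def
    proof (rule nn_integral_cong)
      fix x assume "x \<in> space circle_measure"
      then have x: "x \<in> circle" by simp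
      define x' where "x' = frac (x + of_int n * \<alpha>)"
      have fx': "f x' = f (x + of_int n * \<alpha>)" by (simp add: x'_def)
      have b: "bsum (- n) x' = - bsum n x" "bsum (- n + 1) x' = f x - bsum n x"
        unfolding x'_def bsum_frac by (rule bsum_minus, rule bsum_minus_Suc)
      have "s \<in> Pair x -` B n \<longleftrightarrow> s + (t - bsum n x) \<in> Pair x' -` A' n" for s
      proof -
        define v where "v = t + s - bsum n x"
        have v: "s + (t - bsum n x) = v" by (simp add: v_def)
        have A: "(x', v) \<in> A \<Longrightarrow> 0 \<le> v \<and> v < f (x + of_int n * \<alpha>)" using AX fx' by (auto simp: Xf_iff)
        have "x' \<in> circle" by (simp add: x'_def)
        then have "v \<in> Pair x' -` A' n \<longleftrightarrow> (x', v) \<in> A \<and> - bsum n x \<le> v - t \<and> v - t < f x - bsum n x"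
          by (simp only: A'_def vimage_eq mem_Collect_eq case_prod_conv b simp_thms)
        moreover have "s \<in> Pair x -` B n \<longleftrightarrow> 0 \<le> s \<and> s < f x \<and> bsum n x \<le> t + s \<and> t + s < bsum (n + 1) x \<and> (x', v) \<in> A"
          using x by (simp only: B_def vimage_eq mem_Collect_eq case_prod_conv simp_thms v_def x'_def)
        ultimately show ?thesis using A bsum_Suc[of n x] unfolding v by (auto simp: v_def)
      qed
      then have "Pair x -` B n = {s. s + (t - bsum n x) \<in> Pair x' -` A' n}" by blast
      then show "emeasure lborel (Pair x -` B n) = emeasure lborel (Pair (frac (x + of_int n * \<alpha>)) -` A' n)"
        using emeasure_lborel_shift[of "Pair x' -` A' n" "t - bsum n x"] sets_Pair1[OF A_PM[of n], of x']
        by (simp add: x'_def)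
    qed
    also have "\<dots> = vol (A' n)" unfolding vol_def
      by (rule nn_integral_rotation) (rule lborel.measurable_emeasure_Pair[OF A_PM])
    finally show ?thesis .
  qed
  have UB: "Fl t -` A \<inter> Xf = (\<Union>n. B n)"
  proof (intro set_eqI iffI)
    fix z assume "z \<in> Fl t -` A \<inter> Xf"
    then show "z \<in> (\<Union>n. B n)"
      using idx by (cases z) (auto simp: B_def Xf_iff flow_idx flow_at_def intro!: exI)
  next
    fix z assume "z \<in> (\<Union>n. B n)"
    then show "z \<in> Fl t -` A \<inter> Xf"
      by (cases z) (auto simp: B_def Xf_iff flow_eq)
  qed
  have UA: "A = (\<Union>n. A' n)"
  proof (intro set_eqI iffI)
    fix z assume z: "z \<in> A"
    obtain x v where xv: "z = (x, v)" by (cases z)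
    have "z \<in> A' (- idx x (v - t))"
      using z AX idx[of x "v - t"] by (auto simp: A'_def Xf_iff xv)
    then show "z \<in> (\<Union>n. A' n)" by blast
  qed (auto simp: A'_def)
  have dB: "disjoint_family B"
    using height_index by (auto simp: disjoint_family_on_def B_def)
  have dA: "disjoint_family A'"
    using height_index by (fastforce simp: disjoint_family_on_def A'_def)
  have "vol (Fl t -` A \<inter> Xf) = emeasure PM (\<Union>n. B n)"
    unfolding UB by (rule emeasure_PM[symmetric]) (rule sets.countable_UN', use B_PM in auto)
  also have "\<dots> = (\<integral>\<^sup>+n. vol (B n) \<partial>count_space UNIV)"
    using dB B_PM by (subst emeasure_UN_countable) (auto simp: emeasure_PM)
  also have "\<dots> = (\<integral>\<^sup>+n. vol (A' n) \<partial>count_space UNIV)" by (simp add: eq)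
  also have "\<dots> = emeasure PM (\<Union>n. A' n)"
    using dA A_PM by (subst emeasure_UN_countable) (auto simp: emeasure_PM)
  also have "\<dots> = vol A" unfolding UA[symmetric]
    using A Xf_sub by (intro emeasure_PM) (auto simp: sets_PM_iff' sets_MF_iff)
  finally have "vol (Fl t -` A \<inter> Xf) = vol A" .
  moreover have "Fl t -` A \<inter> Xf \<in> sets MF" using measurable_sets[OF flow_t_measurable A, of t] by simp
  ultimately show "emeasure (distr MF MF (Fl t)) A = emeasure MF A"
    using A by (simp add: emeasure_distr[OF flow_t_measurable] emeasure_MF)
qed simp

lemma null_over:
  assumes B: "B \<in> sets circle_measure" "measure circle_measure B = 0"
  shows "{(x, s) \<in> Xf. x \<in> B} \<in> sets MF \<and> measure MF {(x, s) \<in> Xf. x \<in> B} = 0"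
proof -
  have Bb [measurable]: "B \<in> sets borel" and Bc: "B \<subseteq> circle" using B by (auto simp: sets_circle_iff)
  have "{(x, s). (x, s) \<in> Xf \<and> x \<in> B} \<in> sets (borel :: (real \<times> real) measure)"
    unfolding Xf_iff by (rule borel_pair_Collect) measurable
  then have s: "{(x, s) \<in> Xf. x \<in> B} \<in> sets MF" by (auto simp: sets_MF_iff split_beta)
  interpret prob_space circle_measure by (rule prob_space_circle)
  have "B \<in> null_sets circle_measure" using B by (simp add: null_sets_def emeasure_eq_measure)
  then have "AE x in circle_measure. x \<notin> B" by (rule AE_not_in)
  then have "AE x in circle_measure. ennreal (f x) * indicator B x = 0" by eventually_elim simp
  then have "(\<integral>\<^sup>+x. ennreal (f x) * indicator B x \<partial>circle_measure) = 0"
    using B(1) by (subst nn_integral_0_iff_AE) (auto intro!: measurable_from_circle)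
  then have "vol {(x, s) \<in> Xf. x \<in> B} = 0" by (simp add: vol_over[OF Bc Bb])
  then show ?thesis using s by (simp add: measure_def emeasure_MF)
qed

lemma flow_ergodic: "ergodic_flow MF Fl"
  unfolding ergodic_flow_def
proof (intro conjI ballI allI impI)
  fix A assume A: "A \<in> sets MF" and inv: "\<forall>t. Fl t -` A \<inter> space MF = A"
  then have Ab [measurable]: "A \<in> sets (borel :: (real \<times> real) measure)" and AX: "A \<subseteq> Xf" by (auto simp: sets_MF_iff)
  have inv': "Fl t z \<in> A \<longleftrightarrow> z \<in> A" if "z \<in> Xf" for t z using inv that by auto
  define A0 where "A0 = {x \<in> circle. (x, 0) \<in> A}"
  have z0: "(x, 0) \<in> Xf" if "x \<in> circle" for x using that pos[of x] by (simp add: Xf_iff)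
  have fib: "(x, s) \<in> A \<longleftrightarrow> x \<in> A0" if "(x, s) \<in> Xf" for x s
  proof -
    have x: "x \<in> circle" "0 \<le> s" "s < f x" using that by (auto simp: Xf_iff)
    have "Fl s (x, 0) = (x, s)" using flow_vertical[of x 0 s] x z0 by simp
    then show ?thesis using inv'[OF z0[OF x(1)], of s] x by (simp add: A0_def)
  qed
  have A0m: "A0 \<in> sets circle_measure"
  proof -
    have "(\<lambda>x::real. (x, 0::real)) \<in> borel \<rightarrow>\<^sub>M (borel :: (real \<times> real) measure)"
      unfolding borel_prod[symmetric] by measurable
    from measurable_sets[OF this Ab] have "{x. (x, 0) \<in> A} \<in> sets borel" by (simp add: vimage_def)
    then have "circle \<inter> {x. (x, 0) \<in> A} \<in> sets borel" by (intro sets.Int) auto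
    moreover have "A0 = circle \<inter> {x. (x, 0) \<in> A}" by (auto simp: A0_def)
    ultimately show ?thesis by (auto simp: sets_circle_iff)
  qed
  have "rotation \<alpha> x \<in> A0 \<longleftrightarrow> x \<in> A0" if x: "x \<in> circle" for x
  proof -
    have "Fl (f x) (x, 0) = (rotation \<alpha> x, 0)"
      using flow_eq[OF x, of 1 "f x" 0] bsum_Suc[of 0 x] bsum_Suc[of 1 x] pos[of "x + \<alpha>"]
      by (simp add: rotation_def)
    then show ?thesis using inv'[OF z0[OF x], of "f x"] x by (simp add: A0_def rotation_def)
  qed
  then have "measure circle_measure A0 = 0 \<or> measure circle_measure A0 = 1"
    by (rule rotation_ergodic[OF A0m])
  then show "measure MF A = 0 \<or> measure MF A = 1"
  proof
    assume "measure circle_measure A0 = 0"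
    moreover have "A = {(x, s) \<in> Xf. x \<in> A0}" using fib AX by auto
    ultimately show ?thesis using null_over[OF A0m] by simp
  next
    assume "measure circle_measure A0 = 1"
    then have "measure circle_measure (circle - A0) = 0"
      using prob_space.prob_compl[OF prob_space_circle A0m] by simp
    moreover have "circle - A0 \<in> sets circle_measure" using sets.compl_sets[OF A0m] by simp
    ultimately have "measure MF {(x, s) \<in> Xf. x \<in> circle - A0} = 0" using null_over by blast
    moreover have "Xf - A = {(x, s) \<in> Xf. x \<in> circle - A0}" using fib by (auto simp: Xf_iff)
    ultimately show ?thesis using prob_space.prob_compl[OF prob_space_MF A] by simp
  qed
qed (use prob_space_MF flow_measurable flow_0 flow_add flow_preserves in auto)

end


lemma standard_borel_closed_embedding:
  fixes \<phi> :: "'a \<Rightarrow> 'b::polish_space"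
  assumes meas: "\<phi> \<in> borel_measurable M" and inj: "inj_on \<phi> (space M)" and cl: "closed (\<phi> ` space M)"
    and gen: "\<And>A. A \<in> sets M \<Longrightarrow> \<exists>B\<in>sets borel. A = \<phi> -` B \<inter> space M"
  shows "standard_borel M"
proof -
  define X where "X = pullback_topology (space M) \<phi> (euclidean :: 'b topology)"
  define K where "K = \<phi> ` space M"
  define \<psi> where "\<psi> = inv_into (space M) \<phi>"
  have top: "topspace X = space M" by (simp add: X_def topspace_pullback_topology)
  have opn: "openin X U \<longleftrightarrow> (\<exists>V. open V \<and> U = \<phi> -` V \<inter> space M)" for U
    by (simp add: X_def openin_pullback_topology)
  have \<psi>: "\<psi> (\<phi> x) = x" if "x \<in> space M" for x using inj that by (simp add: \<psi>_def)
  have "homeomorphic_maps X (top_of_set K) \<phi> \<psi>"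
    unfolding homeomorphic_maps_def
  proof (intro conjI)
    show "continuous_map X (top_of_set K) \<phi>"
      unfolding continuous_map_def
    proof (intro conjI allI impI)
      fix U assume "openin (top_of_set K) U"
      then obtain V where V: "open V" "U = K \<inter> V" by (auto simp: openin_open)
      have "{x \<in> topspace X. \<phi> x \<in> U} = \<phi> -` V \<inter> space M" using V by (auto simp: top K_def)
      then show "openin X {x \<in> topspace X. \<phi> x \<in> U}" unfolding opn using V(1) by blast
    qed (auto simp: top K_def)
    show "continuous_map (top_of_set K) X \<psi>"
      unfolding continuous_map_def
    proof (intro conjI allI impI)
      fix U assume "openin X U"
      then obtain V where V: "open V" "U = \<phi> -` V \<inter> space M" using opn by blast
      have "{y \<in> topspace (top_of_set K). \<psi> y \<in> U} = K \<inter> V" using V \<psi> by (auto simp: K_def)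
      then show "openin (top_of_set K) {y \<in> topspace (top_of_set K). \<psi> y \<in> U}" using V by (auto simp: openin_open)
    qed (auto simp: top K_def \<psi>)
  qed (auto simp: top K_def \<psi>)
  then have "X homeomorphic_space (top_of_set K)" unfolding homeomorphic_space_def by blast
  moreover have "completely_metrizable_space (top_of_set K)"
    by (rule completely_metrizable_space_closedin[OF completely_metrizable_space_euclidean])
      (use cl in \<open>simp add: K_def\<close>)
  ultimately have cm: "completely_metrizable_space X"
    by (rule homeomorphic_completely_metrizable_space[THEN iffD2])
  obtain B :: "'b set set" where B: "countable B" "topological_basis B" using ex_countable_basis by blast
  have sc: "second_countable X"
    unfolding second_countable_def
  proof (intro exI[of _ "(\<lambda>V. \<phi> -` V \<inter> space M) ` B"] conjI ballI allI impI)
    show "countable ((\<lambda>V. \<phi> -` V \<inter> space M) ` B)" using B by simp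
  next
    fix V assume "V \<in> (\<lambda>V. \<phi> -` V \<inter> space M) ` B"
    then obtain W where W: "W \<in> B" "V = \<phi> -` W \<inter> space M" by auto
    have "open W" using topological_basis_open[OF B(2) W(1)] .
    then show "openin X V" unfolding opn W(2) by (intro exI[of _ W] conjI refl)
  next
    fix U x assume "openin X U \<and> x \<in> U"
    then obtain V where V: "open V" "U = \<phi> -` V \<inter> space M" "x \<in> space M" "\<phi> x \<in> V" using opn by auto
    obtain W where "W \<in> B" "\<phi> x \<in> W" "W \<subseteq> V" by (rule topological_basisE[OF B(2) V(1) V(4)])
    then show "\<exists>V\<in>(\<lambda>V. \<phi> -` V \<inter> space M) ` B. x \<in> V \<and> V \<subseteq> U"
      using V by (intro bexI[of _ "\<phi> -` W \<inter> space M"]) auto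
  qed
  have "sets M = {\<phi> -` A \<inter> space M | A. A \<in> sets borel}"
  proof (intro set_eqI iffI)
    fix A assume "A \<in> sets M"
    from gen[OF this] show "A \<in> {\<phi> -` A \<inter> space M | A. A \<in> sets borel}" by auto
  next
    fix A assume "A \<in> {\<phi> -` A \<inter> space M | A. A \<in> sets borel}"
    then obtain B where "B \<in> sets borel" "A = \<phi> -` B \<inter> space M" by auto
    with measurable_sets[OF meas this(1)] show "A \<in> sets M" by simp
  qed
  also have "\<dots> = {\<phi> -` A \<inter> space M | A. A \<in> sigma_sets UNIV {S. open S}}"
    unfolding sets_borel ..
  also have "\<dots> = sigma_sets (space M) {\<phi> -` A \<inter> space M | A. A \<in> {S. open S}}"
    by (rule sigma_sets_vimage_commute) simp
  also have "{\<phi> -` A \<inter> space M | A. A \<in> {S. open S}} = {U. openin X U}" unfolding opn by blast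
  finally show ?thesis using cm sc top unfolding standard_borel_def by blast
qed

context roof_flow
begin

lemma metric_flow: "Metric_space Xf (special_flow_dist circle_dist)"
proof
  fix z w :: "real \<times> real"
  show "0 \<le> special_flow_dist circle_dist z w"
    by (cases z; cases w) (simp add: special_flow_dist_def circle_dist_def)
  show "special_flow_dist circle_dist z w = special_flow_dist circle_dist w z"
    by (cases z; cases w) (simp add: special_flow_dist_def circle_dist_def int_dist_commute abs_minus_commute)
next
  fix z w :: "real \<times> real" assume zw: "z \<in> Xf" "w \<in> Xf"
  obtain x s y t where [simp]: "z = (x, s)" "w = (y, t)" by (cases z, cases w) blast
  have xy: "x \<in> circle" "y \<in> circle" using zw by (auto simp: Xf_iff)
  have "int_dist (x - y) = 0 \<Longrightarrow> x = y"
  proof -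
    assume "int_dist (x - y) = 0"
    then obtain m :: int where "x - y = of_int m" by (auto simp: int_dist_def)
    then have "x = y + of_int m" by simp
    moreover have "m = 0"
    proof -
      have "\<bar>of_int m :: real\<bar> < 1" using xy \<open>x - y = of_int m\<close> by (simp add: circle_iff)
      then have "of_int \<bar>m\<bar> < (1 :: real)" by simp
      then show ?thesis by linarith
    qed
    ultimately show "x = y" by simp
  qed
  then show "special_flow_dist circle_dist z w = 0 \<longleftrightarrow> z = w"
    using int_dist_nonneg[of "x - y"] int_dist_le_abs[of 0] int_dist_nonneg[of 0]
    by (auto simp: special_flow_dist_def circle_dist_def add_nonneg_eq_0_iff)
next
  fix z w v :: "real \<times> real"
  obtain x s y t x' s' where [simp]: "z = (x, s)" "w = (y, t)" "v = (x', s')" by (cases z, cases w, cases v) blast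
  show "special_flow_dist circle_dist z v \<le> special_flow_dist circle_dist z w + special_flow_dist circle_dist w v"
    using int_dist_triangle[of "x - y" "y - x'"] by (simp add: special_flow_dist_def circle_dist_def)
qed

lemma standard_borel_MF: "standard_borel MF"
proof -
  define D where "D = insert 0 (insert 1 (S \<inter> circle))"
  have D: "finite D" "D \<noteq> {}" "closed D" using finite_S by (auto simp: D_def finite_imp_closed)
  define g where "g x = (if x \<in> D then 0 else 1 / infdist x D)" for x :: real
  define \<phi> where "\<phi> = (\<lambda>(x, s). (x, s, 1 / (f x - s), g x))"
  have [measurable]: "D \<in> sets borel" using D(3) by simp
  have [measurable]: "(\<lambda>x. infdist x D) \<in> borel_measurable borel"
    by (intro borel_measurable_continuous_onI continuous_intros)
  have g_meas [measurable]: "g \<in> borel_measurable borel" unfolding g_def[abs_def] by measurable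
  have \<phi>_meas: "\<phi> \<in> borel_measurable MF"
  proof (rule measurable_from_MF)
    have "(\<lambda>z. (fst z, snd z, 1 / (f (fst z) - snd z), g (fst z))) \<in>
       (borel \<Otimes>\<^sub>M borel) \<rightarrow>\<^sub>M (borel \<Otimes>\<^sub>M (borel \<Otimes>\<^sub>M (borel \<Otimes>\<^sub>M borel)) :: (real \<times> real \<times> real \<times> real) measure)"
      by measurable
    then show "\<phi> \<in> borel \<rightarrow>\<^sub>M borel" by (simp add: borel_prod \<phi>_def split_beta')
  qed
  have D0: "infdist x D = 0 \<longleftrightarrow> x \<in> D" for x using D by (metis in_closed_iff_infdist_zero)
  have im: "\<phi> ` Xf = (\<Union>d\<in>D \<inter> circle. {k. fst k = d \<and> 0 \<le> fst (snd k) \<and> 0 \<le> fst (snd (snd k)) \<and>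
        fst (snd (snd k)) * (f d - fst (snd k)) = 1 \<and> snd (snd (snd k)) = 0})
     \<union> {k. 0 \<le> fst k \<and> fst k \<le> 1 \<and> 0 \<le> fst (snd k) \<and> 0 \<le> fst (snd (snd k)) \<and>
        fst (snd (snd k)) * (f (fst k) - fst (snd k)) = 1 \<and> snd (snd (snd k)) * infdist (fst k) D = 1}"
    (is "_ = (\<Union>d\<in>_. ?K d) \<union> ?L")
  proof (intro set_eqI iffI)
    fix k assume "k \<in> \<phi> ` Xf"
    then obtain x s where xs: "(x, s) \<in> Xf" "k = (x, s, 1 / (f x - s), g x)" by (auto simp: \<phi>_def)
    then have "x \<in> circle" "0 \<le> s" "s < f x" by (auto simp: Xf_iff)
    then show "k \<in> (\<Union>d\<in>D \<inter> circle. ?K d) \<union> ?L"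
      using xs D0[of x] by (cases "x \<in> D") (auto simp: g_def circle_iff)
  next
    fix k assume k: "k \<in> (\<Union>d\<in>D \<inter> circle. ?K d) \<union> ?L"
    obtain x s u v where kk: "k = (x, s, u, v)" by (cases k) auto
    have "x \<in> circle \<and> 0 \<le> s \<and> 0 \<le> u \<and> u * (f x - s) = 1 \<and> v = g x"
    proof (cases "k \<in> ?L")
      case True
      then have nz: "infdist x D \<noteq> 0" by (auto simp: kk)
      then have "x \<notin> D" using D0 by simp
      moreover from this have "x \<noteq> 1" by (auto simp: D_def)
      ultimately show ?thesis using True nz by (auto simp: kk circle_iff g_def field_simps)
    qed (use k in \<open>auto simp: kk g_def\<close>)
    moreover from this have "0 < f x - s" by (metis linorder_not_le mult_nonneg_nonpos zero_less_one)
    ultimately have "(x, s) \<in> Xf" "k = \<phi> (x, s)" by (auto simp: kk \<phi>_def Xf_iff field_simps)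
    then show "k \<in> \<phi> ` Xf" by blast
  qed
  have cK: "closed (?K d)" for d
    by (intro closed_Collect_conj closed_Collect_eq closed_Collect_le continuous_intros)
  have cL: "closed ?L"
    unfolding closed_sequential_limits
  proof (intro allI impI, elim conjE)
    fix k :: "nat \<Rightarrow> real \<times> real \<times> real \<times> real" and l
    assume kn: "\<forall>n. k n \<in> ?L" and lim: "k \<longlonglongrightarrow> l"
    obtain x s u v where l: "l = (x, s, u, v)" by (cases l) auto
    have lx: "(\<lambda>n. fst (k n)) \<longlonglongrightarrow> x" using tendsto_fst[OF lim] by (simp add: l)
    have ls: "(\<lambda>n. fst (snd (k n))) \<longlonglongrightarrow> s" using tendsto_fst[OF tendsto_snd[OF lim]] by (simp add: l)
    have lu: "(\<lambda>n. fst (snd (snd (k n)))) \<longlonglongrightarrow> u"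
      using tendsto_fst[OF tendsto_snd[OF tendsto_snd[OF lim]]] by (simp add: l)
    have lv: "(\<lambda>n. snd (snd (snd (k n)))) \<longlonglongrightarrow> v"
      using tendsto_snd[OF tendsto_snd[OF tendsto_snd[OF lim]]] by (simp add: l)
    have "(\<lambda>n. snd (snd (snd (k n))) * infdist (fst (k n)) D) \<longlonglongrightarrow> v * infdist x D"
      by (intro tendsto_intros lv lx)
    moreover have "snd (snd (snd (k n))) * infdist (fst (k n)) D = 1" for n using kn by blast
    ultimately have v1: "v * infdist x D = 1" by (simp add: LIMSEQ_const_iff)
    then have "x \<notin> D" using D0[of x] by auto
    have x01: "0 \<le> x" "x \<le> 1" "0 \<le> s" "0 \<le> u"
      using kn by (auto intro: LIMSEQ_le_const[OF lx] LIMSEQ_le_const2[OF lx] LIMSEQ_le_const[OF ls] LIMSEQ_le_const[OF lu])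
    have "x \<in> circle" using x01 \<open>x \<notin> D\<close> by (auto simp: circle_iff D_def less_le)
    then have "frac x \<notin> S" using \<open>x \<notin> D\<close> by (auto simp: frac_circle D_def)
    then have "isCont f x" by (rule cont)
    then have "(\<lambda>n. f (fst (k n))) \<longlonglongrightarrow> f x" using lx by (rule isCont_tendsto_compose)
    then have "(\<lambda>n. fst (snd (snd (k n))) * (f (fst (k n)) - fst (snd (k n)))) \<longlonglongrightarrow> u * (f x - s)"
      by (intro tendsto_intros lu ls)
    moreover have "fst (snd (snd (k n))) * (f (fst (k n)) - fst (snd (k n))) = 1" for n using kn by blast
    ultimately have u1: "u * (f x - s) = 1" by (simp add: LIMSEQ_const_iff)
    show "l \<in> ?L" using x01 v1 u1 by (simp add: l)
  qed
  have "closed (\<phi> ` Xf)" unfolding im using D(1) cK cL by (intro closed_Un closed_UN) auto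
  then show ?thesis
  proof (intro standard_borel_closed_embedding[OF \<phi>_meas])
    show "inj_on \<phi> (space MF)" by (auto simp: inj_on_def \<phi>_def)
    fix A assume A: "A \<in> sets MF"
    then have Ab: "A \<in> sets (borel :: (real \<times> real) measure)" "A \<subseteq> Xf" by (auto simp: sets_MF_iff)
    define A4 where "A4 = (\<lambda>k :: real \<times> real \<times> real \<times> real. (fst k, fst (snd k))) -` A"
    have "(\<lambda>k :: real \<times> real \<times> real \<times> real. (fst k, fst (snd k))) \<in> borel \<rightarrow>\<^sub>M borel"
      by (intro borel_measurable_continuous_onI continuous_intros)
    from measurable_sets[OF this Ab(1)] have "A4 \<in> sets borel" by (simp add: A4_def)
    moreover have "A = \<phi> -` A4 \<inter> space MF" using Ab(2) by (auto simp: A4_def \<phi>_def)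
    ultimately show "\<exists>B\<in>sets borel. A = \<phi> -` B \<inter> space MF" by blast
  qed simp
qed

end


lemma frac_circle_eq: "x \<in> circle \<Longrightarrow> frac x = x" by (simp add: circle_def frac_eq)

lemma int_dist_cases: "int_dist x = frac x \<or> int_dist x = frac (- x)"
proof -
  define m where "m = round x"
  have m: "int_dist x = \<bar>x - of_int m\<bar>" "\<bar>x - of_int m\<bar> \<le> 1 / 2"
    using of_int_round_abs_le[of x] by (auto simp: int_dist_def m_def abs_minus_commute)
  show ?thesis
  proof (cases "of_int m \<le> x")
    case True
    then have "frac x = x - of_int m" using m by (auto simp: frac_unique_iff)
    then show ?thesis using True m by simp
  next
    case False
    then have "frac (- x) = of_int m - x" using m by (auto simp: frac_unique_iff)
    then show ?thesis using False m by simp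
  qed
qed

lemma int_dist_lipschitz: "\<bar>int_dist x - int_dist y\<bar> \<le> \<bar>x - y\<bar>"
  using int_dist_triangle[of "x - y" y] int_dist_triangle[of "y - x" x]
    int_dist_le_abs[of "x - y"] int_dist_le_abs[of "y - x"] by simp

lemma continuous_on_int_dist: "continuous_on S int_dist"
proof -
  have "isCont int_dist x" for x
    unfolding isCont_def
  proof (rule Lim_null_comparison[THEN LIM_zero_cancel])
    show "\<forall>\<^sub>F y in at x. norm (int_dist y - int_dist x) \<le> \<bar>y - x\<bar>"
      using int_dist_lipschitz by (auto intro: always_eventually)
    show "(\<lambda>y. \<bar>y - x\<bar>) \<midarrow>x\<rightarrow> 0" by (auto intro!: tendsto_eq_intros)
  qed
  then show ?thesis by (simp add: continuous_at_imp_continuous_on)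
qed

locale singular_rotation = denominators \<alpha> q for \<alpha> :: real and q :: "nat \<Rightarrow> nat" +
  fixes f h :: "real \<Rightarrow> real" and k :: nat and a A B :: "nat \<Rightarrow> real" and C m\<^sub>0 :: real
    and x :: "nat \<Rightarrow> real"
  assumes a_circle: "a ` {1..k} \<subseteq> circle" and a_inj: "inj_on a {1..k}"
    and f_C2: "circle_C2_off f (a ` {1..k})"
    and h_type: "singularity_type h"
    and sing: "has_singularities f h k a A B"
    and C_gt: "1 < C"
    and bad: "badly_approximable \<alpha> q C (a ` {1..k})"
    and asym: "(\<Sum>i\<in>{1..k}. A i) \<noteq> (\<Sum>i\<in>{1..k}. B i)"
    and m0_pos: "0 < m\<^sub>0"
    and x_pos: "\<And>s. 0 < x s" and x_less: "\<And>s. x s < 1 / real (q s)"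
    and cond1: "(\<lambda>s. deriv h (x s / (4 * C)) / (real (q s) * h (1 / (2 * real (q s))))) \<longlonglongrightarrow> 0"
    and cond1': "filterlim (\<lambda>s. x s * real (q s) * h (1 / (2 * real (q s)))) at_top sequentially"
    and cond2: "(\<lambda>i. real (q i) * x i) summable_on (- {s. real (q (Suc s)) < 1 / x s})"
    and cond3: "\<And>s. h (1 / (2 * real (q s))) / h (1 / (2 * real (q (Suc s)))) > m\<^sub>0"
begin

subsection \<open>The comparison function\<close>

lemma h_deriv: "0 < u \<Longrightarrow> u < 1 \<Longrightarrow> (h has_real_derivative deriv h u) (at u)"
proof -
  assume "0 < u" "u < 1"
  then have "h differentiable (at u)"
    using h_type by (auto simp: singularity_type_def C2_on_def C1_differentiable_on_eq)
  then show ?thesis by (simp add: DERIV_deriv_iff_real_differentiable)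
qed

lemma h_pos: "0 < u \<Longrightarrow> u < 1 \<Longrightarrow> 0 < h u"
  using h_type by (auto simp: singularity_type_def)

lemma h_anti: "0 < u \<Longrightarrow> u \<le> v \<Longrightarrow> v < 1 \<Longrightarrow> h v \<le> h u"
  using h_type by (auto simp: singularity_type_def monotone_on_def)

lemma dh_mono: "0 < u \<Longrightarrow> u \<le> v \<Longrightarrow> v < 1 \<Longrightarrow> deriv h u \<le> deriv h v"
  using h_type by (auto simp: singularity_type_def monotone_on_def)

lemma dh_nonpos: "0 < u \<Longrightarrow> u < 1 \<Longrightarrow> deriv h u \<le> 0"
proof (rule ccontr)
  assume u: "0 < u" "u < 1" and "\<not> deriv h u \<le> 0"
  then have "0 < deriv h u" by simp
  from DERIV_pos_inc_right[OF h_deriv[OF u] this]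
  obtain d where d: "0 < d" "\<And>t. 0 < t \<Longrightarrow> t < d \<Longrightarrow> h u < h (u + t)" by auto
  define t where "t = min d (1 - u) / 2"
  have "0 < t" "t < d" "u + t < 1" using u d by (auto simp: t_def min_def field_simps)
  then show False using d(2)[of t] h_anti[of u "u + t"] u by simp
qed

lemma h_mvt:
  assumes "0 < u" "u \<le> v" "v < 1"
  shows "h u - h v \<le> - deriv h u * (v - u)" "- deriv h v * (v - u) \<le> h u - h v"
proof -
  have "h u - h v \<le> - deriv h u * (v - u) \<and> - deriv h v * (v - u) \<le> h u - h v"
  proof (cases "u = v")
    case False
    then have "u < v" using assms by simp
    from MVT2[OF this, of h "deriv h"] h_deriv assms
    obtain z where z: "u < z" "z < v" "h v - h u = (v - u) * deriv h z" by force
    have "deriv h u \<le> deriv h z" "deriv h z \<le> deriv h v" using z assms by (auto intro!: dh_mono)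
    then have "(v - u) * deriv h u \<le> (v - u) * deriv h z" "(v - u) * deriv h z \<le> (v - u) * deriv h v"
      using assms by (auto intro: mult_left_mono)
    then show ?thesis using z(3) by (simp add: algebra_simps)
  qed simp
  then show "h u - h v \<le> - deriv h u * (v - u)" "- deriv h v * (v - u) \<le> h u - h v" by auto
qed

lemma h_at_top: "filterlim h at_top (at_right 0)"
  using h_type by (simp add: singularity_type_def)

lemma dh_neg: "\<forall>\<^sub>F u in at_right 0. deriv h u < 0"
proof -
  have "\<forall>\<^sub>F u in at_right (0::real). h (1 / 2) < h u"
    using h_at_top by (simp add: filterlim_at_top_dense)
  moreover have "\<forall>\<^sub>F u in at_right (0::real). 0 < u \<and> u < 1 / 2"
    by (rule eventually_at_rightI[of 0 "1 / 2"]) auto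
  ultimately have "\<forall>\<^sub>F u in at_right (0::real). h (1 / 2) < h u \<and> 0 < u \<and> u < 1 / 2"
    by eventually_elim auto
  then obtain u where u: "h (1 / 2) < h u" "0 < u" "u < 1 / 2"
    using eventually_happens'[OF trivial_limit_at_right_real] by blast
  have "0 < - deriv h u * (1 / 2 - u)" using h_mvt(1)[of u "1 / 2"] u by simp
  then have "deriv h u < 0" using u by (simp add: mult_less_0_iff)
  then have "deriv h v < 0" if "0 < v" "v < u" for v using dh_mono[of v u] that u by simp
  then show ?thesis using u by (intro eventually_at_rightI[of 0 u]) auto
qed

definition H :: "nat \<Rightarrow> real" where "H s = h (1 / (2 * real (q s)))"

lemma half_q: "0 < 1 / (2 * real (q s))" "1 / (2 * real (q s)) < 1"
  using q_pos[of s] by (auto simp: field_simps)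

lemma H_pos: "0 < H s" unfolding H_def using half_q by (rule h_pos)

lemma H_mono: "r \<le> s \<Longrightarrow> H r \<le> H s"
  unfolding H_def using half_q q_mono[of r s] q_pos[of r] by (intro h_anti) (auto simp: field_simps)

lemma H_at_top: "filterlim H at_top sequentially"
  unfolding H_def[abs_def]
proof (rule filterlim_compose[OF h_at_top])
  have "(\<lambda>s. 1 / (2 * real (q s))) \<longlonglongrightarrow> 0"
    using filterlim_q
    by (intro tendsto_divide_0[OF tendsto_const] filterlim_at_top_imp_at_infinity filterlim_tendsto_pos_mult_at_top[OF tendsto_const]) auto
  then show "filterlim (\<lambda>s. 1 / (2 * real (q s))) (at_right 0) sequentially"
    using half_q(1) by (simp add: filterlim_at)
qed

lemma H_ratio: "m\<^sub>0 * H (Suc s) < H s"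
  using cond3[of s] H_pos[of "Suc s"] by (simp add: H_def field_simps)

lemma m0_less: "m\<^sub>0 < 1"
  using H_ratio[of 0] H_mono[of 0 1] H_pos[of 1] by (metis One_nat_def le_numeral_extra(1) less_le_trans linorder_not_le mult_right_mono mult_1 zero_le_one less_imp_le order_less_irrefl zero_less_one_class.zero_le_one)

definition T :: "nat \<Rightarrow> real" where "T s = - deriv h (x s / (4 * C))"

lemma x4C: "0 < x s / (4 * C)" "x s / (4 * C) < 1" "x s / (4 * C) \<le> 1 / (2 * real (q s))"
proof -
  show "0 < x s / (4 * C)" using x_pos[of s] C_gt by simp
  have "x s / (4 * C) \<le> x s / 2" using x_pos[of s] C_gt by (intro divide_left_mono) auto
  also have "\<dots> \<le> (1 / real (q s)) / 2" using x_less[of s] by simp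
  finally show "x s / (4 * C) \<le> 1 / (2 * real (q s))" by (simp add: mult.commute)
  then show "x s / (4 * C) < 1" using half_q(2)[of s] by linarith
qed

lemma T_nonneg: "0 \<le> T s" unfolding T_def using dh_nonpos[OF x4C(1,2)] by simp

lemma T_small:
  assumes "0 < \<eta>"
  shows "\<forall>\<^sub>F s in sequentially. T s \<le> \<eta> * (real (q s) * H s)"
proof -
  from tendstoD[OF cond1 assms] show ?thesis
  proof eventually_elim
    fix s assume *: "dist (deriv h (x s / (4 * C)) / (real (q s) * h (1 / (2 * real (q s))))) 0 < \<eta>"
    have Q: "0 < real (q s) * H s" using q_pos[of s] H_pos[of s] by simp
    have "\<bar>T s / (real (q s) * H s)\<bar> < \<eta>" using * by (simp add: T_def H_def)
    then show "T s \<le> \<eta> * (real (q s) * H s)" using Q by (simp add: abs_less_iff pos_divide_less_eq)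
  qed
qed

subsection \<open>Sums of the truncated derivative of the comparison function\<close>

definition \<Phi> :: "real \<Rightarrow> real \<Rightarrow> real" where
  "\<Phi> d u = (if 0 < u \<and> u < d then - deriv h u else 0)"

lemma \<Phi>_nonneg: "d \<le> 1 \<Longrightarrow> 0 \<le> \<Phi> d u" using dh_nonpos by (auto simp: \<Phi>_def)

lemma \<Phi>_anti: "d \<le> 1 \<Longrightarrow> 0 < u \<Longrightarrow> u \<le> v \<Longrightarrow> v < 1 \<Longrightarrow> \<Phi> d v \<le> \<Phi> d u"
  using dh_mono[of u v] \<Phi>_nonneg[of d u] by (auto simp: \<Phi>_def)

lemma \<Phi>_le: "0 < u \<Longrightarrow> u < 1 \<Longrightarrow> \<Phi> d u \<le> - deriv h u"
  using dh_nonpos by (auto simp: \<Phi>_def)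

lemma riemann_upper:
  assumes d: "d \<le> 1" and n: "1 \<le> n" "n < N"
  shows "(\<Sum>j\<in>{1..n}. \<Phi> d (real j / real N)) \<le> \<Phi> d (1 / real N) + real N * (h (1 / real N) - h (real n / real N))"
  using n
proof (induction n rule: nat_induct_at_least)
  case (Suc n)
  have N: "0 < real N" using Suc by simp
  have "\<Phi> d (real (Suc n) / real N) \<le> - deriv h (real (Suc n) / real N)"
    using Suc N by (intro \<Phi>_le) (auto simp: field_simps)
  also have "\<dots> = real N * (- deriv h (real (Suc n) / real N) * (real (Suc n) / real N - real n / real N))"
    using N by (simp add: field_simps)
  also have "\<dots> \<le> real N * (h (real n / real N) - h (real (Suc n) / real N))"
    using Suc N by (intro mult_left_mono h_mvt) (auto simp: field_simps)
  finally have "\<Phi> d (real (Suc n) / real N) \<le> real N * (h (real n / real N) - h (real (Suc n) / real N))" .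
  moreover have "(\<Sum>j\<in>{1..n}. \<Phi> d (real j / real N)) \<le> \<Phi> d (1 / real N) + real N * (h (1 / real N) - h (real n / real N))"
    using Suc by simp
  ultimately show ?case by (simp add: algebra_simps)
qed simp

lemma riemann_lower:
  assumes d: "0 < d" "d < 1 / 2" and N: "5 < d * real N"
  shows "real N * (h (5 / real N) - h d) \<le> (\<Sum>j\<in>{5..<N}. \<Phi> d (real j / real N))"
proof -
  have "0 < N" using N d by (cases N) auto
  then have N0: "0 < real N" by simp
  define n where "n = nat \<lceil>d * real N\<rceil>"
  have n: "d * real N \<le> real n" "real n < d * real N + 1" using d N unfolding n_def by linarith+
  have "d * real N \<le> 1 / 2 * real N" using d by (intro mult_right_mono) auto
  then have nN: "n < N" using n N by linarith
  have n5: "5 \<le> n" using n N by linarith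
  have "real N * (h (5 / real N) - h d) \<le> real N * (h (5 / real N) - h (real n / real N))"
  proof (intro mult_left_mono diff_left_mono h_anti)
    show "d \<le> real n / real N" using n N0 by (simp add: field_simps)
  qed (use d nN in auto)
  also have "\<dots> = (\<Sum>j\<in>{5..<n}. real N * (h (real j / real N) - h (real (Suc j) / real N)))"
    using sum_Suc_diff'[OF n5, of "\<lambda>j. - h (real j / real N)"] by (simp flip: sum_distrib_left)
  also have "\<dots> \<le> (\<Sum>j\<in>{5..<n}. \<Phi> d (real j / real N))"
  proof (rule sum_mono)
    fix j assume j: "j \<in> {5..<n}"
    have jd: "real j / real N < d"
    proof -
      have "real j \<le> real n - 1" using j by auto
      then show ?thesis using n N0 by (simp add: field_simps)
    qed
    have "real N * (h (real j / real N) - h (real (Suc j) / real N))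
        \<le> real N * (- deriv h (real j / real N) * (real (Suc j) / real N - real j / real N))"
      using j nN N0 by (intro mult_left_mono h_mvt) (auto simp: field_simps)
    also have "\<dots> = - deriv h (real j / real N)" using N0 by (simp add: field_simps)
    finally show "real N * (h (real j / real N) - h (real (Suc j) / real N)) \<le> \<Phi> d (real j / real N)"
      using j jd N0 by (simp add: \<Phi>_def)
  qed
  also have "\<dots> \<le> (\<Sum>j\<in>{5..<N}. \<Phi> d (real j / real N))"
    using nN d by (intro sum_mono2) (auto simp: \<Phi>_nonneg)
  finally show ?thesis .
qed

lemma block_\<Phi>:
  assumes \<beta>: "denominators \<beta> q" and rs: "r \<le> s" and d: "0 < d" "d < 1 / 2" and big: "5 < d * real (q r)"
    and far: "\<And>i. i < q r \<Longrightarrow> x s / (4 * C) \<le> frac (\<theta> + real i * \<beta>)"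
  shows "\<bar>(\<Sum>i<q r. \<Phi> d (frac (\<theta> + real i * \<beta>))) - real (q r) * H s\<bar> \<le> 6 * T s + real (q r) * h d"
proof -
  interpret \<beta>: denominators \<beta> q by (rule \<beta>)
  have "d * real (q r) \<le> 1 / 2 * real (q r)" using d by (intro mult_right_mono) auto
  then have qr: "10 < real (q r)" using big by simp
  have qrs: "real (q r) \<le> real (q s)" using q_mono[OF rs] by simp
  have Tle: "- deriv h u \<le> T s" if "x s / (4 * C) \<le> u" "u < 1" for u
    using dh_mono[of "x s / (4 * C)" u] x4C[of s] that by (simp add: T_def)
  have x1: "x s / (4 * C) \<le> 1 / real (q r)"
  proof -
    have "1 / (2 * real (q s)) \<le> 1 / real (q r)" using qr qrs by (intro divide_left_mono) auto
    then show ?thesis using x4C(3)[of s] by linarith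
  qed
  have "(\<Sum>i<q r. \<Phi> d (frac (\<theta> + real i * \<beta>))) \<le> 5 * T s + (\<Sum>j\<in>{1..<q r}. \<Phi> d (real j / real (q r)))"
  proof (rule \<beta>.denjoy_koksma_upper)
    fix i assume i: "i < q r"
    have "\<Phi> d (frac (\<theta> + real i * \<beta>)) \<le> - deriv h (frac (\<theta> + real i * \<beta>))"
      using far[OF i] x4C(1)[of s] by (intro \<Phi>_le) (auto simp: frac_lt_1 simp del: frac_gt_0_iff)
    also have "\<dots> \<le> T s" using far[OF i] by (intro Tle) (auto simp: frac_lt_1)
    finally show "\<Phi> d (frac (\<theta> + real i * \<beta>)) \<le> T s" .
  qed (use d in \<open>auto simp: \<Phi>_nonneg \<Phi>_anti\<close>)
  also have "{1..<q r} = {1..q r - 1}" by auto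
  also have "(\<Sum>j\<in>{1..q r - 1}. \<Phi> d (real j / real (q r)))
      \<le> \<Phi> d (1 / real (q r)) + real (q r) * (h (1 / real (q r)) - h (real (q r - 1) / real (q r)))"
    using qr d by (intro riemann_upper) auto
  also have "\<Phi> d (1 / real (q r)) \<le> T s"
  proof -
    have "\<Phi> d (1 / real (q r)) \<le> - deriv h (1 / real (q r))" using qr by (intro \<Phi>_le) auto
    also have "\<dots> \<le> T s" using qr x1 by (intro Tle) auto
    finally show ?thesis .
  qed
  also have "h (1 / real (q r)) - h (real (q r - 1) / real (q r)) \<le> H s"
  proof -
    have "0 < h (real (q r - 1) / real (q r))" using qr by (intro h_pos) (auto simp: field_simps)
    moreover have "h (1 / real (q r)) \<le> H s" unfolding H_def
      using half_q qr qrs by (intro h_anti) (auto simp: field_simps)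
    ultimately show ?thesis by simp
  qed
  finally have up: "(\<Sum>i<q r. \<Phi> d (frac (\<theta> + real i * \<beta>))) \<le> 6 * T s + real (q r) * H s"
    using qr by (simp add: mult_left_mono)
  have "real (q r) * H s - 5 * T s - real (q r) * h d \<le> real (q r) * (h (5 / real (q r)) - h d)"
  proof -
    have l: "1 / (2 * real (q s)) \<le> 5 / real (q r)" using qr qrs by (simp add: field_simps)
    have "H s - h (5 / real (q r)) \<le> - deriv h (1 / (2 * real (q s))) * (5 / real (q r) - 1 / (2 * real (q s)))"
      unfolding H_def using half_q l qr by (intro h_mvt) auto
    also have "\<dots> \<le> T s * (5 / real (q r) - 1 / (2 * real (q s)))"
      using x4C[of s] half_q[of s] l by (intro mult_right_mono Tle) auto
    also have "\<dots> \<le> T s * (5 / real (q r))" using T_nonneg half_q(1)[of s] by (intro mult_left_mono) auto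
    finally have "real (q r) * (H s - h (5 / real (q r))) \<le> real (q r) * (T s * (5 / real (q r)))"
      using qr by (intro mult_left_mono) auto
    also have "\<dots> = 5 * T s" using qr by simp
    finally show ?thesis by (simp add: algebra_simps)
  qed
  also have "\<dots> \<le> (\<Sum>j\<in>{5..<q r}. \<Phi> d (real j / real (q r)))"
    using d big by (intro riemann_lower) auto
  also have "\<dots> \<le> (\<Sum>i<q r. \<Phi> d (frac (\<theta> + real i * \<beta>)))"
    using d by (intro \<beta>.denjoy_koksma_lower) (auto simp: \<Phi>_nonneg \<Phi>_anti)
  finally have lo: "real (q r) * H s - 5 * T s - real (q r) * h d \<le> (\<Sum>i<q r. \<Phi> d (frac (\<theta> + real i * \<beta>)))" .
  have "0 < h d" using d by (intro h_pos) auto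
  then have "0 \<le> real (q r) * h d" by simp
  then show ?thesis using up lo T_nonneg[of s] by linarith
qed

end


context singular_rotation
begin

subsection \<open>Decomposition of the derivative of the roof\<close>

lemma f_periodic: "f (y + of_int m) = f y"
proof -
  have p: "f (y + 1) = f y" for y using f_C2 by (simp add: circle_C2_off_def)
  have nat: "f (y + real n) = f y" for y n
  proof (induction n)
    case (Suc n)
    then show ?case using p[of "y + real n"] by (simp add: add_ac)
  qed simp
  show ?thesis
  proof (cases "0 \<le> m")
    case True
    then show ?thesis using nat[of y "nat m"] by simp
  next
    case False
    then show ?thesis using nat[of "y + of_int m" "nat (- m)"] by simp
  qed
qed

lemma df_periodic: "deriv f (y + of_int m) = deriv f y"
  unfolding deriv_def using DERIV_shift[of f _ y "of_int m"] by (simp add: f_periodic)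

lemma f_deriv: "frac z \<notin> a ` {1..k} \<Longrightarrow> (f has_real_derivative deriv f z) (at z)"
proof -
  assume "frac z \<notin> a ` {1..k}"
  then have "f differentiable (at z)"
    using f_C2 by (auto simp: circle_C2_off_def C2_on_def C1_differentiable_on_eq)
  then show ?thesis by (simp add: DERIV_deriv_iff_real_differentiable)
qed

lemma df_continuous: "continuous_on {z. frac z \<notin> a ` {1..k}} (deriv f)"
proof -
  have "deriv f C1_differentiable_on {z. frac z \<notin> a ` {1..k}}"
    using f_C2 by (auto simp: circle_C2_off_def C2_on_def)
  then have "deriv f differentiable_on {z. frac z \<notin> a ` {1..k}}" by (rule C1_diff_imp_diff)
  then show ?thesis by (rule differentiable_imp_continuous_on)
qed

lemma a_frac: "i \<in> {1..k} \<Longrightarrow> frac (a i) = a i"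
  using a_circle by (intro frac_circle_eq) auto

lemma singular_iff: "frac z \<in> a ` {1..k} \<longleftrightarrow> (\<exists>i\<in>{1..k}. int_dist (z - a i) = 0)"
proof
  assume "frac z \<in> a ` {1..k}"
  then obtain i where i: "i \<in> {1..k}" "frac z = a i" by auto
  then have "z - a i = of_int \<lfloor>z\<rfloor>" by (simp add: frac_def)
  then have "int_dist (z - a i) = int_dist (0 + of_int \<lfloor>z\<rfloor>)" by simp
  also have "\<dots> = 0" unfolding int_dist_add_int by (simp add: int_dist_def)
  finally show "\<exists>i\<in>{1..k}. int_dist (z - a i) = 0" using i by blast
next
  assume "\<exists>i\<in>{1..k}. int_dist (z - a i) = 0"
  then obtain i m where i: "i \<in> {1..k}" "z - a i = of_int m" by (auto simp: int_dist_def)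
  then have "z = a i + of_int m" by simp
  then have "frac z = a i" using a_frac[OF i(1)] by simp
  then show "frac z \<in> a ` {1..k}" using i by blast
qed

lemma a_separated: "i \<in> {1..k} \<Longrightarrow> j \<in> {1..k} \<Longrightarrow> i \<noteq> j \<Longrightarrow> 0 < int_dist (a i - a j)"
proof (rule ccontr)
  assume ij: "i \<in> {1..k}" "j \<in> {1..k}" "i \<noteq> j" and "\<not> 0 < int_dist (a i - a j)"
  then have "int_dist (a i - a j) = 0" using int_dist_nonneg[of "a i - a j"] by linarith
  then obtain m :: int where "a i - a j = of_int m" by (auto simp: int_dist_def)
  then have "a i = a j + of_int m" by simp
  then have "frac (a i) = frac (a j)" by simp
  then have "a i = a j" unfolding a_frac[OF ij(1)] a_frac[OF ij(2)] .
  from inj_onD[OF a_inj this ij(1,2)] ij(3) show False by simp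
qed

lemma AB_nonneg: "i \<in> {1..k} \<Longrightarrow> 0 \<le> A i" "i \<in> {1..k} \<Longrightarrow> 0 \<le> B i"
  using sing by (auto simp: has_singularities_def)

lemma near_singularity:
  assumes i: "i \<in> {1..k}" and \<eta>: "0 < \<eta>"
  shows "\<forall>\<^sub>F u in at_right 0. \<bar>deriv f (a i + u) + A i * (- deriv h u)\<bar> \<le> \<eta> * (- deriv h u)
     \<and> \<bar>deriv f (a i - u) - B i * (- deriv h u)\<bar> \<le> \<eta> * (- deriv h u)"
proof -
  have r: "((\<lambda>y. deriv f y / deriv h (y - a i)) \<longlongrightarrow> A i) (at_right (a i))"
    and l: "((\<lambda>y. deriv f y / deriv h (a i - y)) \<longlongrightarrow> - B i) (at_left (a i))"
    using sing i by (auto simp: has_singularities_def)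
  have r': "((\<lambda>u. deriv f (a i + u) / deriv h u) \<longlongrightarrow> A i) (at_right 0)"
    using r by (subst (asm) filterlim_at_right_to_0) (simp add: add.commute)
  have l': "((\<lambda>u. deriv f (a i - u) / deriv h u) \<longlongrightarrow> - B i) (at_right 0)"
    using l by (subst (asm) filterlim_at_left_to_right, subst (asm) filterlim_at_right_to_0)
      (simp add: algebra_simps)
  from tendstoD[OF r' \<eta>] tendstoD[OF l' \<eta>] dh_neg
  show ?thesis
  proof eventually_elim
    fix u assume *: "dist (deriv f (a i + u) / deriv h u) (A i) < \<eta>"
      "dist (deriv f (a i - u) / deriv h u) (- B i) < \<eta>" and neg: "deriv h u < 0"
    have gen: "\<bar>D - c * deriv h u\<bar> \<le> \<eta> * (- deriv h u)" if "dist (D / deriv h u) c < \<eta>" for D c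
    proof -
      have "D - c * deriv h u = (D / deriv h u - c) * deriv h u" using neg by (simp add: field_simps)
      then have "\<bar>D - c * deriv h u\<bar> = dist (D / deriv h u) c * (- deriv h u)"
        using neg by (simp add: abs_mult dist_real_def)
      also have "\<dots> \<le> \<eta> * (- deriv h u)" using that neg by (intro mult_right_mono) auto
      finally show ?thesis .
    qed
    show "\<bar>deriv f (a i + u) + A i * (- deriv h u)\<bar> \<le> \<eta> * (- deriv h u)
     \<and> \<bar>deriv f (a i - u) - B i * (- deriv h u)\<bar> \<le> \<eta> * (- deriv h u)"
      using gen[OF *(1)] gen[OF *(2)] by simp
  qed
qed

definition Rt :: "real \<Rightarrow> nat \<Rightarrow> real \<Rightarrow> real" where "Rt d i z = \<Phi> d (frac (z - a i))"
definition Lt :: "real \<Rightarrow> nat \<Rightarrow> real \<Rightarrow> real" where "Lt d i z = \<Phi> d (frac (a i - z))"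

lemma derivative_decomposition:
  assumes \<eta>: "0 < \<eta>"
  obtains d K where "0 < d" "d < 1 / 2" "0 \<le> K"
    and "\<And>z. frac z \<notin> a ` {1..k} \<Longrightarrow>
      \<bar>deriv f z - (\<Sum>i\<in>{1..k}. B i * Lt d i z - A i * Rt d i z)\<bar>
        \<le> \<eta> * (\<Sum>i\<in>{1..k}. Lt d i z + Rt d i z) + K"
proof -
  define near where "near i u \<longleftrightarrow> \<bar>deriv f (a i + u) + A i * (- deriv h u)\<bar> \<le> \<eta> * (- deriv h u)
     \<and> \<bar>deriv f (a i - u) - B i * (- deriv h u)\<bar> \<le> \<eta> * (- deriv h u)" for i u
  have small: "\<forall>\<^sub>F u in at_right (0::real). u < c" if "0 < c" for c
    by (rule eventually_at_rightI[of 0 c]) (use that in auto)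
  have "\<forall>\<^sub>F u in at_right (0::real). u < 1 / 2 \<and> (\<forall>i\<in>{1..k}. near i u \<and>
      (\<forall>j\<in>{1..k}. i \<noteq> j \<longrightarrow> 2 * u < int_dist (a i - a j)))"
  proof (intro eventually_conj eventually_ball_finite ballI)
    fix i assume i: "i \<in> {1..k}"
    show "\<forall>\<^sub>F u in at_right 0. near i u" unfolding near_def by (rule near_singularity[OF i \<eta>])
    fix j assume j: "j \<in> {1..k}"
    show "\<forall>\<^sub>F u in at_right 0. i \<noteq> j \<longrightarrow> 2 * u < int_dist (a i - a j)"
    proof (cases "i = j")
      case False
      from small[of "int_dist (a i - a j) / 2"] a_separated[OF i j False]
      show ?thesis by (auto elim: eventually_mono)
    qed simp
  next
    show "\<forall>\<^sub>F u in at_right (0::real). u < 1 / 2" by (rule small) simp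
  qed simp_all
  then obtain b where b: "0 < b" and bb: "\<And>u. 0 < u \<Longrightarrow> u < b \<Longrightarrow> u < 1 / 2 \<and> (\<forall>i\<in>{1..k}. near i u \<and>
      (\<forall>j\<in>{1..k}. i \<noteq> j \<longrightarrow> 2 * u < int_dist (a i - a j)))"
    by (auto simp: eventually_at_right_field)
  define d where "d = b / 2"
  have d: "0 < d" "d < b" "d < 1 / 2" using b bb[of "b / 2"] by (auto simp: d_def)
  have sep: "2 * d < int_dist (a i - a j)" if "i \<in> {1..k}" "j \<in> {1..k}" "i \<noteq> j" for i j
    using bb[of d] d that by auto
  define E where "E = {z \<in> {0..1}. \<forall>i\<in>{1..k}. d \<le> int_dist (z - a i)}"
  have "closed ({0..1::real} \<inter> (\<Inter>i\<in>{1..k}. {z. d \<le> int_dist (z - a i)}))"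
  proof (intro closed_Int closed_INT ballI)
    fix i
    show "closed {z. d \<le> int_dist (z - a i)}"
      by (intro closed_Collect_le continuous_intros continuous_on_compose2[OF continuous_on_int_dist[of UNIV]]) auto
  qed simp
  moreover have Eeq: "E = {0..1::real} \<inter> (\<Inter>i\<in>{1..k}. {z. d \<le> int_dist (z - a i)})" by (auto simp: E_def)
  ultimately have "compact E"
    by (metis Int_lower1 bounded_closed_interval bounded_subset compact_eq_bounded_closed)
  moreover have "continuous_on E (deriv f)"
  proof (rule continuous_on_subset[OF df_continuous])
    show "E \<subseteq> {z. frac z \<notin> a ` {1..k}}"
    proof (intro subsetI CollectI notI)
      fix z assume z: "z \<in> E" and "frac z \<in> a ` {1..k}"
      then obtain i where "i \<in> {1..k}" "int_dist (z - a i) = 0" using singular_iff by blast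
      moreover from this z have "d \<le> int_dist (z - a i)" unfolding E_def by blast
      ultimately show False using d by simp
    qed
  qed
  ultimately have "bounded (deriv f ` E)" by (intro compact_imp_bounded compact_continuous_image)
  then obtain K where K: "0 < K" "\<And>z. z \<in> E \<Longrightarrow> \<bar>deriv f z\<bar> \<le> K"
    unfolding bounded_pos by auto
  have main: "\<bar>deriv f z - (\<Sum>i\<in>{1..k}. B i * Lt d i z - A i * Rt d i z)\<bar>
        \<le> \<eta> * (\<Sum>i\<in>{1..k}. Lt d i z + Rt d i z) + K" if z: "frac z \<notin> a ` {1..k}" for z
  proof -
    have pos: "0 < int_dist (z - a i)" if "i \<in> {1..k}" for i
      using z singular_iff[of z] that int_dist_nonneg[of "z - a i"] by (metis order_le_less)
    have far0: "Lt d j z = 0 \<and> Rt d j z = 0" if "d \<le> int_dist (z - a j)" for j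
      using that int_dist_le_frac[of "z - a j"] by (auto simp: Lt_def Rt_def \<Phi>_def)
    show ?thesis
    proof (cases "\<exists>i\<in>{1..k}. int_dist (z - a i) < d")
      case True
      then obtain i where i: "i \<in> {1..k}" "int_dist (z - a i) < d" by blast
      have others: "Lt d j z = 0 \<and> Rt d j z = 0" if j: "j \<in> {1..k}" "j \<noteq> i" for j
      proof (rule far0)
        have "int_dist (a i - a j) \<le> int_dist (a i - z) + int_dist (z - a j)"
          using int_dist_triangle[of "a i - z" "z - a j"] by simp
        then show "d \<le> int_dist (z - a j)"
          using sep[of i j] i j int_dist_commute[of "a i" z] by auto
      qed
      have S1: "(\<Sum>i\<in>{1..k}. B i * Lt d i z - A i * Rt d i z) = B i * Lt d i z - A i * Rt d i z"
        using others i by (subst sum.remove[of _ i]) (auto intro: sum.neutral)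
      have S2: "(\<Sum>i\<in>{1..k}. Lt d i z + Rt d i z) = Lt d i z + Rt d i z"
        using others i by (subst sum.remove[of _ i]) (auto intro: sum.neutral)
      define u where "u = int_dist (z - a i)"
      have u: "0 < u" "u < d" "u < b" using pos[OF i(1)] i d by (auto simp: u_def)
      have nr: "near i u" using bb[of u] u i by blast
      from int_dist_cases[of "z - a i"] show ?thesis
      proof
        assume c: "int_dist (z - a i) = frac (z - a i)"
        then have "z = a i + u + of_int \<lfloor>z - a i\<rfloor>" by (simp add: u_def frac_def)
        then have "deriv f z = deriv f (a i + u)" using df_periodic by metis
        moreover have "Rt d i z = - deriv h u" using u by (simp add: Rt_def \<Phi>_def u_def flip: c)
        moreover have "Lt d i z = 0"
        proof -
          have "z - a i \<notin> \<int>" using u by (simp add: u_def c)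
          then have "frac (a i - z) = 1 - u" using frac_neg[of "z - a i"] by (simp add: u_def c)
          then show ?thesis using u d by (simp add: Lt_def \<Phi>_def)
        qed
        ultimately show ?thesis unfolding S1 S2 using nr K(1) by (simp add: near_def)
      next
        assume "int_dist (z - a i) = frac (- (z - a i))"
        then have c: "int_dist (z - a i) = frac (a i - z)" by simp
        then have "z = a i - u + of_int (- \<lfloor>a i - z\<rfloor>)" by (simp add: u_def frac_def)
        then have "deriv f z = deriv f (a i - u)" using df_periodic by metis
        moreover have "Lt d i z = - deriv h u" using u by (simp add: Lt_def \<Phi>_def u_def flip: c)
        moreover have "Rt d i z = 0"
        proof -
          have "a i - z \<notin> \<int>" using u by (simp add: u_def c)
          then have "frac (z - a i) = 1 - u" using frac_neg[of "a i - z"] by (simp add: u_def c)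
          then show ?thesis using u d by (simp add: Rt_def \<Phi>_def)
        qed
        ultimately show ?thesis unfolding S1 S2 using nr K(1) by (simp add: near_def)
      qed
    next
      case False
      then have far: "\<forall>i\<in>{1..k}. d \<le> int_dist (z - a i)" by (auto simp: not_less)
      have "(\<Sum>i\<in>{1..k}. B i * Lt d i z - A i * Rt d i z) = 0" "(\<Sum>i\<in>{1..k}. Lt d i z + Rt d i z) = 0"
        using far far0 by (auto intro!: sum.neutral)
      moreover have "\<bar>deriv f z\<bar> \<le> K"
      proof -
        have zf: "z = frac z + of_int \<lfloor>z\<rfloor>" by (simp add: frac_def)
        have "int_dist (frac z - a i) = int_dist (z - a i)" for i
        proof -
          have "z - a i = (frac z - a i) + of_int \<lfloor>z\<rfloor>" by (simp add: frac_def)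
          then show ?thesis by (metis int_dist_add_int)
        qed
        then have "frac z \<in> E" using far by (auto simp: E_def frac_lt_1 intro: less_imp_le)
        then have "\<bar>deriv f (frac z)\<bar> \<le> K" by (rule K)
        moreover have "deriv f (frac z) = deriv f z" using df_periodic[of "frac z" "\<lfloor>z\<rfloor>"] zf by simp
        ultimately show ?thesis by simp
      qed
      ultimately show ?thesis by simp
    qed
  qed
  show thesis using that[of d K] d K(1) main by auto
qed

definition sAB :: real where "sAB = (\<Sum>i\<in>{1..k}. A i + B i)"
definition c0 :: real where "c0 = (\<Sum>i\<in>{1..k}. B i) - (\<Sum>i\<in>{1..k}. A i)"
definition C1 :: real where "C1 = 8 * sAB + 16 * real k + 1"

lemma sAB_nonneg: "0 \<le> sAB" unfolding sAB_def using AB_nonneg by (intro sum_nonneg) auto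
lemma C1_pos: "1 \<le> C1" using sAB_nonneg by (simp add: C1_def)
lemma c0_nz: "c0 \<noteq> 0" using asym by (simp add: c0_def)

lemma block_estimate:
  assumes \<zeta>: "0 < \<zeta>" and W: "1 \<le> W"
  shows "\<forall>\<^sub>F s in sequentially. \<forall>r\<le>s. real (q s) \<le> W * real (q r) \<longrightarrow>
     (\<forall>z. (\<forall>i<q r. \<forall>j\<in>{1..k}. x s / (4 * C) \<le> int_dist (z + real i * \<alpha> - a j)) \<longrightarrow>
       \<bar>(\<Sum>i<q r. deriv f (z + real i * \<alpha>)) - c0 * (real (q r) * H s)\<bar> \<le> \<zeta> * (real (q r) * H s)
       \<and> (\<Sum>i<q r. \<bar>deriv f (z + real i * \<alpha>)\<bar>) \<le> C1 * (real (q r) * H s))"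
proof -
  define \<eta> where "\<eta> = min 1 (\<zeta> / (7 * sAB + 16 * real k + 1))"
  have den: "0 < 7 * sAB + 16 * real k + 1" using sAB_nonneg by (simp add: add_nonneg_pos)
  have \<eta>: "0 < \<eta>" "\<eta> \<le> 1" "\<eta> * (7 * sAB + 16 * real k + 1) \<le> \<zeta>"
  proof -
    show "0 < \<eta>" "\<eta> \<le> 1" using \<zeta> den by (auto simp: \<eta>_def)
    have "\<eta> \<le> \<zeta> / (7 * sAB + 16 * real k + 1)" by (simp add: \<eta>_def)
    then show "\<eta> * (7 * sAB + 16 * real k + 1) \<le> \<zeta>" using den by (simp add: pos_le_divide_eq)
  qed
  obtain d K where d: "0 < d" "d < 1 / 2" and K: "0 \<le> K"
    and dec: "\<And>z. frac z \<notin> a ` {1..k} \<Longrightarrow>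
      \<bar>deriv f z - (\<Sum>i\<in>{1..k}. B i * Lt d i z - A i * Rt d i z)\<bar>
        \<le> \<eta> * (\<Sum>i\<in>{1..k}. Lt d i z + Rt d i z) + K"
    using derivative_decomposition[OF \<eta>(1)] by blast
  have e1: "\<forall>\<^sub>F s in sequentially. T s \<le> \<eta> / W * (real (q s) * H s)"
    using \<eta> W by (intro T_small) auto
  have e2: "\<forall>\<^sub>F s in sequentially. h d / \<eta> < H s" "\<forall>\<^sub>F s in sequentially. K / \<eta> < H s"
    using H_at_top by (auto simp: filterlim_at_top_dense)
  have e3: "\<forall>\<^sub>F s in sequentially. W * (5 / d) < real (q s)"
    using filterlim_q by (auto simp: filterlim_at_top_dense)
  from e1 e2 e3 show ?thesis
  proof eventually_elim
    case (elim s)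
    show ?case
    proof (intro allI impI)
      fix r z assume r: "r \<le> s" and qW: "real (q s) \<le> W * real (q r)"
        and far: "\<forall>i<q r. \<forall>j\<in>{1..k}. x s / (4 * C) \<le> int_dist (z + real i * \<alpha> - a j)"
      define Q where "Q = real (q r) * H s"
      have Q: "0 < Q" using q_pos[of r] H_pos[of s] by (simp add: Q_def)
      have hd: "h d \<le> \<eta> * H s" and KH: "K \<le> \<eta> * H s"
        using elim(2,3) \<eta> by (auto simp: pos_divide_less_eq mult.commute)
      have TQ: "T s \<le> \<eta> * Q"
      proof -
        have "T s \<le> \<eta> / W * (real (q s) * H s)" by (rule elim(1))
        also have "\<dots> \<le> \<eta> / W * (W * real (q r) * H s)"
          using qW \<eta> W H_pos[of s] by (intro mult_left_mono mult_right_mono) auto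
        also have "\<dots> = \<eta> * Q" using W by (simp add: Q_def)
        finally show ?thesis .
      qed
      have big: "5 < d * real (q r)"
      proof -
        have "W * (5 / d) < W * real (q r)" using elim(4) qW by linarith
        then have "5 / d < real (q r)" by (rule mult_left_less_imp_less) (use W in simp)
        then show ?thesis using d by (simp add: pos_divide_less_eq mult.commute)
      qed
      have err: "6 * T s + real (q r) * h d \<le> 7 * \<eta> * Q"
      proof -
        have "real (q r) * h d \<le> real (q r) * (\<eta> * H s)" using hd by (intro mult_left_mono) auto
        then show ?thesis using TQ by (simp add: Q_def algebra_simps)
      qed
      have R: "\<bar>(\<Sum>i<q r. Rt d j (z + real i * \<alpha>)) - Q\<bar> \<le> 7 * \<eta> * Q" if j: "j \<in> {1..k}" for j
      proof -
        have "\<bar>(\<Sum>i<q r. \<Phi> d (frac ((z - a j) + real i * \<alpha>))) - real (q r) * H s\<bar> \<le> 6 * T s + real (q r) * h d"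
        proof (rule block_\<Phi>[OF denominators_axioms r d big])
          fix i assume "i < q r"
          then show "x s / (4 * C) \<le> frac (z - a j + real i * \<alpha>)"
            using far j int_dist_le_frac(1)[of "z + real i * \<alpha> - a j"] by (force simp: algebra_simps)
        qed
        then show ?thesis using err by (simp add: Rt_def Q_def algebra_simps)
      qed
      have L: "\<bar>(\<Sum>i<q r. Lt d j (z + real i * \<alpha>)) - Q\<bar> \<le> 7 * \<eta> * Q" if j: "j \<in> {1..k}" for j
      proof -
        have "\<bar>(\<Sum>i<q r. \<Phi> d (frac ((a j - z) + real i * (- \<alpha>)))) - real (q r) * H s\<bar> \<le> 6 * T s + real (q r) * h d"
        proof (rule block_\<Phi>[OF denominators_minus[OF denominators_axioms] r d big])
          fix i assume "i < q r"
          then show "x s / (4 * C) \<le> frac (a j - z + real i * (- \<alpha>))"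
            using far j int_dist_le_frac(2)[of "z + real i * \<alpha> - a j"] by (force simp: algebra_simps)
        qed
        then show ?thesis using err by (simp add: Lt_def Q_def algebra_simps)
      qed
      have ns: "frac (z + real i * \<alpha>) \<notin> a ` {1..k}" if "i < q r" for i
        using singular_iff[of "z + real i * \<alpha>"] far that x4C(1)[of s] by force
      define F where "F i = deriv f (z + real i * \<alpha>)" for i
      define G where "G i = (\<Sum>j\<in>{1..k}. B j * Lt d j (z + real i * \<alpha>) - A j * Rt d j (z + real i * \<alpha>))" for i
      define P where "P i = (\<Sum>j\<in>{1..k}. Lt d j (z + real i * \<alpha>) + Rt d j (z + real i * \<alpha>))" for i
      have FG: "\<bar>F i - G i\<bar> \<le> \<eta> * P i + K" if "i < q r" for i
        unfolding F_def G_def P_def by (rule dec[OF ns[OF that]])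
      have Lle: "(\<Sum>i<q r. Lt d j (z + real i * \<alpha>)) \<le> 8 * Q" and Rle: "(\<Sum>i<q r. Rt d j (z + real i * \<alpha>)) \<le> 8 * Q"
        if "j \<in> {1..k}" for j
      proof -
        have "7 * \<eta> * Q \<le> 7 * Q" using \<eta> Q by simp
        then show "(\<Sum>i<q r. Lt d j (z + real i * \<alpha>)) \<le> 8 * Q" "(\<Sum>i<q r. Rt d j (z + real i * \<alpha>)) \<le> 8 * Q"
          using L[OF that] R[OF that] by linarith+
      qed
      have Psum: "(\<Sum>i<q r. P i) \<le> 16 * real k * Q"
      proof -
        have "(\<Sum>i<q r. P i) = (\<Sum>j\<in>{1..k}. (\<Sum>i<q r. Lt d j (z + real i * \<alpha>)) + (\<Sum>i<q r. Rt d j (z + real i * \<alpha>)))"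
          unfolding P_def by (subst sum.swap) (simp add: sum.distrib)
        also have "\<dots> \<le> (\<Sum>j\<in>{1..k}. 8 * Q + 8 * Q)" using Lle Rle by (intro sum_mono add_mono) auto
        finally show ?thesis by simp
      qed
      have errsum: "(\<Sum>i<q r. \<eta> * P i + K) \<le> \<eta> * (16 * real k + 1) * Q"
      proof -
        have "(\<Sum>i<q r. \<eta> * P i + K) = \<eta> * (\<Sum>i<q r. P i) + real (q r) * K"
          by (simp add: sum.distrib sum_distrib_left)
        also have "\<dots> \<le> \<eta> * (16 * real k * Q) + real (q r) * (\<eta> * H s)"
          using Psum \<eta> KH by (intro add_mono mult_left_mono) auto
        finally show ?thesis by (simp add: Q_def algebra_simps)
      qed
      have sABsum: "(\<Sum>j\<in>{1..k}. B j * y + A j * y) = sAB * y" for y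
        unfolding sAB_def sum_distrib_right by (rule sum.cong[OF refl]) (simp add: distrib_right)
      have Gsum: "\<bar>(\<Sum>i<q r. G i) - c0 * Q\<bar> \<le> 7 * \<eta> * sAB * Q"
      proof -
        have eq: "(\<Sum>i<q r. G i) - c0 * Q = (\<Sum>j\<in>{1..k}. B j * ((\<Sum>i<q r. Lt d j (z + real i * \<alpha>)) - Q)
            - A j * ((\<Sum>i<q r. Rt d j (z + real i * \<alpha>)) - Q))"
        proof -
          have alg: "b * l - c * r - (b * Q - c * Q) = b * (l - Q) - c * (r - Q)" for b c l r :: real
            by (simp add: algebra_simps)
          have e1: "(\<Sum>i<q r. G i) = (\<Sum>j\<in>{1..k}. B j * (\<Sum>i<q r. Lt d j (z + real i * \<alpha>))
              - A j * (\<Sum>i<q r. Rt d j (z + real i * \<alpha>)))"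
            unfolding G_def
            by (rule trans[OF sum.swap], rule sum.cong[OF refl]) (simp only: sum_subtractf sum_distrib_left)
          have e2: "c0 * Q = (\<Sum>j\<in>{1..k}. B j * Q - A j * Q)"
            by (simp only: c0_def sum_subtractf sum_distrib_right left_diff_distrib)
          have "(\<Sum>i<q r. G i) - c0 * Q = (\<Sum>j\<in>{1..k}. (B j * (\<Sum>i<q r. Lt d j (z + real i * \<alpha>))
              - A j * (\<Sum>i<q r. Rt d j (z + real i * \<alpha>))) - (B j * Q - A j * Q))"
            by (simp only: e1 e2 sum_subtractf)
          also have "\<dots> = (\<Sum>j\<in>{1..k}. B j * ((\<Sum>i<q r. Lt d j (z + real i * \<alpha>)) - Q)
              - A j * ((\<Sum>i<q r. Rt d j (z + real i * \<alpha>)) - Q))"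
            by (rule sum.cong[OF refl]) (rule alg)
          finally show ?thesis .
        qed
        have "\<bar>(\<Sum>i<q r. G i) - c0 * Q\<bar> \<le> (\<Sum>j\<in>{1..k}. B j * (7 * \<eta> * Q) + A j * (7 * \<eta> * Q))"
          unfolding eq
        proof (rule order_trans[OF sum_abs], rule sum_mono)
          fix j assume j: "j \<in> {1..k}"
          have 1: "\<bar>B j * ((\<Sum>i<q r. Lt d j (z + real i * \<alpha>)) - Q)\<bar> \<le> B j * (7 * \<eta> * Q)"
            unfolding abs_mult abs_of_nonneg[OF AB_nonneg(2)[OF j]]
            by (rule mult_left_mono[OF L[OF j] AB_nonneg(2)[OF j]])
          have 2: "\<bar>A j * ((\<Sum>i<q r. Rt d j (z + real i * \<alpha>)) - Q)\<bar> \<le> A j * (7 * \<eta> * Q)"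
            unfolding abs_mult abs_of_nonneg[OF AB_nonneg(1)[OF j]]
            by (rule mult_left_mono[OF R[OF j] AB_nonneg(1)[OF j]])
          show "\<bar>B j * ((\<Sum>i<q r. Lt d j (z + real i * \<alpha>)) - Q) - A j * ((\<Sum>i<q r. Rt d j (z + real i * \<alpha>)) - Q)\<bar>
             \<le> B j * (7 * \<eta> * Q) + A j * (7 * \<eta> * Q)"
            by (rule order_trans[OF abs_triangle_ineq4 add_mono[OF 1 2]])
        qed
        also have "\<dots> = 7 * \<eta> * sAB * Q"
          by (rule trans[OF sABsum]) simp
        finally show ?thesis .
      qed
      have "\<bar>(\<Sum>i<q r. F i) - (\<Sum>i<q r. G i)\<bar> \<le> (\<Sum>i<q r. \<eta> * P i + K)"
      proof -
        have "\<bar>\<Sum>i<q r. F i - G i\<bar> \<le> (\<Sum>i<q r. \<bar>F i - G i\<bar>)" by (rule sum_abs)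
        also have "\<dots> \<le> (\<Sum>i<q r. \<eta> * P i + K)" by (rule sum_mono) (simp only: FG lessThan_iff)
        finally show ?thesis by (simp only: sum_subtractf)
      qed
      moreover have "\<bar>u - w\<bar> \<le> \<bar>u - v\<bar> + \<bar>v - w\<bar>" for u v w :: real by linarith
      ultimately have "\<bar>(\<Sum>i<q r. F i) - c0 * Q\<bar> \<le> \<eta> * (16 * real k + 1) * Q + 7 * \<eta> * sAB * Q"
        using order_trans[OF _ add_mono[OF order_trans[OF _ errsum] Gsum]] by blast
      also have "\<dots> = \<eta> * (7 * sAB + 16 * real k + 1) * Q" by (simp add: algebra_simps)
      also have "\<dots> \<le> \<zeta> * Q" using \<eta>(3) Q by (intro mult_right_mono) auto
      finally have est1: "\<bar>(\<Sum>i<q r. F i) - c0 * Q\<bar> \<le> \<zeta> * Q" .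
      have LR0: "0 \<le> Lt d j y" "0 \<le> Rt d j y" for j y
        using d by (auto simp: Lt_def Rt_def intro!: \<Phi>_nonneg)
      have "(\<Sum>i<q r. \<bar>F i\<bar>) \<le> (\<Sum>i<q r. \<bar>G i\<bar> + (\<eta> * P i + K))"
        using FG by (intro sum_mono) force
      also have "\<dots> = (\<Sum>i<q r. \<bar>G i\<bar>) + (\<Sum>i<q r. \<eta> * P i + K)" by (rule sum.distrib)
      also have "(\<Sum>i<q r. \<bar>G i\<bar>) \<le> (\<Sum>i<q r. \<Sum>j\<in>{1..k}. B j * Lt d j (z + real i * \<alpha>) + A j * Rt d j (z + real i * \<alpha>))"
      proof (rule sum_mono)
        fix i
        show "\<bar>G i\<bar> \<le> (\<Sum>j\<in>{1..k}. B j * Lt d j (z + real i * \<alpha>) + A j * Rt d j (z + real i * \<alpha>))"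
          unfolding G_def
        proof (rule order_trans[OF sum_abs], rule sum_mono)
          fix j assume j: "j \<in> {1..k}"
          have "0 \<le> B j * Lt d j (z + real i * \<alpha>)" "0 \<le> A j * Rt d j (z + real i * \<alpha>)"
            using LR0 AB_nonneg[OF j] by auto
          then show "\<bar>B j * Lt d j (z + real i * \<alpha>) - A j * Rt d j (z + real i * \<alpha>)\<bar>
             \<le> B j * Lt d j (z + real i * \<alpha>) + A j * Rt d j (z + real i * \<alpha>)" by linarith
        qed
      qed
      also have "\<dots> = (\<Sum>j\<in>{1..k}. B j * (\<Sum>i<q r. Lt d j (z + real i * \<alpha>)) + A j * (\<Sum>i<q r. Rt d j (z + real i * \<alpha>)))"
        by (subst sum.swap) (simp add: sum.distrib sum_distrib_left)
      also have "\<dots> \<le> (\<Sum>j\<in>{1..k}. B j * (8 * Q) + A j * (8 * Q))"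
        using Lle Rle AB_nonneg by (intro sum_mono add_mono mult_left_mono) auto
      also have "\<dots> = 8 * sAB * Q"
        by (rule trans[OF sABsum]) simp
      finally have "(\<Sum>i<q r. \<bar>F i\<bar>) \<le> 8 * sAB * Q + \<eta> * (16 * real k + 1) * Q" using errsum by linarith
      also have "\<dots> \<le> 8 * sAB * Q + 1 * (16 * real k + 1) * Q"
        using \<eta> Q by (intro add_left_mono mult_right_mono) auto
      also have "\<dots> = C1 * Q" by (simp add: C1_def algebra_simps)
      finally have est2: "(\<Sum>i<q r. \<bar>F i\<bar>) \<le> C1 * Q" .
      show "\<bar>(\<Sum>i<q r. deriv f (z + real i * \<alpha>)) - c0 * (real (q r) * H s)\<bar> \<le> \<zeta> * (real (q r) * H s)
       \<and> (\<Sum>i<q r. \<bar>deriv f (z + real i * \<alpha>)\<bar>) \<le> C1 * (real (q r) * H s)"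
        using est1 est2 unfolding F_def Q_def by blast
    qed
  qed
qed

end


lemma int_dist_small: "\<bar>t\<bar> \<le> 1 / 2 \<Longrightarrow> int_dist t = \<bar>t\<bar>"
proof (rule antisym[OF int_dist_le_abs])
  assume t: "\<bar>t\<bar> \<le> 1 / 2"
  obtain m :: int where m: "int_dist t = \<bar>t - of_int m\<bar>" using int_dist_attained by blast
  show "\<bar>t\<bar> \<le> int_dist t"
  proof (cases "m = 0")
    case False
    then have "1 \<le> \<bar>m\<bar>" by simp
    then have "1 \<le> \<bar>of_int m :: real\<bar>" by linarith
    then show ?thesis using t m by linarith
  qed (use m in simp)
qed

lemma drift_window:
  fixes e :: "nat \<Rightarrow> real" and Q J i W' :: nat and g c C1 g1 \<epsilon> :: real
  assumes Q: "1 \<le> Q" and J: "1 \<le> J" "C1 \<le> \<bar>c\<bar> * real J / 4" and i: "1 \<le> i" and g: "0 < g"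
    and bs: "\<And>j. j < (J + 1) * i \<Longrightarrow> \<bar>(\<Sum>n\<in>{j * Q..<(j + 1) * Q}. e n) - c * g\<bar> \<le> \<bar>c\<bar> / 2 * g"
    and ba: "\<And>j. j < (J + 1) * i \<Longrightarrow> (\<Sum>n\<in>{j * Q..<(j + 1) * Q}. \<bar>e n\<bar>) \<le> C1 * g"
    and ig: "g1 \<le> real i * g" "real i * g \<le> 1"
    and W': "1 \<le> W'" "C1 / real W' < \<epsilon>" "2 * W' \<le> i * Q"
  shows "\<exists>M L. Q \<le> M \<and> real (i * Q) / (2 * real W') \<le> real L \<and> M \<le> (J + 1) * i * Q
      \<and> \<bar>c\<bar> * real J / 4 * g1 \<le> \<bar>\<Sum>n<M. e n\<bar> \<and> \<bar>\<Sum>n<M. e n\<bar> \<le> C1 * (real J + 1)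
      \<and> (\<forall>n\<in>{M..M+L}. \<bar>(\<Sum>n<n. e n) - (\<Sum>n<M. e n)\<bar> < \<epsilon>)"
proof -
  have C1: "0 \<le> C1"
  proof -
    have "0 \<le> (\<Sum>n\<in>{0 * Q..<(0 + 1) * Q}. \<bar>e n\<bar>)" by (intro sum_nonneg) auto
    also have "\<dots> \<le> C1 * g" using i by (intro ba) auto
    finally show ?thesis using g by (simp add: zero_le_mult_iff)
  qed
  have split: "(\<Sum>n\<in>{j * Q..<(j + Suc l) * Q}. w n)
     = (\<Sum>n\<in>{j * Q..<(j + l) * Q}. w n) + (\<Sum>n\<in>{(j + l) * Q..<((j + l) + 1) * Q}. w n)" for w :: "nat \<Rightarrow> real" and j l
    by (subst sum.atLeastLessThan_concat) (auto simp: add.assoc)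
  have bs': "\<bar>(\<Sum>n\<in>{j * Q..<(j + l) * Q}. e n) - real l * (c * g)\<bar> \<le> real l * (\<bar>c\<bar> / 2 * g)"
    if "j + l \<le> (J + 1) * i" for j l
    using that
  proof (induction l)
    case (Suc l)
    have "\<bar>(\<Sum>n\<in>{(j + l) * Q..<((j + l) + 1) * Q}. e n) - c * g\<bar> \<le> \<bar>c\<bar> / 2 * g" using Suc.prems by (intro bs) auto
    moreover have "\<bar>(\<Sum>n\<in>{j * Q..<(j + l) * Q}. e n) - real l * (c * g)\<bar> \<le> real l * (\<bar>c\<bar> / 2 * g)" using Suc by simp
    moreover have m: "real (Suc l) * y = real l * y + y" for y by (simp add: algebra_simps)
    ultimately show ?case unfolding split[of e j l] m by linarith
  qed simp
  have ba': "(\<Sum>n\<in>{j * Q..<(j + l) * Q}. \<bar>e n\<bar>) \<le> real l * (C1 * g)" if "j + l \<le> (J + 1) * i" for j l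
    using that
  proof (induction l)
    case (Suc l)
    have "(\<Sum>n\<in>{(j + l) * Q..<((j + l) + 1) * Q}. \<bar>e n\<bar>) \<le> C1 * g" using Suc.prems by (intro ba) auto
    moreover have "(\<Sum>n\<in>{j * Q..<(j + l) * Q}. \<bar>e n\<bar>) \<le> real l * (C1 * g)" using Suc by simp
    moreover have m: "real (Suc l) * y = real l * y + y" for y by (simp add: algebra_simps)
    ultimately show ?case unfolding split[of "\<lambda>n. \<bar>e n\<bar>" j l] m by linarith
  qed simp
  define D where "D n = (\<Sum>n<n. e n)" for n
  have diff: "\<bar>D n' - D n\<bar> \<le> (\<Sum>t\<in>{n..<n'}. \<bar>e t\<bar>)" if "n \<le> n'" for n n'
  proof -
    have "D n' - D n = (\<Sum>t\<in>{n..<n'}. e t)"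
      using sum.atLeastLessThan_concat[of 0 n n' e] that by (simp add: D_def lessThan_atLeast0)
    then show ?thesis by simp
  qed
  define n0 where "n0 = J * i * Q"
  define ell where "ell = (i * Q) div W'"
  have ell: "W' * ell \<le> i * Q" "real (i * Q) / (2 * real W') \<le> real ell"
  proof -
    show "W' * ell \<le> i * Q" by (simp add: ell_def)
    have "i * Q < W' * ell + W'" unfolding ell_def using W'(1)
      by (metis add.commute add_less_cancel_left mult.commute div_mult_mod_eq mod_less_divisor less_le_trans zero_less_one)
    then have "real (i * Q) < real W' * real ell + real W'" by (metis of_nat_add of_nat_less_iff of_nat_mult)
    moreover have "2 * real W' \<le> real (i * Q)" using W'(3) by (metis of_nat_le_iff of_nat_mult of_nat_numeral)
    ultimately have "real (i * Q) \<le> 2 * (real W' * real ell)" by linarith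
    then show "real (i * Q) / (2 * real W') \<le> real ell" using W'(1) by (simp add: field_simps)
  qed
  have tot: "(\<Sum>t\<in>{n0..<n0 + i * Q}. \<bar>e t\<bar>) \<le> real i * (C1 * g)"
    using ba'[of "J * i" i] by (simp add: n0_def algebra_simps)
  have tot1: "(\<Sum>t\<in>{n0..<n0 + i * Q}. \<bar>e t\<bar>) \<le> C1"
  proof -
    have "real i * (C1 * g) = C1 * (real i * g)" by simp
    also have "\<dots> \<le> C1 * 1" using C1 ig by (intro mult_left_mono) auto
    finally show ?thesis using tot by simp
  qed
  have pieces: "(\<Sum>t<l. \<Sum>n\<in>{n0 + t * ell..<n0 + t * ell + ell}. \<bar>e n\<bar>) = (\<Sum>n\<in>{n0..<n0 + l * ell}. \<bar>e n\<bar>)" for l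
  proof (induction l)
    case (Suc l)
    have "(\<Sum>n\<in>{n0..<n0 + Suc l * ell}. \<bar>e n\<bar>) =
      (\<Sum>n\<in>{n0..<n0 + l * ell}. \<bar>e n\<bar>) + (\<Sum>n\<in>{n0 + l * ell..<n0 + Suc l * ell}. \<bar>e n\<bar>)"
      by (rule sum.atLeastLessThan_concat[symmetric]) auto
    then show ?case using Suc by (simp add: algebra_simps)
  qed simp
  have "\<exists>t<W'. (\<Sum>n\<in>{n0 + t * ell..<n0 + t * ell + ell}. \<bar>e n\<bar>) \<le> C1 / real W'"
  proof (rule ccontr)
    assume no: "\<not> ?thesis"
    have "0 \<in> {..<W'}" using W'(1) by simp
    then have "{..<W'} \<noteq> {}" by blast
    with no have "(\<Sum>t<W'. C1 / real W') < (\<Sum>t<W'. \<Sum>n\<in>{n0 + t * ell..<n0 + t * ell + ell}. \<bar>e n\<bar>)"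
      by (intro sum_strict_mono) (auto simp: not_le)
    also have "\<dots> = (\<Sum>n\<in>{n0..<n0 + W' * ell}. \<bar>e n\<bar>)" by (rule pieces)
    also have "\<dots> \<le> (\<Sum>t\<in>{n0..<n0 + i * Q}. \<bar>e t\<bar>)" using ell(1) by (intro sum_mono2) auto
    also have "\<dots> \<le> C1" by (rule tot1)
    finally show False using W'(1) by simp
  qed
  then obtain t where t: "t < W'" "(\<Sum>n\<in>{n0 + t * ell..<n0 + t * ell + ell}. \<bar>e n\<bar>) \<le> C1 / real W'" by blast
  define M where "M = n0 + t * ell"
  have Mend: "M + ell \<le> n0 + i * Q"
  proof -
    have "(t + 1) * ell \<le> W' * ell" using t(1) by (intro mult_right_mono) auto
    then show ?thesis using ell(1) by (simp add: M_def)
  qed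
  have "Q \<le> M" unfolding M_def n0_def using J(1) i by (simp add: trans_le_add1)
  moreover have "M \<le> (J + 1) * i * Q" using Mend by (simp add: n0_def algebra_simps)
  moreover have "\<bar>D n - D M\<bar> < \<epsilon>" if n: "n \<in> {M..M + ell}" for n
  proof -
    have "\<bar>D n - D M\<bar> \<le> (\<Sum>t\<in>{M..<n}. \<bar>e t\<bar>)" using n by (intro diff) auto
    also have "\<dots> \<le> (\<Sum>t\<in>{M..<M + ell}. \<bar>e t\<bar>)" using n by (intro sum_mono2) auto
    also have "\<dots> \<le> C1 / real W'" using t(2) by (simp add: M_def)
    finally show ?thesis using W'(2) by simp
  qed
  moreover have "\<bar>c\<bar> * real J / 4 * g1 \<le> \<bar>D M\<bar>"
  proof -
    have D0: "\<bar>D n0 - real (J * i) * (c * g)\<bar> \<le> real (J * i) * (\<bar>c\<bar> / 2 * g)"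
      using bs'[of 0 "J * i"] by (simp add: D_def n0_def lessThan_atLeast0)
    have "real (J * i) * (\<bar>c\<bar> * g) = \<bar>real (J * i) * (c * g)\<bar>" using g by (simp add: abs_mult)
    then have 1: "real (J * i) * (\<bar>c\<bar> * g) - real (J * i) * (\<bar>c\<bar> / 2 * g) \<le> \<bar>D n0\<bar>" using D0 by linarith
    have "\<bar>D M - D n0\<bar> \<le> (\<Sum>t\<in>{n0..<M}. \<bar>e t\<bar>)" by (intro diff) (simp add: M_def)
    also have "\<dots> \<le> (\<Sum>t\<in>{n0..<n0 + i * Q}. \<bar>e t\<bar>)" using Mend by (intro sum_mono2) auto
    also have "\<dots> \<le> real i * (C1 * g)" by (rule tot)
    also have "\<dots> \<le> real i * (\<bar>c\<bar> * real J / 4 * g)" using J(2) g by (intro mult_left_mono mult_right_mono) auto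
    finally have 2: "\<bar>D M - D n0\<bar> \<le> real i * (\<bar>c\<bar> * real J / 4 * g)" .
    have "\<bar>c\<bar> * real J / 4 * g1 \<le> \<bar>c\<bar> * real J / 4 * (real i * g)" using ig by (intro mult_left_mono) auto
    also have "\<dots> = real (J * i) * (\<bar>c\<bar> * g) - real (J * i) * (\<bar>c\<bar> / 2 * g) - real i * (\<bar>c\<bar> * real J / 4 * g)"
      by (simp add: field_simps)
    also have "\<dots> \<le> \<bar>D M\<bar>" using 1 2 by linarith
    finally show ?thesis .
  qed
  moreover have "\<bar>D M\<bar> \<le> C1 * (real J + 1)"
  proof -
    have "\<bar>D M - D 0\<bar> \<le> (\<Sum>t\<in>{0..<M}. \<bar>e t\<bar>)" by (intro diff) simp
    also have "\<dots> \<le> (\<Sum>t\<in>{0 * Q..<(0 + (J + 1) * i) * Q}. \<bar>e t\<bar>)"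
      using Mend by (intro sum_mono2) (auto simp: n0_def algebra_simps)
    also have "\<dots> \<le> real ((J + 1) * i) * (C1 * g)" by (intro ba') simp
    also have "\<dots> = C1 * (real J + 1) * (real i * g)" by (simp add: algebra_simps)
    also have "\<dots> \<le> C1 * (real J + 1) * 1" using C1 ig by (intro mult_left_mono) auto
    finally show ?thesis by (simp add: D_def)
  qed
  ultimately show ?thesis using ell(2) unfolding D_def by (intro exI[of _ M] exI[of _ ell]) blast
qed

context singular_rotation
begin

subsection \<open>Staying away from the singularities\<close>

lemma badly_approximable_unique:
  assumes "i < q s" "i' < q s" "j \<in> {1..k}" "j' \<in> {1..k}"
    and "int_dist (z + real i * \<alpha> - a j) \<le> 1 / (2 * C * real (q s))"
    and "int_dist (z + real i' * \<alpha> - a j') \<le> 1 / (2 * C * real (q s))"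
  shows "i = i'"
proof -
  define \<rho> where "\<rho> = 1 / (2 * C * real (q s))"
  define P where "P l \<longleftrightarrow> l < q s \<and> frac (frac z + real l * \<alpha>) \<in> (\<Union>b\<in>a ` {1..k}. frac ` {b - \<rho> .. b + \<rho>})" for l
  have "\<exists>\<^sub>\<le>\<^sub>1 l. P l"
    unfolding P_def \<rho>_def
    by (rule bad[unfolded badly_approximable_def, THEN bspec, THEN spec]) (simp add: circle_def frac_lt_1)
  moreover have "P l" if l: "l < q s" "m \<in> {1..k}" "int_dist (z + real l * \<alpha> - a m) \<le> \<rho>" for l m
  proof -
    define t where "t = z + real l * \<alpha> - a m - of_int (round (z + real l * \<alpha> - a m))"
    have t: "\<bar>t\<bar> \<le> \<rho>" using l(3) by (simp add: int_dist_def t_def)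
    have "z + real l * \<alpha> = (a m + t) + of_int (round (z + real l * \<alpha> - a m))" by (simp add: t_def)
    then have "frac (z + real l * \<alpha>) = frac (a m + t)" by (metis frac_add_of_int_right)
    moreover have "a m + t \<in> {a m - \<rho> .. a m + \<rho>}" using t by (auto simp: abs_le_iff)
    ultimately have "frac (z + real l * \<alpha>) \<in> frac ` {a m - \<rho> .. a m + \<rho>}" by (simp only: imageI)
    then show ?thesis using l by (auto simp: P_def)
  qed
  ultimately show ?thesis using assms unfolding \<rho>_def[symmetric] by (intro Uniq_D[of P]) blast+
qed

definition far :: "real \<Rightarrow> real \<Rightarrow> bool" where
  "far z d \<longleftrightarrow> (\<forall>j\<in>{1..k}. d \<le> int_dist (z - a j))"

lemma not_far: "\<not> far z d \<longleftrightarrow> (\<exists>j\<in>{1..k}. int_dist (z - a j) < d)"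
  by (auto simp: far_def not_le)

definition K\<alpha> :: "nat set" where "K\<alpha> = {s. real (q (Suc s)) < 1 / x s}"

definition close :: "nat \<Rightarrow> real set" where
  "close s = {z. s \<notin> K\<alpha> \<and> (\<exists>b<q s. \<not> far (z + real b * \<alpha>) (x s / (2 * C)))}"

definition ext :: "nat \<Rightarrow> real" where "ext s = (if s \<in> K\<alpha> then 0 else real (q s) * x s)"

lemma ext_summable: "summable ext" and ext_nonneg: "0 \<le> ext s"
proof -
  have nn: "0 \<le> ext s" for s using x_pos[of s] by (simp add: ext_def)
  then show "0 \<le> ext s" .
  have "(\<lambda>i. real (q i) * x i) summable_on (- K\<alpha>)" using cond2 by (simp add: K\<alpha>_def)
  then have "ext summable_on UNIV"
    by (subst summable_on_cong_neutral[where T = "- K\<alpha>" and g = "\<lambda>i. real (q i) * x i"]) (auto simp: ext_def)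
  then show "summable ext" by (simp add: summable_on_UNIV_nonneg_real_iff nn)
qed

lemma one_sided_avoidance:
  "\<forall>\<^sub>F s in sequentially. \<forall>z. z \<notin> close s \<longrightarrow>
     (\<forall>n. real n \<le> 1 / (8 * C) * real (q (Suc s)) \<longrightarrow> far (z + real n * \<alpha>) (x s / (2 * C))) \<or>
     (\<forall>n. 1 \<le> n \<longrightarrow> real n \<le> 1 / (8 * C) * real (q (Suc s)) \<longrightarrow> far (z - real n * \<alpha>) (x s / (2 * C)))"
proof -
  have e1: "\<forall>\<^sub>F s in sequentially. ext s < 1 / (2 + 8 * C)"
    using order_tendstoD(2)[OF summable_LIMSEQ_zero[OF ext_summable], of "1 / (2 + 8 * C)"] C_gt by simp
  have e2: "\<forall>\<^sub>F s in sequentially. \<forall>i\<in>{1..k}. \<forall>j\<in>{1..k}. i \<noteq> j \<longrightarrow> 2 / real (q s) < int_dist (a i - a j)"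
  proof (intro eventually_ball_finite ballI)
    fix i j assume ij: "i \<in> {1..k}" "j \<in> {1..k}"
    show "\<forall>\<^sub>F s in sequentially. i \<noteq> j \<longrightarrow> 2 / real (q s) < int_dist (a i - a j)"
    proof (cases "i = j")
      case False
      then have p: "0 < int_dist (a i - a j)" by (rule a_separated[OF ij])
      have "\<forall>\<^sub>F s in sequentially. 2 / int_dist (a i - a j) < real (q s)"
        using filterlim_q by (auto simp: filterlim_at_top_dense)
      then show ?thesis
      proof eventually_elim
        fix s assume "2 / int_dist (a i - a j) < real (q s)"
        then show "i \<noteq> j \<longrightarrow> 2 / real (q s) < int_dist (a i - a j)"
          using p q_pos[of s] by (simp add: pos_divide_less_eq mult.commute)
      qed
    qed simp
  qed auto
  have e3: "\<forall>\<^sub>F s in sequentially. 2 \<le> real (q s)"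
    using filterlim_q unfolding filterlim_at_top by blast
  from e1 e2 e3 show ?thesis
  proof eventually_elim
    case (elim s)
    show ?case
    proof (intro allI impI, rule ccontr)
      fix z assume z: "z \<notin> close s"
      assume "\<not> ((\<forall>n. real n \<le> 1 / (8 * C) * real (q (Suc s)) \<longrightarrow> far (z + real n * \<alpha>) (x s / (2 * C))) \<or>
        (\<forall>n. 1 \<le> n \<longrightarrow> real n \<le> 1 / (8 * C) * real (q (Suc s)) \<longrightarrow> far (z - real n * \<alpha>) (x s / (2 * C))))"
      then obtain n n' j j' where n: "real n \<le> 1 / (8 * C) * real (q (Suc s))" "j \<in> {1..k}"
          "int_dist (z + real n * \<alpha> - a j) < x s / (2 * C)"
        and n': "1 \<le> n'" "real n' \<le> 1 / (8 * C) * real (q (Suc s))" "j' \<in> {1..k}"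
          "int_dist (z - real n' * \<alpha> - a j') < x s / (2 * C)"
        unfolding de_Morgan_disj not_all not_imp not_far by blast
      have qS: "2 \<le> q (Suc s)" using q_ge[of "Suc s"] by simp
      show False
      proof (cases "s \<in> K\<alpha>")
        case True
        define w where "w = q (Suc s) div 2"
        have c8: "1 / (8 * C) * real (q (Suc s)) \<le> real (q (Suc s)) / 8"
        proof -
          have "1 / (8 * C) \<le> 1 / 8" using C_gt by (intro divide_left_mono) auto
          then have "1 / (8 * C) * real (q (Suc s)) \<le> 1 / 8 * real (q (Suc s))" by (rule mult_right_mono) simp
          then show ?thesis by simp
        qed
        have w: "2 * w \<le> q (Suc s)" "q (Suc s) \<le> 2 * w + 1" by (auto simp: w_def)
        have n1: "8 * real n \<le> real (q (Suc s))" "8 * real n' \<le> real (q (Suc s))" using n(1) n'(2) c8 by linarith+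
        then have n2: "8 * n \<le> q (Suc s)" "8 * n' \<le> q (Suc s)" by linarith+
        have idx: "w + n < q (Suc s)" "w - n' < q (Suc s)" "n' \<le> w" using n2 w qS by linarith+
        have \<rho>: "x s / (2 * C) \<le> 1 / (2 * C * real (q (Suc s)))"
        proof -
          have "real (q (Suc s)) * x s < 1" using True x_pos[of s] by (simp add: K\<alpha>_def field_simps)
          then show ?thesis using C_gt qS by (simp add: field_simps)
        qed
        have "w + n = w - n'"
        proof (rule badly_approximable_unique[OF idx(1,2) n(2) n'(3)])
          show "int_dist (z - real w * \<alpha> + real (w + n) * \<alpha> - a j) \<le> 1 / (2 * C * real (q (Suc s)))"
            using n(3) \<rho> by (simp add: algebra_simps)
          show "int_dist (z - real w * \<alpha> + real (w - n') * \<alpha> - a j') \<le> 1 / (2 * C * real (q (Suc s)))"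
            using n'(4) \<rho> idx(3) by (simp add: algebra_simps of_nat_diff)
        qed
        then show False using n'(1) idx(3) by simp
      next
        case False
        define X where "X = x s / (2 * C)"
        define \<rho> where "\<rho> = 1 / (2 * C * real (q s))"
        define p where "p = round (real (q s) * \<alpha>)"
        define \<beta> where "\<beta> = real (q s) * \<alpha> - of_int p"
        have qs: "1 \<le> real (q s)" using q_pos[of s] by simp
        have X0: "0 < X" using x_pos[of s] C_gt by (simp add: X_def)
        have bd: "\<bar>\<beta>\<bar> < 2 / real (q (Suc s))" using int_dist_q_le[of s] by (simp add: \<beta>_def p_def int_dist_def)
        have xq: "(2 + 8 * C) * (real (q s) * x s) \<le> 1"
          using elim(1) False C_gt by (simp add: ext_def field_simps)
        have xr: "2 * x s + X \<le> \<rho> / 2" 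
        proof -
          have "2 * x s + X = (2 + 8 * C) * (real (q s) * x s) / (4 * C * real (q s))"
            using C_gt qs by (simp add: X_def field_simps)
          also have "\<dots> \<le> 1 / (4 * C * real (q s))" using xq C_gt qs by (intro divide_right_mono) auto
          also have "\<dots> = \<rho> / 2" by (simp add: \<rho>_def)
          finally show ?thesis .
        qed
        have "1 / x s \<le> real (q (Suc s))" using False by (simp add: K\<alpha>_def)
        then have "2 / real (q (Suc s)) \<le> 2 * x s" using x_pos[of s] qS by (simp add: field_simps)
        then have bx: "\<bar>\<beta>\<bar> \<le> 2 * x s" using bd by simp
        have \<rho>1: "\<rho> * real (q s) < 1 / 2" "0 < \<rho>"
          using C_gt qs by (auto simp: \<rho>_def field_simps)
        have "\<rho> * 2 \<le> \<rho> * real (q s)" using \<rho>1(2) elim(3) by (intro mult_left_mono) auto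
        then have \<rho>small: "\<rho> \<le> 1 / 4" using \<rho>1(1) by linarith
        have shift: "int_dist (y + real m * real (q s) * \<alpha>) = int_dist (y + real m * \<beta>)" for y m
        proof -
          have "y + real m * real (q s) * \<alpha> = (y + real m * \<beta>) + of_int (int m * p)"
            by (simp add: \<beta>_def algebra_simps)
          then show ?thesis by (metis int_dist_add_int)
        qed
        have shift': "int_dist (y - real m * real (q s) * \<alpha>) = int_dist (y - real m * \<beta>)" for y m
        proof -
          have "y - real m * real (q s) * \<alpha> = (y - real m * \<beta>) + of_int (- int m * p)"
            by (simp add: \<beta>_def algebra_simps)
          then show ?thesis by (metis int_dist_add_int)
        qed
        define b where "b = n mod q s"
        define J where "J = n div q s"
        define J' where "J' = (n' + q s - 1) div q s"
        define b' where "b' = J' * q s - n'"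
        have nb: "n = J * q s + b" "b < q s" using q_pos[of s] by (simp_all add: b_def J_def)
        have J'a: "n' \<le> J' * q s" "J' * q s \<le> n' + q s - 1"
        proof -
          have "n' + q s - 1 = J' * q s + (n' + q s - 1) mod q s"
            unfolding J'_def by (rule div_mult_mod_eq[symmetric])
          moreover have "(n' + q s - 1) mod q s < q s" using q_pos[of s] by simp
          ultimately show "n' \<le> J' * q s" "J' * q s \<le> n' + q s - 1" by linarith+
        qed
        then have b': "b' < q s" "real n' = real J' * real (q s) - real b'"
          using q_pos[of s] n'(1) unfolding b'_def by (linarith, simp add: of_nat_diff)
        have J'1: "1 \<le> J'" using J'a n'(1) by (cases J') auto
        have Jb: "real J * \<bar>\<beta>\<bar> \<le> \<rho> / 2"
        proof -
          have "real J * real (q s) \<le> real n" using nb(1) by (simp flip: of_nat_mult)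
          also have "\<dots> \<le> 1 / (8 * C) * real (q (Suc s))" by (rule n(1))
          finally have "real J \<le> 1 / (8 * C) * real (q (Suc s)) / real (q s)"
            by (rule mult_imp_le_div_pos[rotated]) (use qs in simp)
          then have "real J * \<bar>\<beta>\<bar> \<le> (1 / (8 * C) * real (q (Suc s)) / real (q s)) * (2 / real (q (Suc s)))"
            using bd C_gt by (intro mult_mono) auto
          also have "\<dots> = \<rho> / 2" using qS by (simp add: \<rho>_def)
          finally show ?thesis .
        qed
        have Jb': "real J' * \<bar>\<beta>\<bar> \<le> \<rho> / 2 + 2 * x s"
        proof -
          have "J' * q s \<le> n' + q s" using J'a(2) by linarith
          then have "real J' * real (q s) \<le> real n' + real (q s)" by (metis of_nat_add of_nat_le_iff of_nat_mult)
          also have "\<dots> \<le> 1 / (8 * C) * real (q (Suc s)) + real (q s)" using n'(2) by simp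
          finally have "real J' \<le> (1 / (8 * C) * real (q (Suc s)) + real (q s)) / real (q s)"
            by (rule mult_imp_le_div_pos[rotated]) (use qs in simp)
          also have "\<dots> = 1 / (8 * C) * real (q (Suc s)) / real (q s) + 1"
            using qs by (simp add: add_divide_distrib)
          finally have "real J' \<le> 1 / (8 * C) * real (q (Suc s)) / real (q s) + 1" .
          then have "real J' * \<bar>\<beta>\<bar> \<le> (1 / (8 * C) * real (q (Suc s)) / real (q s) + 1) * \<bar>\<beta>\<bar>"
            by (intro mult_right_mono) auto
          also have "\<dots> = (1 / (8 * C) * real (q (Suc s)) / real (q s)) * \<bar>\<beta>\<bar> + \<bar>\<beta>\<bar>" by (simp add: algebra_simps)
          also have "\<dots> \<le> (1 / (8 * C) * real (q (Suc s)) / real (q s)) * (2 / real (q (Suc s))) + 2 * x s"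
            using bd bx C_gt by (intro add_mono mult_left_mono) auto
          also have "\<dots> = \<rho> / 2 + 2 * x s" using qS by (simp add: \<rho>_def)
          finally show ?thesis .
        qed
        have xs: "0 < x s" by (rule x_pos)
        have d1: "int_dist (z + real b * \<alpha> - a j + real J * \<beta>) < X"
          using n(3) nb(1) shift[of "z + real b * \<alpha> - a j" J] by (simp add: X_def algebra_simps)
        have d2: "int_dist (z + real b' * \<alpha> - a j' - real J' * \<beta>) < X"
          using n'(4) shift'[of "z + real b' * \<alpha> - a j'" J'] unfolding b'(2) by (simp add: X_def algebra_simps)
        have near1: "int_dist (z + real b * \<alpha> - a j) \<le> \<rho>"
          using int_dist_triangle[of "z + real b * \<alpha> - a j + real J * \<beta>" "- (real J * \<beta>)"]
            int_dist_le_abs[of "real J * \<beta>"] d1 Jb xr xs by (simp add: abs_mult)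
        have near2: "int_dist (z + real b' * \<alpha> - a j') \<le> \<rho>"
          using int_dist_triangle[of "z + real b' * \<alpha> - a j' - real J' * \<beta>" "real J' * \<beta>"]
            int_dist_le_abs[of "real J' * \<beta>"] d2 Jb' xr xs by (simp add: abs_mult)
        have bb: "b = b'"
          by (rule badly_approximable_unique[OF nb(2) b'(1) n(2) n'(3)]) (use near1 near2 in \<open>simp_all add: \<rho>_def\<close>)
        have jj: "j = j'"
        proof (rule ccontr)
          assume "j \<noteq> j'"
          then have "2 / real (q s) < int_dist (a j - a j')" using elim(2) n(2) n'(3) by blast
          also have "int_dist (a j - a j') \<le> int_dist (a j - (z + real b * \<alpha>)) + int_dist (z + real b * \<alpha> - a j')"
            using int_dist_triangle[of "a j - (z + real b * \<alpha>)" "z + real b * \<alpha> - a j'"] by simp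
          also have "\<dots> \<le> \<rho> + \<rho>" using near1 near2 bb int_dist_commute[of "a j" "z + real b * \<alpha>"] by simp
          finally show False using \<rho>1(1) qs by (simp add: field_simps)
        qed
        define y where "y = z + real b * \<alpha> - a j"
        define y0 where "y0 = y - of_int (round y)"
        have y0: "\<bar>y0\<bar> = int_dist y" by (simp add: y0_def int_dist_def)
        have yX: "X \<le> \<bar>y0\<bar>"
        proof -
          have "far (z + real b * \<alpha>) X" using z False nb(2) by (auto simp: close_def X_def)
          then show ?thesis using n(2) unfolding y0 y_def far_def by blast
        qed
        have y\<rho>: "\<bar>y0\<bar> \<le> \<rho>" using near1 by (simp add: y0 y_def)
        have eqi: "int_dist (y + t) = int_dist (y0 + t)" for t
        proof -
          have "y + t = (y0 + t) + of_int (round y)" by (simp add: y0_def)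
          then show ?thesis by (metis int_dist_add_int)
        qed
        have x14: "2 * x s \<le> \<rho> / 2" using xr X0 by simp
        have s1: "\<bar>y0 + real J * \<beta>\<bar> < X \<or> 1 / 2 < \<bar>y0 + real J * \<beta>\<bar>"
          using d1 int_dist_small[of "y0 + real J * \<beta>"] eqi[of "real J * \<beta>"] by (fastforce simp: y_def)
        have s2: "\<bar>y0 - real J' * \<beta>\<bar> < X \<or> 1 / 2 < \<bar>y0 - real J' * \<beta>\<bar>"
          using d2 int_dist_small[of "y0 - real J' * \<beta>"] eqi[of "- (real J' * \<beta>)"]
          by (fastforce simp: y_def bb jj)
        have "\<bar>y0 + real J * \<beta>\<bar> \<le> \<bar>y0\<bar> + real J * \<bar>\<beta>\<bar>" using abs_triangle_ineq[of y0 "real J * \<beta>"] by (simp add: abs_mult)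
        then have t1: "\<bar>y0 + real J * \<beta>\<bar> < X" using s1 y\<rho> Jb \<rho>small by linarith
        have "\<bar>y0 - real J' * \<beta>\<bar> \<le> \<bar>y0\<bar> + real J' * \<bar>\<beta>\<bar>" using abs_triangle_ineq4[of y0 "real J' * \<beta>"] by (simp add: abs_mult)
        then have t2: "\<bar>y0 - real J' * \<beta>\<bar> < X" using s2 y\<rho> Jb' x14 \<rho>small by linarith
        show False
        proof (cases "0 \<le> \<beta>")
          case True
          then have "0 \<le> real J * \<beta>" "0 \<le> real J' * \<beta>" by auto
          then show False using t1 t2 yX X0 by linarith
        next
          case False
          then have "real J * \<beta> \<le> 0" "real J' * \<beta> \<le> 0" by (auto simp: mult_le_0_iff)
          then show False using t1 t2 yX X0 by linarith
        qed
      qed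
    qed
  qed
qed

end


context singular_rotation
begin

subsection \<open>Choosing the scale\<close>

lemma qH_mono: "r \<le> s \<Longrightarrow> real (q r) * H r \<le> real (q s) * H s"
  using q_mono[of r s] H_mono[of r s] H_pos[of r] by (intro mult_mono) (auto intro: less_imp_le)

lemma scale_selection:
  assumes b: "1 \<le> b"
  obtains u W where "0 < u" "1 \<le> W"
    and "\<And>s0. \<exists>\<delta>>0. \<forall>\<Delta>. 0 < \<Delta> \<longrightarrow> \<Delta> < \<delta> \<longrightarrow> (\<exists>r s. s0 \<le> r \<and> r \<le> s \<and> real (q s) \<le> W * real (q r)
        \<and> real (q s) * H s * \<Delta> \<le> 1 \<and> u \<le> real (q (Suc s)) * H s * \<Delta> \<and> b * real (q r) \<le> real (q (Suc s)))"
proof -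
  obtain M :: nat where M: "b < 2 ^ M" using real_arch_pow[of 2 b] by auto
  define m where "m = 2 * M"
  define W where "W = b ^ Suc m"
  define u where "u = m\<^sub>0 ^ Suc m / b ^ m"
  have m0: "0 < m\<^sub>0" "m\<^sub>0 < 1" using m0_pos m0_less by auto
  have u: "0 < u" "1 \<le> W" using m0 b one_le_power[OF b, of "Suc m"] unfolding u_def W_def by (simp, simp)
  have u_le: "u \<le> m\<^sub>0 ^ Suc j / b ^ j" if "j \<le> m" for j
  proof -
    have "m\<^sub>0 ^ Suc m / b ^ m \<le> m\<^sub>0 ^ Suc j / b ^ j"
      using that m0 b by (intro frac_le power_decreasing power_increasing) auto
    then show ?thesis by (simp add: u_def)
  qed
  have Hm: "m\<^sub>0 ^ j * H (s + j) \<le> H s" for s j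
  proof (induction j)
    case (Suc j)
    have "m\<^sub>0 ^ Suc j * H (s + Suc j) = m\<^sub>0 ^ j * (m\<^sub>0 * H (Suc (s + j)))" by simp
    also have "\<dots> \<le> m\<^sub>0 ^ j * H (s + j)" using m0 H_ratio[of "s + j"] by (intro mult_left_mono) auto
    also have "\<dots> \<le> H s" by (rule Suc)
    finally show ?case .
  qed simp
  have "\<exists>\<delta>>0. \<forall>\<Delta>. 0 < \<Delta> \<longrightarrow> \<Delta> < \<delta> \<longrightarrow> (\<exists>r s. s0 \<le> r \<and> r \<le> s \<and> real (q s) \<le> W * real (q r)
        \<and> real (q s) * H s * \<Delta> \<le> 1 \<and> u \<le> real (q (Suc s)) * H s * \<Delta> \<and> b * real (q r) \<le> real (q (Suc s)))" for s0
  proof -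
    define N where "N = s0 + m"
    have QN: "0 < real (q N) * H N" using q_pos[of N] H_pos[of N] by simp
    define \<delta> where "\<delta> = 1 / (real (q N) * H N)"
    have "\<exists>r s. s0 \<le> r \<and> r \<le> s \<and> real (q s) \<le> W * real (q r)
        \<and> real (q s) * H s * \<Delta> \<le> 1 \<and> u \<le> real (q (Suc s)) * H s * \<Delta> \<and> b * real (q r) \<le> real (q (Suc s))"
      if \<Delta>: "0 < \<Delta>" "\<Delta> < \<delta>" for \<Delta>
    proof -
      define F where "F = {s. real (q s) * H s * \<Delta> \<le> 1}"
      have NF: "N \<in> F" using \<Delta>(2) QN by (simp add: F_def \<delta>_def pos_less_divide_eq mult.commute)
      have "\<forall>\<^sub>F s in sequentially. 1 / (H 0 * \<Delta>) < real (q s)"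
        using filterlim_q by (auto simp: filterlim_at_top_dense)
      then obtain s1 where s1: "\<And>s. s1 \<le> s \<Longrightarrow> 1 / (H 0 * \<Delta>) < real (q s)" by (auto simp: eventually_sequentially)
      have "F \<subseteq> {..s1}"
      proof (rule subsetI, rule ccontr)
        fix s assume s: "s \<in> F" "s \<notin> {..s1}"
        then have "1 / (H 0 * \<Delta>) < real (q s)" by (intro s1) simp
        then have "1 < real (q s) * (H 0 * \<Delta>)" using H_pos[of 0] \<Delta>(1) by (simp add: pos_divide_less_eq)
        also have "\<dots> \<le> real (q s) * (H s * \<Delta>)" using H_mono[of 0 s] \<Delta>(1) by (intro mult_left_mono mult_right_mono) auto
        finally show False using s(1) by (simp add: F_def mult.assoc)
      qed
      then have finF: "finite F" by (rule finite_subset) simp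
      define t where "t = Max F"
      have tF: "t \<in> F" unfolding t_def using finF NF by (intro Max_in) auto
      have Nt: "N \<le> t" unfolding t_def using finF NF by (rule Max_ge)
      have "Suc t \<notin> F" using Max_ge[OF finF, of "Suc t"] by (auto simp: t_def)
      then have t1: "1 < real (q (Suc t)) * H (Suc t) * \<Delta>" by (simp add: F_def not_le)
      have tle: "real (q s) * H s * \<Delta> \<le> 1" if "s \<le> t" for s
      proof -
        have "real (q s) * H s * \<Delta> \<le> real (q t) * H t * \<Delta>"
          using qH_mono[OF that] \<Delta>(1) by (intro mult_right_mono) auto
        then show ?thesis using tF by (simp add: F_def)
      qed
      define P where "P j \<longleftrightarrow> b * real (q (t - j)) \<le> real (q (Suc t - j))" for j
      have chain: "real (q (Suc t)) \<le> b ^ j * real (q (Suc t - j))" if "\<And>i. i < j \<Longrightarrow> \<not> P i" "j \<le> Suc t" for j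
        using that
      proof (induction j)
        case (Suc j)
        have IH: "real (q (Suc t)) \<le> b ^ j * real (q (Suc t - j))" using Suc by auto
        have "real (q (Suc t - j)) < b * real (q (t - j))" using Suc.prems(1)[of j] by (simp add: P_def not_le)
        then have "b ^ j * real (q (Suc t - j)) \<le> b ^ j * (b * real (q (t - j)))"
          using b by (intro mult_left_mono) auto
        then show ?case using IH by (simp add: mult.assoc mult.left_commute)
      qed simp
      show ?thesis
      proof (cases "\<exists>j\<le>m. P j")
        case True
        define j where "j = (LEAST j. P j)"
        have j: "P j" "\<And>i. i < j \<Longrightarrow> \<not> P i" "j \<le> m"
        proof -
          obtain i where i: "i \<le> m" "P i" using True by blast
          show "P j" unfolding j_def using i(2) by (rule LeastI)
          show "j \<le> m" using Least_le[of P i] i by (simp add: j_def)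
          show "\<And>i. i < j \<Longrightarrow> \<not> P i" unfolding j_def by (rule not_less_Least)
        qed
        define s where "s = t - j"
        have jt: "j \<le> t" using j(3) Nt by (simp add: N_def)
        have sS: "Suc t - j = Suc s" "t = s + j" using jt by (auto simp: s_def)
        have "u \<le> real (q (Suc s)) * H s * \<Delta>"
        proof -
          have 1: "real (q (Suc t)) / b ^ j \<le> real (q (Suc s))"
          proof -
            have "real (q (Suc t)) \<le> b ^ j * real (q (Suc t - j))" by (rule chain[OF j(2)]) (use jt in auto)
            then show ?thesis unfolding sS(1) using b by (simp add: pos_divide_le_eq mult.commute)
          qed
          have 2: "m\<^sub>0 ^ Suc j * H (Suc t) \<le> H s" using Hm[of "Suc j" s] sS by simp
          have "u \<le> m\<^sub>0 ^ Suc j / b ^ j * 1" using u_le[OF j(3)] by simp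
          also have "\<dots> \<le> m\<^sub>0 ^ Suc j / b ^ j * (real (q (Suc t)) * H (Suc t) * \<Delta>)"
            using t1 m0 b by (intro mult_left_mono) auto
          also have "\<dots> = (real (q (Suc t)) / b ^ j) * (m\<^sub>0 ^ Suc j * H (Suc t)) * \<Delta>" by simp
          also have "\<dots> \<le> real (q (Suc s)) * H s * \<Delta>"
            using 1 2 \<Delta>(1) m0 b H_pos[of "Suc t"] by (intro mult_right_mono mult_mono) auto
          finally show ?thesis .
        qed
        moreover have "real (q s) \<le> W * real (q s)" using u(2) by (intro mult_right_mono[of 1 W, simplified]) auto
        moreover have "b * real (q s) \<le> real (q (Suc s))" using j(1) by (simp add: P_def sS(1) flip: s_def)
        moreover have "s0 \<le> s" using j(3) Nt by (simp add: s_def N_def)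
        ultimately show ?thesis using tle[of s] by (intro exI[of _ s]) (simp add: s_def)
      next
        case False
        define r where "r = t - m"
        have mt: "m \<le> t" using Nt by (simp add: N_def)
        have tr: "t = r + 2 * M" using mt by (simp add: r_def m_def)
        have c: "real (q (Suc t)) \<le> b ^ Suc m * real (q r)"
          using chain[of "Suc m"] False mt by (simp add: r_def)
        have "real (q t) \<le> W * real (q r)" using c q_mono[of t "Suc t"] by (simp add: W_def)
        moreover have "u \<le> real (q (Suc t)) * H t * \<Delta>"
        proof -
          have "u \<le> m\<^sub>0 * 1" using u_le[of 0] by simp
          also have "\<dots> \<le> m\<^sub>0 * (real (q (Suc t)) * H (Suc t) * \<Delta>)" using t1 m0 by (intro mult_left_mono) auto
          also have "\<dots> = real (q (Suc t)) * (m\<^sub>0 * H (Suc t)) * \<Delta>" by simp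
          also have "\<dots> \<le> real (q (Suc t)) * H t * \<Delta>"
            using H_ratio[of t] \<Delta>(1) by (intro mult_right_mono mult_left_mono) auto
          finally show ?thesis .
        qed
        moreover have "b * real (q r) \<le> real (q (Suc t))"
        proof -
          have "b * real (q r) \<le> 2 ^ M * real (q r)" using M by (intro mult_right_mono) auto
          also have "\<dots> = real (2 ^ M * q r)" by simp
          also have "\<dots> \<le> real (q t)" unfolding tr of_nat_le_iff by (rule q_growth)
          also have "\<dots> \<le> real (q (Suc t))" using q_mono[of t "Suc t"] by simp
          finally show ?thesis .
        qed
        moreover have "s0 \<le> r" using Nt by (simp add: r_def N_def)
        ultimately show ?thesis using tle[of t] by (intro exI[of _ r] exI[of _ t]) (simp add: r_def)
      qed
    qed
    moreover have "0 < \<delta>" using QN by (simp add: \<delta>_def)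
    ultimately show ?thesis by blast
  qed
  with u show thesis by (rule that)
qed

subsection \<open>Increments over one block\<close>

lemma weighted_mvt:
  fixes w t :: "nat \<Rightarrow> real"
  assumes far: "\<And>\<xi> i. i < n \<Longrightarrow> \<bar>\<xi> - z\<bar> \<le> \<bar>v\<bar> \<Longrightarrow> frac (\<xi> + t i) \<notin> a ` {1..k}"
  shows "\<exists>\<xi>. \<bar>\<xi> - z\<bar> \<le> \<bar>v\<bar> \<and> (\<Sum>i<n. w i * (f (z + v + t i) - f (z + t i))) = v * (\<Sum>i<n. w i * deriv f (\<xi> + t i))"
proof -
  define F where "F y = (\<Sum>i<n. w i * f (z + y * v + t i))" for y
  have "\<exists>y::real. 0 < y \<and> y < 1 \<and> F 1 - F 0 = (1 - 0) * (\<Sum>i<n. w i * (deriv f (z + y * v + t i) * v))"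
  proof (rule MVT2)
    fix y :: real assume y: "0 \<le> y" "y \<le> 1"
    have near: "\<bar>(z + y * v) - z\<bar> \<le> \<bar>v\<bar>" using y by (simp add: abs_mult mult_left_le_one_le)
    have d: "((\<lambda>y. f (z + y * v + t i)) has_real_derivative deriv f (z + y * v + t i) * v) (at y)" if "i < n" for i
    proof -
      have "((\<lambda>y. z + y * v + t i) has_real_derivative v) (at y)"
        by (auto intro!: derivative_eq_intros)
      from DERIV_chain2[OF f_deriv[OF far[OF that near]] this] show ?thesis .
    qed
    show "(F has_real_derivative (\<Sum>i<n. w i * (deriv f (z + y * v + t i) * v))) (at y)"
      unfolding F_def[abs_def] using d by (intro DERIV_sum DERIV_cmult) auto
  qed simp
  then obtain y where y: "0 < y" "y < 1" "F 1 - F 0 = (\<Sum>i<n. w i * (deriv f (z + y * v + t i) * v))" by auto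
  have "(\<Sum>i<n. w i * (f (z + v + t i) - f (z + t i))) = F 1 - F 0"
    by (simp add: F_def right_diff_distrib sum_subtractf)
  also have "\<dots> = v * (\<Sum>i<n. w i * deriv f ((z + y * v) + t i))"
    unfolding y(3) sum_distrib_left by (rule sum.cong[OF refl]) simp
  finally show ?thesis using y by (intro exI[of _ "z + y * v"]) (simp add: abs_mult mult_left_le_one_le)
qed

lemma block_increment:
  assumes est: "\<And>\<xi>. \<bar>\<xi> - z\<bar> \<le> \<bar>v\<bar> \<Longrightarrow> \<bar>(\<Sum>i<n. deriv f (\<xi> + real i * \<alpha>)) - c * G\<bar> \<le> \<zeta> * G
       \<and> (\<Sum>i<n. \<bar>deriv f (\<xi> + real i * \<alpha>)\<bar>) \<le> c' * G"
    and far: "\<And>\<xi> i. i < n \<Longrightarrow> \<bar>\<xi> - z\<bar> \<le> \<bar>v\<bar> \<Longrightarrow> frac (\<xi> + real i * \<alpha>) \<notin> a ` {1..k}"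
  shows "\<bar>(\<Sum>i<n. f (z + v + real i * \<alpha>) - f (z + real i * \<alpha>)) - v * (c * G)\<bar> \<le> \<zeta> * (G * \<bar>v\<bar>)"
    and "(\<Sum>i<n. \<bar>f (z + v + real i * \<alpha>) - f (z + real i * \<alpha>)\<bar>) \<le> c' * (G * \<bar>v\<bar>)"
proof -
  obtain \<xi> where \<xi>: "\<bar>\<xi> - z\<bar> \<le> \<bar>v\<bar>"
    "(\<Sum>i<n. 1 * (f (z + v + real i * \<alpha>) - f (z + real i * \<alpha>))) = v * (\<Sum>i<n. 1 * deriv f (\<xi> + real i * \<alpha>))"
    using weighted_mvt[of n z v "\<lambda>i. real i * \<alpha>" "\<lambda>_. 1"] far by blast
  define X where "X = (\<Sum>i<n. deriv f (\<xi> + real i * \<alpha>))"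
  have e: "(\<Sum>i<n. f (z + v + real i * \<alpha>) - f (z + real i * \<alpha>)) = v * X" using \<xi>(2) by (simp add: X_def)
  have "\<bar>v * X - v * (c * G)\<bar> = \<bar>v\<bar> * \<bar>X - c * G\<bar>" by (simp add: right_diff_distrib flip: abs_mult)
  also have "\<dots> \<le> \<bar>v\<bar> * (\<zeta> * G)" using est[OF \<xi>(1)] by (intro mult_left_mono) (auto simp: X_def)
  finally have "\<bar>v * X - v * (c * G)\<bar> \<le> \<zeta> * (G * \<bar>v\<bar>)" by (simp add: mult_ac)
  then show "\<bar>(\<Sum>i<n. f (z + v + real i * \<alpha>) - f (z + real i * \<alpha>)) - v * (c * G)\<bar> \<le> \<zeta> * (G * \<bar>v\<bar>)"
    unfolding e .
  define w where "w i = sgn (f (z + v + real i * \<alpha>) - f (z + real i * \<alpha>))" for i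
  obtain \<xi> where \<xi>: "\<bar>\<xi> - z\<bar> \<le> \<bar>v\<bar>"
    "(\<Sum>i<n. w i * (f (z + v + real i * \<alpha>) - f (z + real i * \<alpha>))) = v * (\<Sum>i<n. w i * deriv f (\<xi> + real i * \<alpha>))"
    using weighted_mvt[of n z v "\<lambda>i. real i * \<alpha>" w] far by blast
  have w: "\<bar>w i\<bar> \<le> 1" for i by (simp add: w_def abs_sgn_eq)
  have "(\<Sum>i<n. \<bar>f (z + v + real i * \<alpha>) - f (z + real i * \<alpha>)\<bar>) = v * (\<Sum>i<n. w i * deriv f (\<xi> + real i * \<alpha>))"
    unfolding \<xi>(2)[symmetric] by (rule sum.cong[OF refl]) (simp add: w_def abs_sgn mult.commute)
  also have "\<dots> \<le> \<bar>v\<bar> * \<bar>\<Sum>i<n. w i * deriv f (\<xi> + real i * \<alpha>)\<bar>"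
    unfolding abs_mult[symmetric] by (rule abs_ge_self)
  also have "\<dots> \<le> \<bar>v\<bar> * (\<Sum>i<n. \<bar>deriv f (\<xi> + real i * \<alpha>)\<bar>)"
  proof (rule mult_left_mono[OF order_trans[OF sum_abs sum_mono]])
    fix i
    show "\<bar>w i * deriv f (\<xi> + real i * \<alpha>)\<bar> \<le> \<bar>deriv f (\<xi> + real i * \<alpha>)\<bar>"
      unfolding abs_mult using mult_right_mono[OF w[of i] abs_ge_zero] by simp
  qed simp
  also have "\<dots> \<le> \<bar>v\<bar> * (c' * G)" using est[OF \<xi>(1)] by (intro mult_left_mono) auto
  finally show "(\<Sum>i<n. \<bar>f (z + v + real i * \<alpha>) - f (z + real i * \<alpha>)\<bar>) \<le> c' * (G * \<bar>v\<bar>)" by (simp add: mult_ac)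
qed

end


lemma nat_floor_bounds:
  assumes "1 \<le> (y::real)"
  shows "1 \<le> nat \<lfloor>y\<rfloor>" "real (nat \<lfloor>y\<rfloor>) \<le> y" "y / 2 \<le> real (nat \<lfloor>y\<rfloor>)"
proof -
  have "1 \<le> \<lfloor>y\<rfloor>" using assms by simp
  then have "real (nat \<lfloor>y\<rfloor>) = of_int \<lfloor>y\<rfloor>" "1 \<le> nat \<lfloor>y\<rfloor>" "(1::real) \<le> of_int \<lfloor>y\<rfloor>"
    by linarith+
  then show "1 \<le> nat \<lfloor>y\<rfloor>" "real (nat \<lfloor>y\<rfloor>) \<le> y" "y / 2 \<le> real (nat \<lfloor>y\<rfloor>)" by linarith+
qed

lemma sum_block: "(\<Sum>n\<in>{j * Q..<(j + 1) * Q}. e n) = (\<Sum>i<Q. e (j * Q + i :: nat))" for e :: "nat \<Rightarrow> real"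
  by (rule sum.reindex_bij_witness[of _ "\<lambda>i. j * Q + i" "\<lambda>n. n - j * Q"]) auto

lemma sum_block_reversed:
  "(\<Sum>n\<in>{j * Q..<(j + 1) * Q}. e n) = (\<Sum>i<Q. e ((j + 1) * Q - 1 - i :: nat))" for e :: "nat \<Rightarrow> real"
  by (rule sum.reindex_bij_witness[of _ "\<lambda>i. (j + 1) * Q - 1 - i" "\<lambda>n. (j + 1) * Q - 1 - n"]) auto

context singular_rotation
begin

subsection \<open>The drift\<close>

lemma drift:
  obtains p1 p2 :: real where "0 < p1"
    and "\<And>\<epsilon>. 0 < \<epsilon> \<Longrightarrow> \<exists>\<kappa>>0. \<forall>N::nat. \<exists>s00. \<forall>s0\<ge>s00. \<exists>\<delta>>0. \<forall>z v. v \<noteq> 0 \<longrightarrow> \<bar>v\<bar> < \<delta> \<longrightarrow> (\<forall>s\<ge>s0. z \<notin> close s) \<longrightarrow>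
      (\<exists>(M::nat) (L::nat) p. N < M \<and> N < L \<and> \<kappa> * real M \<le> real L \<and> p1 \<le> \<bar>p\<bar> \<and> \<bar>p\<bar> \<le> p2 \<and>
        ((\<forall>n\<in>{M..M+L}. \<bar>(\<Sum>i<n. f (z + real i * \<alpha>) - f (z + v + real i * \<alpha>)) - p\<bar> < \<epsilon>) \<or>
         (\<forall>n\<in>{M..M+L}. \<bar>(\<Sum>i<n. f (z + v - real (Suc i) * \<alpha>) - f (z - real (Suc i) * \<alpha>)) - p\<bar> < \<epsilon>)))"
proof -
  define c where "c = 1 / (8 * C)"
  have c: "0 < c" using C_gt by (simp add: c_def)
  have ac0: "0 < \<bar>c0\<bar>" using c0_nz by simp
  obtain J0 :: nat where J0: "4 * C1 / \<bar>c0\<bar> \<le> real J0" using real_arch_simple by blast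
  define J where "J = max 1 J0"
  have "4 * C1 / \<bar>c0\<bar> \<le> real J" using J0 by (simp add: J_def)
  then have J: "1 \<le> J" "C1 \<le> \<bar>c0\<bar> * real J / 4" using ac0 by (auto simp: J_def pos_divide_le_eq field_simps)
  define b where "b = (real J + 1) / c"
  have b: "1 \<le> b"
  proof -
    have "c \<le> 1" using C_gt by (simp add: c_def)
    then show ?thesis using c by (simp add: b_def pos_le_divide_eq)
  qed
  obtain u W where u: "0 < u" "1 \<le> W"
    and scale: "\<And>s0. \<exists>\<delta>>0. \<forall>\<Delta>. 0 < \<Delta> \<longrightarrow> \<Delta> < \<delta> \<longrightarrow> (\<exists>r s. s0 \<le> r \<and> r \<le> s \<and> real (q s) \<le> W * real (q r)
        \<and> real (q s) * H s * \<Delta> \<le> 1 \<and> u \<le> real (q (Suc s)) * H s * \<Delta> \<and> b * real (q r) \<le> real (q (Suc s)))"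
    using scale_selection[OF b] by blast
  define g1 where "g1 = min (c * u / (2 * (real J + 1))) (1 / 2)"
  define p1 where "p1 = \<bar>c0\<bar> * real J / 4 * g1"
  define p2 where "p2 = C1 * (real J + 1)"
  have g1: "0 < g1" using c u by (simp add: g1_def)
  have p1: "0 < p1" using g1 J ac0 by (simp add: p1_def)
  have main: "\<exists>\<kappa>>0. \<forall>N::nat. \<exists>s00. \<forall>s0\<ge>s00. \<exists>\<delta>>0. \<forall>z v. v \<noteq> 0 \<longrightarrow> \<bar>v\<bar> < \<delta> \<longrightarrow> (\<forall>s\<ge>s0. z \<notin> close s) \<longrightarrow>
      (\<exists>(M::nat) (L::nat) p. N < M \<and> N < L \<and> \<kappa> * real M \<le> real L \<and> p1 \<le> \<bar>p\<bar> \<and> \<bar>p\<bar> \<le> p2 \<and>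
        ((\<forall>n\<in>{M..M+L}. \<bar>(\<Sum>i<n. f (z + real i * \<alpha>) - f (z + v + real i * \<alpha>)) - p\<bar> < \<epsilon>) \<or>
         (\<forall>n\<in>{M..M+L}. \<bar>(\<Sum>i<n. f (z + v - real (Suc i) * \<alpha>) - f (z - real (Suc i) * \<alpha>)) - p\<bar> < \<epsilon>)))"
    if \<epsilon>: "0 < \<epsilon>" for \<epsilon>
  proof -
    obtain W0 :: nat where "C1 / \<epsilon> < real W0" using reals_Archimedean2 by blast
    define W' where "W' = max 1 W0"
    have W'1: "1 \<le> W'" and "C1 / \<epsilon> < real W'" using \<open>C1 / \<epsilon> < real W0\<close> by (auto simp: W'_def)
    then have W'2: "C1 / real W' < \<epsilon>" using \<epsilon> by (simp add: pos_divide_less_eq mult.commute)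
    define \<kappa> where "\<kappa> = 1 / (2 * real W' * (real J + 1))"
    have \<kappa>: "0 < \<kappa>" using W'1 by (simp add: \<kappa>_def)
    have "\<exists>s00. \<forall>s0\<ge>s00. \<exists>\<delta>>0. \<forall>z v. v \<noteq> 0 \<longrightarrow> \<bar>v\<bar> < \<delta> \<longrightarrow> (\<forall>s\<ge>s0. z \<notin> close s) \<longrightarrow>
      (\<exists>(M::nat) (L::nat) p. N < M \<and> N < L \<and> \<kappa> * real M \<le> real L \<and> p1 \<le> \<bar>p\<bar> \<and> \<bar>p\<bar> \<le> p2 \<and>
        ((\<forall>n\<in>{M..M+L}. \<bar>(\<Sum>i<n. f (z + real i * \<alpha>) - f (z + v + real i * \<alpha>)) - p\<bar> < \<epsilon>) \<or>
         (\<forall>n\<in>{M..M+L}. \<bar>(\<Sum>i<n. f (z + v - real (Suc i) * \<alpha>) - f (z - real (Suc i) * \<alpha>)) - p\<bar> < \<epsilon>)))"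
      for N :: nat
    proof -
      have \<zeta>: "0 < \<bar>c0\<bar> / 2" using ac0 by simp
      have ev3: "\<forall>\<^sub>F s in sequentially. 4 * C \<le> x s * real (q s) * H s"
        using cond1' unfolding filterlim_at_top H_def by blast
      have ev4: "\<forall>\<^sub>F s in sequentially. 2 * real W' * (real N + 1) \<le> real (q s)"
        using filterlim_q unfolding filterlim_at_top by blast
      obtain s1 where s1: "\<And>s. s1 \<le> s \<Longrightarrow> \<forall>r\<le>s. real (q s) \<le> W * real (q r) \<longrightarrow>
         (\<forall>z. (\<forall>i<q r. \<forall>j\<in>{1..k}. x s / (4 * C) \<le> int_dist (z + real i * \<alpha> - a j)) \<longrightarrow>
           \<bar>(\<Sum>i<q r. deriv f (z + real i * \<alpha>)) - c0 * (real (q r) * H s)\<bar> \<le> \<bar>c0\<bar> / 2 * (real (q r) * H s)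
           \<and> (\<Sum>i<q r. \<bar>deriv f (z + real i * \<alpha>)\<bar>) \<le> C1 * (real (q r) * H s))"
        using block_estimate[OF \<zeta> u(2)] unfolding eventually_sequentially by blast
      obtain s2 where s2: "\<And>s. s2 \<le> s \<Longrightarrow> \<forall>z. z \<notin> close s \<longrightarrow>
         (\<forall>n. real n \<le> 1 / (8 * C) * real (q (Suc s)) \<longrightarrow> far (z + real n * \<alpha>) (x s / (2 * C))) \<or>
         (\<forall>n. 1 \<le> n \<longrightarrow> real n \<le> 1 / (8 * C) * real (q (Suc s)) \<longrightarrow> far (z - real n * \<alpha>) (x s / (2 * C)))"
        using one_sided_avoidance unfolding eventually_sequentially by blast
      obtain s3 where s3: "\<And>s. s3 \<le> s \<Longrightarrow> 4 * C \<le> x s * real (q s) * H s"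
        using ev3 unfolding eventually_sequentially by blast
      obtain s4 where s4: "\<And>s. s4 \<le> s \<Longrightarrow> 2 * real W' * (real N + 1) \<le> real (q s)"
        using ev4 unfolding eventually_sequentially by blast
      define s00 where "s00 = max (max s1 s2) (max s3 s4)"
      have "\<exists>\<delta>>0. \<forall>z v. v \<noteq> 0 \<longrightarrow> \<bar>v\<bar> < \<delta> \<longrightarrow> (\<forall>s\<ge>s0. z \<notin> close s) \<longrightarrow>
        (\<exists>(M::nat) (L::nat) p. N < M \<and> N < L \<and> \<kappa> * real M \<le> real L \<and> p1 \<le> \<bar>p\<bar> \<and> \<bar>p\<bar> \<le> p2 \<and>
          ((\<forall>n\<in>{M..M+L}. \<bar>(\<Sum>i<n. f (z + real i * \<alpha>) - f (z + v + real i * \<alpha>)) - p\<bar> < \<epsilon>) \<or>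
           (\<forall>n\<in>{M..M+L}. \<bar>(\<Sum>i<n. f (z + v - real (Suc i) * \<alpha>) - f (z - real (Suc i) * \<alpha>)) - p\<bar> < \<epsilon>)))"
        if s0: "s00 \<le> s0" for s0
      proof -
        obtain \<delta> where \<delta>: "0 < \<delta>" "\<And>\<Delta>. 0 < \<Delta> \<Longrightarrow> \<Delta> < \<delta> \<Longrightarrow> \<exists>r s. s0 \<le> r \<and> r \<le> s \<and> real (q s) \<le> W * real (q r)
          \<and> real (q s) * H s * \<Delta> \<le> 1 \<and> u \<le> real (q (Suc s)) * H s * \<Delta> \<and> b * real (q r) \<le> real (q (Suc s))"
          using scale[of s0] by blast
        have "\<exists>(M::nat) (L::nat) p. N < M \<and> N < L \<and> \<kappa> * real M \<le> real L \<and> p1 \<le> \<bar>p\<bar> \<and> \<bar>p\<bar> \<le> p2 \<and>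
          ((\<forall>n\<in>{M..M+L}. \<bar>(\<Sum>i<n. f (z + real i * \<alpha>) - f (z + v + real i * \<alpha>)) - p\<bar> < \<epsilon>) \<or>
           (\<forall>n\<in>{M..M+L}. \<bar>(\<Sum>i<n. f (z + v - real (Suc i) * \<alpha>) - f (z - real (Suc i) * \<alpha>)) - p\<bar> < \<epsilon>))"
          if v: "v \<noteq> 0" "\<bar>v\<bar> < \<delta>" and zc: "\<forall>s\<ge>s0. z \<notin> close s" for z v
        proof -
          have v0: "0 < \<bar>v\<bar>" using v by simp
          obtain r s where rs: "s0 \<le> r" "r \<le> s" "real (q s) \<le> W * real (q r)"
            "real (q s) * H s * \<bar>v\<bar> \<le> 1" "u \<le> real (q (Suc s)) * H s * \<bar>v\<bar>" "b * real (q r) \<le> real (q (Suc s))"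
            using \<delta>(2)[OF v0 v(2)] by blast
          define Q where "Q = q r"
          define G where "G = real Q * H s"
          define g where "g = G * \<bar>v\<bar>"
          have Q1: "1 \<le> Q" using q_pos[of r] by (simp add: Q_def)
          have G0: "0 < G" using Q1 H_pos[of s] by (simp add: G_def)
          have g0: "0 < g" using G0 v0 by (simp add: g_def)
          have "g \<le> real (q s) * H s * \<bar>v\<bar>" unfolding g_def G_def Q_def
            using q_mono[OF rs(2)] H_pos[of s] by (intro mult_right_mono) auto
          then have gle: "g \<le> 1" using rs(4) by simp
          have big: "s00 \<le> s" "s00 \<le> r" using rs s0 by auto
          have QN: "2 * real W' * (real N + 1) \<le> real Q" unfolding Q_def using big by (intro s4) (simp add: s00_def)
          have vx: "\<bar>v\<bar> \<le> x s / (4 * C)"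
          proof -
            have "4 * C \<le> x s * real (q s) * H s" using big by (intro s3) (simp add: s00_def)
            then have "4 * C * \<bar>v\<bar> \<le> x s * real (q s) * H s * \<bar>v\<bar>" by (rule mult_right_mono) simp
            also have "\<dots> = x s * (real (q s) * H s * \<bar>v\<bar>)" by simp
            also have "\<dots> \<le> x s * 1" using rs(4) x_pos[of s] by (intro mult_left_mono) auto
            finally show ?thesis using C_gt by (simp add: pos_le_divide_eq mult.commute)
          qed
          define y1 where "y1 = c * real (q (Suc s)) / ((real J + 1) * real Q)"
          have y1: "1 \<le> y1" "y1 * ((real J + 1) * real Q) = c * real (q (Suc s))"
          proof -
            have den: "0 < (real J + 1) * real Q" using Q1 by (intro mult_pos_pos) auto
            have "(real J + 1) * real Q = c * (b * real Q)" using c by (simp add: b_def)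
            also have "\<dots> \<le> c * real (q (Suc s))" using rs(6) c by (intro mult_left_mono) (auto simp: Q_def)
            finally show "1 \<le> y1" using den by (simp add: y1_def)
            show "y1 * ((real J + 1) * real Q) = c * real (q (Suc s))" using den unfolding y1_def
              by (metis less_irrefl nonzero_eq_divide_eq)
          qed
          have y2: "1 \<le> 1 / g" using g0 gle by simp
          define i where "i = min (nat \<lfloor>y1\<rfloor>) (nat \<lfloor>1 / g\<rfloor>)"
          have i1: "1 \<le> i" using nat_floor_bounds(1)[OF y1(1)] nat_floor_bounds(1)[OF y2] by (simp add: i_def)
          have ig1: "real i * g \<le> 1"
          proof -
            have "real i \<le> 1 / g" using nat_floor_bounds(2)[OF y2] by (simp add: i_def)
            then show ?thesis using g0 by (simp add: pos_le_divide_eq)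
          qed
          have itime: "real ((J + 1) * i * Q) \<le> c * real (q (Suc s))"
          proof -
            have "real i \<le> y1" using nat_floor_bounds(2)[OF y1(1)] by (simp add: i_def)
            then have "real i * ((real J + 1) * real Q) \<le> y1 * ((real J + 1) * real Q)"
              by (intro mult_right_mono) auto
            moreover have "real i * ((real J + 1) * real Q) = real ((J + 1) * i * Q)"
              unfolding of_nat_mult of_nat_add of_nat_1 by (simp only: mult_ac)
            ultimately show ?thesis unfolding y1(2) by (simp only:)
          qed
          have ig2: "g1 \<le> real i * g"
          proof (cases "nat \<lfloor>y1\<rfloor> \<le> nat \<lfloor>1 / g\<rfloor>")
            case True
            then have "y1 / 2 \<le> real i" using nat_floor_bounds(3)[OF y1(1)] by (simp add: i_def)
            then have *: "y1 / 2 * g \<le> real i * g" using g0 by (intro mult_right_mono) auto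
            have "y1 * g = c * (real (q (Suc s)) * H s * \<bar>v\<bar>) / (real J + 1)"
              using Q1 by (simp add: y1_def g_def G_def)
            also have "\<dots> \<ge> c * u / (real J + 1)" using rs(5) c by (intro divide_right_mono mult_left_mono) auto
            finally have fin: "c * u / (real J + 1) \<le> y1 * g" .
            have e1: "c * u / (2 * (real J + 1)) = c * u / (real J + 1) / 2"
              unfolding divide_divide_eq_left by (simp only: mult.commute)
            have e2: "y1 / 2 * g = y1 * g / 2" by simp
            have "c * u / (2 * (real J + 1)) \<le> y1 / 2 * g"
              unfolding e1 e2 by (rule divide_right_mono[OF fin]) simp
            moreover have "g1 \<le> c * u / (2 * (real J + 1))" unfolding g1_def by (rule min.cobounded1)
            ultimately show ?thesis using * by (meson order_trans)
          next
            case False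
            then have "1 / g / 2 \<le> real i" using nat_floor_bounds(3)[OF y2] by (simp add: i_def)
            then have "1 / g / 2 * g \<le> real i * g" using g0 by (intro mult_right_mono) auto
            then show ?thesis using g0 by (simp add: g1_def)
          qed
          have Wi: "2 * W' \<le> i * Q"
          proof -
            have "2 * real W' * 1 \<le> 2 * real W' * (real N + 1)" by (intro mult_left_mono) auto
            then have "2 * real W' \<le> real Q" using QN by simp
            then have "2 * W' \<le> Q" by linarith
            also have "Q \<le> i * Q" using i1 by simp
            finally show ?thesis .
          qed
          have block: "\<bar>(\<Sum>l<Q. f (y + v + real l * \<alpha>) - f (y + real l * \<alpha>)) - v * (c0 * G)\<bar> \<le> \<bar>c0\<bar> / 2 * g"
            "(\<Sum>l<Q. \<bar>f (y + v + real l * \<alpha>) - f (y + real l * \<alpha>)\<bar>) \<le> C1 * g"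
            if fy: "\<And>l. l < Q \<Longrightarrow> far (y + real l * \<alpha>) (x s / (2 * C))" for y
          proof -
            have near: "x s / (4 * C) \<le> int_dist (\<xi> + real l * \<alpha> - a j)"
              if "l < Q" "\<bar>\<xi> - y\<bar> \<le> \<bar>v\<bar>" "j \<in> {1..k}" for \<xi> l j
            proof -
              have 1: "x s / (2 * C) \<le> int_dist (y + real l * \<alpha> - a j)" using fy[OF that(1)] that(3) by (auto simp: far_def)
              have 2: "x s / (2 * C) = x s / (4 * C) + x s / (4 * C)" by simp
              have 3: "\<bar>int_dist (y + real l * \<alpha> - a j) - int_dist (\<xi> + real l * \<alpha> - a j)\<bar> \<le> \<bar>y - \<xi>\<bar>"
                using int_dist_lipschitz[of "y + real l * \<alpha> - a j" "\<xi> + real l * \<alpha> - a j"] by simp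
              show ?thesis using 1 2 3 that(2) vx by linarith
            qed
            have est: "\<bar>(\<Sum>l<Q. deriv f (\<xi> + real l * \<alpha>)) - c0 * G\<bar> \<le> \<bar>c0\<bar> / 2 * G
               \<and> (\<Sum>l<Q. \<bar>deriv f (\<xi> + real l * \<alpha>)\<bar>) \<le> C1 * G" if "\<bar>\<xi> - y\<bar> \<le> \<bar>v\<bar>" for \<xi>
              unfolding G_def Q_def
              by (rule s1[rule_format]) (use big rs near that in \<open>auto simp: s00_def Q_def\<close>)
            have ns: "frac (\<xi> + real l * \<alpha>) \<notin> a ` {1..k}" if "l < Q" "\<bar>\<xi> - y\<bar> \<le> \<bar>v\<bar>" for \<xi> l
              using near[OF that] singular_iff[of "\<xi> + real l * \<alpha>"] x4C(1)[of s] by (metis not_le)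
            show "\<bar>(\<Sum>l<Q. f (y + v + real l * \<alpha>) - f (y + real l * \<alpha>)) - v * (c0 * G)\<bar> \<le> \<bar>c0\<bar> / 2 * g"
              "(\<Sum>l<Q. \<bar>f (y + v + real l * \<alpha>) - f (y + real l * \<alpha>)\<bar>) \<le> C1 * g"
              unfolding g_def by (rule block_increment[OF est ns]; assumption)+
          qed
          have vg: "v * (c0 * G) = sgn v * c0 * g" 
            using v(1) unfolding g_def by (cases "0 < v") (simp_all add: sgn_if)
          have window: "\<exists>(M::nat) (L::nat) p. N < M \<and> N < L \<and> \<kappa> * real M \<le> real L \<and> p1 \<le> \<bar>p\<bar> \<and> \<bar>p\<bar> \<le> p2 \<and>
             (\<forall>n\<in>{M..M+L}. \<bar>(\<Sum>i<n. e i) - p\<bar> < \<epsilon>)"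
            if cc: "\<bar>cc\<bar> = \<bar>c0\<bar>"
              and bs: "\<And>j. j < (J + 1) * i \<Longrightarrow> \<bar>(\<Sum>n\<in>{j * Q..<(j + 1) * Q}. e n) - cc * g\<bar> \<le> \<bar>c0\<bar> / 2 * g"
              and ba: "\<And>j. j < (J + 1) * i \<Longrightarrow> (\<Sum>n\<in>{j * Q..<(j + 1) * Q}. \<bar>e n\<bar>) \<le> C1 * g"
            for cc and e :: "nat \<Rightarrow> real"
          proof -
            obtain M L :: nat where MLw: "Q \<le> M" "real (i * Q) / (2 * real W') \<le> real L" "M \<le> (J + 1) * i * Q"
              "\<bar>cc\<bar> * real J / 4 * g1 \<le> \<bar>\<Sum>n<M. e n\<bar>" "\<bar>\<Sum>n<M. e n\<bar> \<le> C1 * (real J + 1)"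
              "\<forall>n\<in>{M..M+L}. \<bar>(\<Sum>n<n. e n) - (\<Sum>n<M. e n)\<bar> < \<epsilon>"
              using drift_window[of Q J C1 cc i g e g1 W' \<epsilon>] Q1 J i1 g0 bs ba ig1 ig2 W'1 W'2 Wi
              unfolding cc by blast
            have W0: "0 < 2 * real W'" using W'1 by simp
            have QL: "real N + 1 \<le> real Q / (2 * real W')"
              using QN W0 by (simp add: pos_le_divide_eq mult.commute)
            have "N < M"
            proof -
              have "1 * (real N + 1) \<le> 2 * real W' * (real N + 1)" using W'1 by (intro mult_right_mono) auto
              also have "\<dots> \<le> real Q" by (rule QN)
              also have "real Q \<le> real M" using MLw(1) by simp
              finally have "real N + 1 \<le> real M" by simp
              then show ?thesis by linarith
            qed
            moreover have "N < L"
            proof -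
              have "real Q / (2 * real W') \<le> real (i * Q) / (2 * real W')"
              proof (rule divide_right_mono)
                have "Q \<le> i * Q" using i1 by simp
                then show "real Q \<le> real (i * Q)" by (simp only: of_nat_le_iff)
              qed simp
              then have "real N + 1 \<le> real L" using QL MLw(2) by linarith
              then show ?thesis by linarith
            qed
            moreover have "\<kappa> * real M \<le> real L"
            proof -
              have "\<kappa> * real M \<le> \<kappa> * real ((J + 1) * i * Q)" using MLw(3) \<kappa> by (intro mult_left_mono) (auto simp del: of_nat_mult)
              also have "\<dots> = real (i * Q) / (2 * real W')"
              proof -
                have e: "real ((J + 1) * i * Q) = (real J + 1) * real (i * Q)"
                  unfolding of_nat_mult of_nat_add of_nat_1 by (simp only: mult_ac)
                have gen: "1 / (w * d) * (d * y) = y / w" if "d \<noteq> 0" for w d y :: real using that by simp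
                have "real J + 1 \<noteq> 0" by linarith
                then show ?thesis unfolding \<kappa>_def e by (rule gen)
              qed
              finally show ?thesis using MLw(2) by simp
            qed
            ultimately show ?thesis
              using MLw(4,5,6) by (intro exI[of _ M] exI[of _ L] exI[of _ "\<Sum>n<M. e n"]) (simp add: p1_def p2_def cc)
          qed
          have sg: "\<bar>sgn v * c0\<bar> = \<bar>c0\<bar>" "\<bar>- (sgn v * c0)\<bar> = \<bar>c0\<bar>" using v by (simp_all add: abs_mult abs_sgn_eq)
          have jQ: "j * Q + l < (J + 1) * i * Q" "(j + 1) * Q \<le> (J + 1) * i * Q" if "j < (J + 1) * i" "l < Q" for j l
          proof -
            have "(j + 1) * Q \<le> ((J + 1) * i) * Q" using that by (intro mult_right_mono) auto
            then show "(j + 1) * Q \<le> (J + 1) * i * Q" .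
            then show "j * Q + l < (J + 1) * i * Q" using that(2) by simp
          qed
          have "z \<notin> close s" using zc rs by auto
          then have "(\<forall>n. real n \<le> c * real (q (Suc s)) \<longrightarrow> far (z + real n * \<alpha>) (x s / (2 * C))) \<or>
             (\<forall>n. 1 \<le> n \<longrightarrow> real n \<le> c * real (q (Suc s)) \<longrightarrow> far (z - real n * \<alpha>) (x s / (2 * C)))"
            using s2[of s] big unfolding c_def by (simp add: s00_def)
          then show ?thesis
          proof
            assume fw: "\<forall>n. real n \<le> c * real (q (Suc s)) \<longrightarrow> far (z + real n * \<alpha>) (x s / (2 * C))"
            define e where "e n = f (z + real n * \<alpha>) - f (z + v + real n * \<alpha>)" for n :: nat
            have blk: "\<bar>(\<Sum>n\<in>{j * Q..<(j + 1) * Q}. e n) - (- (sgn v * c0)) * g\<bar> \<le> \<bar>c0\<bar> / 2 * g"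
              "(\<Sum>n\<in>{j * Q..<(j + 1) * Q}. \<bar>e n\<bar>) \<le> C1 * g" if j: "j < (J + 1) * i" for j
            proof -
              define y where "y = z + real (j * Q) * \<alpha>"
              have el: "e (j * Q + l) = - (f (y + v + real l * \<alpha>) - f (y + real l * \<alpha>))" for l
                by (simp add: e_def y_def algebra_simps)
              have fy: "far (y + real l * \<alpha>) (x s / (2 * C))" if "l < Q" for l
              proof -
                have "real (j * Q + l) \<le> c * real (q (Suc s))"
                  using jQ(1)[OF j that] itime by (meson less_imp_le of_nat_le_iff order_trans)
                then have "far (z + real (j * Q + l) * \<alpha>) (x s / (2 * C))" using fw by blast
                then show ?thesis by (simp add: y_def algebra_simps)
              qed
              have neg: "\<bar>(\<Sum>l<Q. - t l) - (- w) * g\<bar> = \<bar>(\<Sum>l<Q. t l) - w * g\<bar>" for t :: "nat \<Rightarrow> real" and w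
                by (simp add: sum_negf)
              show "\<bar>(\<Sum>n\<in>{j * Q..<(j + 1) * Q}. e n) - (- (sgn v * c0)) * g\<bar> \<le> \<bar>c0\<bar> / 2 * g"
                unfolding sum_block el neg using block(1)[OF fy] unfolding vg .
              show "(\<Sum>n\<in>{j * Q..<(j + 1) * Q}. \<bar>e n\<bar>) \<le> C1 * g"
                unfolding sum_block el abs_minus_cancel by (rule block(2)[OF fy])
            qed
            show ?thesis using window[OF sg(2) blk] unfolding e_def by blast
          next
            assume bw: "\<forall>n. 1 \<le> n \<longrightarrow> real n \<le> c * real (q (Suc s)) \<longrightarrow> far (z - real n * \<alpha>) (x s / (2 * C))"
            define e where "e n = f (z + v - real (Suc n) * \<alpha>) - f (z - real (Suc n) * \<alpha>)" for n :: nat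
            have blk: "\<bar>(\<Sum>n\<in>{j * Q..<(j + 1) * Q}. e n) - (sgn v * c0) * g\<bar> \<le> \<bar>c0\<bar> / 2 * g"
              "(\<Sum>n\<in>{j * Q..<(j + 1) * Q}. \<bar>e n\<bar>) \<le> C1 * g" if j: "j < (J + 1) * i" for j
            proof -
              define y where "y = z - real ((j + 1) * Q) * \<alpha>"
              have suc: "real (Suc ((j + 1) * Q - 1 - l)) = real ((j + 1) * Q) - real l"
                "1 \<le> (j + 1) * Q - l" "real ((j + 1) * Q - l) = real ((j + 1) * Q) - real l" if "l < Q" for l
              proof -
                have "l < (j + 1) * Q" using that by simp
                then show "real (Suc ((j + 1) * Q - 1 - l)) = real ((j + 1) * Q) - real l"
                "1 \<le> (j + 1) * Q - l" "real ((j + 1) * Q - l) = real ((j + 1) * Q) - real l" by linarith+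
              qed
              have el: "e ((j + 1) * Q - 1 - l) = f (y + v + real l * \<alpha>) - f (y + real l * \<alpha>)" if "l < Q" for l
                unfolding e_def suc(1)[OF that] by (simp add: y_def algebra_simps)
              have fy: "far (y + real l * \<alpha>) (x s / (2 * C))" if "l < Q" for l
              proof -
                have "(j + 1) * Q - l \<le> (J + 1) * i * Q" using jQ(2)[OF j that] by linarith
                then have "real ((j + 1) * Q - l) \<le> c * real (q (Suc s))"
                  using itime by (meson of_nat_le_iff order_trans)
                then have "far (z - real ((j + 1) * Q - l) * \<alpha>) (x s / (2 * C))" using bw suc(2)[OF that] by blast
                then show ?thesis unfolding suc(3)[OF that] by (simp add: y_def algebra_simps)
              qed
              have S1: "(\<Sum>n\<in>{j * Q..<(j + 1) * Q}. e n) = (\<Sum>l<Q. f (y + v + real l * \<alpha>) - f (y + real l * \<alpha>))"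
                unfolding sum_block_reversed by (rule sum.cong[OF refl]) (rule el, simp)
              have S2: "(\<Sum>n\<in>{j * Q..<(j + 1) * Q}. \<bar>e n\<bar>) = (\<Sum>l<Q. \<bar>f (y + v + real l * \<alpha>) - f (y + real l * \<alpha>)\<bar>)"
                unfolding sum_block_reversed by (rule sum.cong[OF refl]) (simp only: el lessThan_iff)
              show "\<bar>(\<Sum>n\<in>{j * Q..<(j + 1) * Q}. e n) - (sgn v * c0) * g\<bar> \<le> \<bar>c0\<bar> / 2 * g"
                unfolding S1 using block(1)[OF fy] unfolding vg .
              show "(\<Sum>n\<in>{j * Q..<(j + 1) * Q}. \<bar>e n\<bar>) \<le> C1 * g"
                unfolding S2 by (rule block(2)[OF fy])
            qed
            show ?thesis using window[OF sg(1) blk] unfolding e_def by blast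
          qed
        qed
        then show ?thesis using \<delta>(1) by blast
      qed
      then show ?thesis by blast
    qed
    then show ?thesis using \<kappa> by blast
  qed
  show thesis by (rule that[OF p1 main])
qed

end


subsection \<open>Discrete times in a window\<close>

lemma discretize:
  fixes t0 c2 c R \<kappa>1 lo hi :: real and N M L :: nat
  assumes t0: "0 < t0" and c2: "0 < c2" and R: "0 < R" and lo0: "0 \<le> lo"
    and lo: "lo \<le> 2 * R * real M" "c2 * real M - c \<le> lo" and hi: "c2 * real L - c \<le> hi - lo"
    and \<kappa>1: "0 \<le> \<kappa>1" "\<kappa>1 * real M \<le> real L"
    and big: "c + t0 * (real N + 1) \<le> c2 * real M" "2 * c + 6 * t0 \<le> c2 * real L"
      "2 * (t0 * (real N + 1)) \<le> c2 * real L" "t0 \<le> R * real M"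
  shows "\<exists>K L'. N < K \<and> N < L' \<and> c2 * \<kappa>1 / (6 * R) * real K \<le> real L'
     \<and> (\<forall>n\<in>{K..K+L'}. lo < real n * t0 \<and> real n * t0 < hi)"
proof -
  define K where "K = nat \<lfloor>lo / t0\<rfloor> + 1"
  define L' where "L' = nat \<lfloor>(hi - lo) / t0\<rfloor> - 2"
  have "real (nat \<lfloor>lo / t0\<rfloor>) = of_int \<lfloor>lo / t0\<rfloor>" using lo0 t0 by simp
  then have K: "lo / t0 < real K" "real K \<le> lo / t0 + 1" unfolding K_def of_nat_add by linarith+
  have "c2 * real L / 2 + 3 * t0 \<le> hi - lo"
  proof -
    have "P / 2 + 3 * t0 \<le> w" if "P - c \<le> w" "2 * c + 6 * t0 \<le> P" for P w :: real using that by linarith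
    from this[OF hi big(2)] show ?thesis .
  qed
  then have "(c2 * real L / 2 + 3 * t0) / t0 \<le> (hi - lo) / t0" using t0 by (intro divide_right_mono) auto
  moreover have "(c2 * real L / 2 + 3 * t0) / t0 = c2 * real L / (2 * t0) + 3" using t0 by (simp add: field_simps)
  ultimately have w: "c2 * real L / (2 * t0) + 3 \<le> (hi - lo) / t0" by simp
  have pos: "0 \<le> c2 * real L / (2 * t0)" using c2 t0 by simp
  have "2 \<le> nat \<lfloor>(hi - lo) / t0\<rfloor>" "real (nat \<lfloor>(hi - lo) / t0\<rfloor>) = of_int \<lfloor>(hi - lo) / t0\<rfloor>"
    using w pos by linarith+
  then have "real L' = of_int \<lfloor>(hi - lo) / t0\<rfloor> - 2" unfolding L'_def by (simp add: of_nat_diff)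
  then have L': "real L' \<le> (hi - lo) / t0 - 2" "(hi - lo) / t0 - 3 \<le> real L'" by linarith+
  have "real N + 1 \<le> lo / t0" using big(1) lo(2) t0 by (simp add: pos_le_divide_eq mult.commute)
  then have NK: "N < K" using K(1) by linarith
  have L1: "c2 * real L / (2 * t0) \<le> real L'" using w L'(2) by linarith
  have "real N + 1 \<le> c2 * real L / (2 * t0)" using big(3) t0 by (simp add: pos_le_divide_eq mult_ac)
  then have NL: "N < L'" using L1 by linarith
  have "real K \<le> 3 * R * real M / t0"
  proof -
    have "lo / t0 + 1 = (lo + t0) / t0" using t0 by (simp add: field_simps)
    also have "\<dots> \<le> 3 * R * real M / t0" using lo(1) big(4) t0 by (intro divide_right_mono) auto
    finally show ?thesis using K(2) by simp
  qed
  have \<kappa>: "c2 * \<kappa>1 / (6 * R) * real K \<le> real L'"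
  proof -
    have "c2 * \<kappa>1 / (6 * R) * real K \<le> c2 * \<kappa>1 / (6 * R) * (3 * R * real M / t0)"
      using \<open>real K \<le> 3 * R * real M / t0\<close> c2 R \<kappa>1(1) by (intro mult_left_mono) auto
    also have "\<dots> = c2 * (\<kappa>1 * real M) / (2 * t0)" using R by (simp add: field_simps)
    also have "\<dots> \<le> c2 * real L / (2 * t0)" using \<kappa>1 c2 t0 by (intro divide_right_mono mult_left_mono) auto
    finally show ?thesis using L1 by simp
  qed
  have "lo < real n * t0 \<and> real n * t0 < hi" if n: "n \<in> {K..K+L'}" for n
  proof
    have "lo < real K * t0" using K(1) t0 by (simp add: pos_divide_less_eq)
    also have "\<dots> \<le> real n * t0" using n t0 by (intro mult_right_mono) auto
    finally show "lo < real n * t0" .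
    have "real n \<le> real K + real L'" using n by (metis atLeastAtMost_iff of_nat_add of_nat_le_iff)
    also have "\<dots> < hi / t0" using K(2) L'(1) by (simp add: diff_divide_distrib)
    finally show "real n * t0 < hi" using t0 by (simp add: pos_less_divide_eq)
  qed
  then show ?thesis using NK NL \<kappa> by blast
qed

lemma int_dist_frac_diff: "int_dist (frac u - frac w) = int_dist (u - w)"
proof -
  have "frac u - frac w = (u - w) + of_int (\<lfloor>w\<rfloor> - \<lfloor>u\<rfloor>)" by (simp add: frac_def)
  then show ?thesis by (metis int_dist_add_int)
qed

lemma int_dist_measurable [measurable]: "int_dist \<in> borel_measurable borel"
  by (rule borel_measurable_continuous_onI) (rule continuous_on_int_dist)

lemma pmpt_rotation: "pmpt circle_measure (\<lambda>x. frac (x + \<beta>))"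
  by (intro pmpt.intro pmpt_axioms.intro prob_space_circle rotation_measurable rotation_preserves)

lemma funpow_rotation: "x \<in> circle \<Longrightarrow> ((\<lambda>x. frac (x + \<beta>)) ^^ n) x = frac (x + real n * \<beta>)"
  by (induction n) (simp_all add: frac_circle algebra_simps)

lemma measure_near_point:
  assumes "0 \<le> X"
  shows "{x \<in> circle. int_dist (x + \<beta>) < X} \<in> sets circle_measure
    \<and> measure circle_measure {x \<in> circle. int_dist (x + \<beta>) < X} \<le> 2 * X"
proof -
  interpret prob_space circle_measure by (rule prob_space_circle)
  define U where "U = {u \<in> circle. int_dist u < X}"
  have Ub: "U \<in> sets circle_measure"
  proof -
    have "{u. int_dist u < X} \<in> sets borel" by measurable
    then have "circle \<inter> {u. int_dist u < X} \<in> sets borel" by (intro sets.Int) auto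
    moreover have "U = circle \<inter> {u. int_dist u < X}" by (auto simp: U_def)
    ultimately show ?thesis by (auto simp: sets_circle_iff)
  qed
  have eq: "{x \<in> circle. int_dist (x + \<beta>) < X} = (\<lambda>x. frac (x + \<beta>)) -` U \<inter> space circle_measure"
    by (auto simp: U_def)
  have "measure circle_measure U \<le> 2 * X"
  proof -
    have "U \<subseteq> {0..X} \<union> {1 - X..1}"
    proof
      fix u assume "u \<in> U"
      then have u: "0 \<le> u" "u < 1" "int_dist u < X" by (auto simp: U_def circle_iff)
      from int_dist_cases[of u] show "u \<in> {0..X} \<union> {1 - X..1}"
      proof
        assume "int_dist u = frac u"
        then show ?thesis using u by (simp add: frac_eq[THEN iffD2])
      next
        assume "int_dist u = frac (- u)"
        moreover have "u \<in> \<int> \<or> frac (- u) = 1 - u" using u frac_neg[of u] frac_eq[of u] by auto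
        moreover have "u = 0" if "u \<in> \<int>" using that u by (metis frac_eq frac_eq_0_iff)
        ultimately show ?thesis using u \<open>0 \<le> X\<close> by auto
      qed
    qed
    then have "emeasure lborel U \<le> emeasure lborel ({0..X} \<union> {1 - X..1})"
      by (rule emeasure_mono) simp
    also have "\<dots> \<le> emeasure lborel {0..X} + emeasure lborel {1 - X..1}"
      by (rule emeasure_subadditive) auto
    also have "\<dots> = ennreal (2 * X)" using assms by (simp flip: ennreal_plus)
    finally have "emeasure circle_measure U \<le> ennreal (2 * X)" by (simp add: emeasure_circle U_def)
    then show ?thesis using assms by (simp add: emeasure_eq_measure)
  qed
  moreover have "measure circle_measure {x \<in> circle. int_dist (x + \<beta>) < X} = measure circle_measure U"
    unfolding eq using measure_distr[OF rotation_measurable, of U \<beta>] Ub by (simp add: rotation_preserves)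
  moreover have "{x \<in> circle. int_dist (x + \<beta>) < X} \<in> sets circle_measure"
    unfolding eq by (rule measurable_sets[OF rotation_measurable Ub])
  ultimately show ?thesis by simp
qed

context roof_flow
begin

lemma bsum_add_int [simp]: "bsum n (y + of_int m) = bsum n y"
  by (metis bsum_frac frac_add_of_int_right)

lemma bsum_forward: "bsum (int n) z = (\<Sum>i<n. f (z + real i * \<alpha>))"
proof (induction n)
  case (Suc n)
  then show ?case using bsum_Suc[of "int n" z] by (simp add: add.commute)
qed simp

lemma bsum_backward: "bsum (- int n) z = - (\<Sum>i<n. f (z - real (Suc i) * \<alpha>))"
proof (induction n)
  case (Suc n)
  have "- int (Suc n) = - int n - 1" by simp
  then show ?case using Suc bsum_Suc[of "- int n - 1" z] by (simp only:) (simp add: algebra_simps)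
qed simp

lemma flow_funpow: "z \<in> Xf \<Longrightarrow> (Fl t ^^ n) z = Fl (real n * t) z"
proof (induction n)
  case (Suc n)
  then show ?case using flow_add[of z t "real n * t"] by (simp add: algebra_simps)
qed (simp add: flow_0)

lemma pmpt_flow: "pmpt MF (Fl t)"
  by (intro pmpt.intro pmpt_axioms.intro prob_space_MF flow_t_measurable flow_preserves)

definition edge :: "real \<Rightarrow> (real \<times> real) set" where
  "edge \<eta> = {(x, v). (x, v) \<in> Xf \<and> (v < \<eta> \<or> f x - \<eta> \<le> v)}"

lemma edge_sets: "edge \<eta> \<in> sets MF"
proof -
  have "edge \<eta> \<in> sets (borel :: (real \<times> real) measure)"
    unfolding edge_def Xf_iff by (rule borel_pair_Collect) measurable
  then show ?thesis by (auto simp: sets_MF_iff edge_def)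
qed

lemma edge_mono: "\<eta> \<le> \<eta>' \<Longrightarrow> edge \<eta> \<subseteq> edge \<eta>'"
  by (auto simp: edge_def)

lemma edge_small:
  assumes "0 < \<epsilon>"
  shows "\<exists>\<eta>>0. measure MF (edge \<eta>) < \<epsilon>"
proof -
  interpret prob_space MF by (rule prob_space_MF)
  define E where "E n = edge (1 / real (Suc n))" for n
  have dec: "decseq E"
    unfolding decseq_def E_def by (intro allI impI edge_mono divide_left_mono) auto
  have int: "(\<Inter>n. E n) = {(x, v). (x, v) \<in> Xf \<and> v = 0}"
  proof (intro set_eqI iffI)
    fix z assume z: "z \<in> (\<Inter>n. E n)"
    obtain x v where xv: "z = (x, v)" by (cases z)
    have X: "(x, v) \<in> Xf" using z by (auto simp: xv E_def edge_def)
    have "v = 0"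
    proof (rule ccontr)
      assume "v \<noteq> 0"
      then have p: "0 < min v (f x - v)" using X by (auto simp: Xf_iff)
      then obtain n where n: "1 / real (Suc n) < min v (f x - v)"
        using reals_Archimedean[OF p] by (auto simp: inverse_eq_divide)
      have "(x, v) \<in> E n" using z xv by auto
      then show False using n by (auto simp: E_def edge_def)
    qed
    then show "z \<in> {(x, v). (x, v) \<in> Xf \<and> v = 0}" using X xv by simp
  next
    fix z assume "z \<in> {(x, v). (x, v) \<in> Xf \<and> v = 0}"
    then show "z \<in> (\<Inter>n. E n)" by (auto simp: E_def edge_def)
  qed
  have "vol {(x, v). (x, v) \<in> Xf \<and> v = 0} = (\<integral>\<^sup>+x. 0 \<partial>circle_measure)"
    unfolding vol_def
  proof (rule nn_integral_cong)
    fix x assume "x \<in> space circle_measure"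
    then have "Pair x -` {(x, v). (x, v) \<in> Xf \<and> v = 0} = {0}" using pos[of x] by (auto simp: Xf_iff)
    then show "emeasure lborel (Pair x -` {(x, v). (x, v) \<in> Xf \<and> v = 0}) = 0" by simp
  qed
  then have "measure MF (\<Inter>n. E n) = 0"
  proof -
    assume v: "vol {(x, v). (x, v) \<in> Xf \<and> v = 0} = (\<integral>\<^sup>+x. 0 \<partial>circle_measure)"
    have "(\<Inter>n. E n) \<in> sets MF" using edge_sets by (auto simp: E_def)
    then have "emeasure MF (\<Inter>n. E n) = 0" using v by (simp add: emeasure_MF int)
    then show ?thesis by (simp add: measure_def)
  qed
  moreover have "(\<lambda>n. measure MF (E n)) \<longlonglongrightarrow> measure MF (\<Inter>n. E n)"
    by (rule finite_Lim_measure_decseq[OF _ dec]) (use edge_sets in \<open>auto simp: E_def\<close>)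
  ultimately have "\<forall>\<^sub>F n in sequentially. measure MF (E n) < \<epsilon>"
    using assms by (auto intro: order_tendstoD)
  then obtain n where "measure MF (E n) < \<epsilon>" by (auto simp: eventually_sequentially)
  then show ?thesis by (intro exI[of _ "1 / real (Suc n)"]) (auto simp: E_def)
qed

definition over :: "real set \<Rightarrow> (real \<times> real) set" where
  "over B = {(x, s) \<in> Xf. x \<in> B}"

lemma over_sets: "B \<in> sets circle_measure \<Longrightarrow> over B \<in> sets MF"
proof -
  assume "B \<in> sets circle_measure"
  then have [measurable]: "B \<in> sets borel" by (simp add: sets_circle_iff)
  have "{(x, s). (x, s) \<in> Xf \<and> x \<in> B} \<in> sets (borel :: (real \<times> real) measure)"
    unfolding Xf_iff by (rule borel_pair_Collect) measurable
  then show ?thesis by (auto simp: sets_MF_iff over_def split_beta)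
qed

lemma over_small:
  assumes B: "\<And>n. B n \<in> sets circle_measure" "decseq B" and null: "measure circle_measure (\<Inter>n. B n) = 0"
    and \<epsilon>: "0 < \<epsilon>"
  shows "\<forall>\<^sub>F n::nat in sequentially. measure MF (over (B n)) < \<epsilon>"
proof -
  interpret prob_space MF by (rule prob_space_MF)
  have "(\<Inter>n. B n) \<in> sets circle_measure" using B by auto
  then have "measure MF (over (\<Inter>n. B n)) = 0" using null_over[OF _ null] by (simp add: over_def)
  moreover have "over (\<Inter>n. B n) = (\<Inter>n. over (B n))" by (auto simp: over_def)
  moreover have "(\<lambda>n. measure MF (over (B n))) \<longlonglongrightarrow> measure MF (\<Inter>n. over (B n))"
  proof (rule finite_Lim_measure_decseq)
    show "range (\<lambda>n. over (B n)) \<subseteq> sets MF" using over_sets[OF B(1)] by blast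
    show "decseq (\<lambda>n. over (B n))" using B(2) by (auto simp: decseq_def over_def)
  qed
  ultimately have "(\<lambda>n. measure MF (over (B n))) \<longlonglongrightarrow> 0" by simp
  from order_tendstoD(2)[OF this \<epsilon>] show ?thesis .
qed

lemma flow_close:
  assumes X: "(x, s) \<in> Xf" and Y: "(y, s') \<in> Xf" and n: "n = idx x (t + s)"
    and d1: "\<bar>bsum n x - bsum n y - p\<bar> < \<epsilon>" and d2: "\<bar>bsum (n + 1) x - bsum (n + 1) y - p\<bar> < \<epsilon>"
    and s: "\<bar>s - s'\<bar> < \<epsilon>" and xy: "int_dist (x - y) < \<epsilon>"
    and ne: "Fl t (x, s) \<notin> edge (2 * \<epsilon>)"
  shows "special_flow_dist circle_dist (Fl t (x, s)) (Fl (t - p) (y, s')) < 3 * \<epsilon>"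
proof -
  have xc: "x \<in> circle" "y \<in> circle" using X Y by (auto simp: Xf_iff)
  define v where "v = t + s - bsum n x"
  have F1: "Fl t (x, s) = (frac (x + of_int n * \<alpha>), v)" using xc by (simp add: flow_idx flow_at_def n v_def)
  have in1: "Fl t (x, s) \<in> Xf" by (rule flow_in_space[OF X])
  have v: "2 * \<epsilon> \<le> v" "v < f (x + of_int n * \<alpha>) - 2 * \<epsilon>"
    using in1 ne by (auto simp: F1 edge_def)
  define e where "e = (s' - s) + (bsum n x - bsum n y - p)"
  have e: "\<bar>e\<bar> < 2 * \<epsilon>" using s d1 unfolding e_def by linarith
  have ve: "t - p + s' - bsum n y = v + e" by (simp add: v_def e_def)
  have "Fl (t - p) (y, s') = (frac (y + of_int n * \<alpha>), t - p + s' - bsum n y)"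
  proof (rule flow_eq[OF xc(2)])
    show "bsum n y \<le> t - p + s'" using ve v e by linarith
    have "t + s < bsum (n + 1) x - 2 * \<epsilon>" using v(2) bsum_Suc[of n x] by (simp add: v_def)
    then show "t - p + s' < bsum (n + 1) y" using d2 s by linarith
  qed
  then have F2: "Fl (t - p) (y, s') = (frac (y + of_int n * \<alpha>), v + e)" by (simp add: ve)
  have "circle_dist (frac (x + of_int n * \<alpha>)) (frac (y + of_int n * \<alpha>)) = int_dist (x - y)"
    by (simp add: circle_dist_def int_dist_frac_diff)
  then show ?thesis using e xy by (simp add: F1 F2 special_flow_dist_def)
qed

definition escape :: "real \<Rightarrow> real set" where
  "escape R = {x \<in> circle. \<exists>n. R * real n < bsum (int n) x \<or> R * real n < - bsum (- int n) x}"

lemma escape_sets: "escape R \<in> sets circle_measure"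
  and escape_small: "0 < R \<Longrightarrow> measure circle_measure (escape R) \<le> 2 * mass / R"
proof -
  interpret prob_space circle_measure by (rule prob_space_circle)
  have key: "{x \<in> circle. \<exists>n. R * real n < (\<Sum>i<n. g (x + real i * \<beta>))} \<in> sets circle_measure
     \<and> (0 < R \<longrightarrow> measure circle_measure {x \<in> circle. \<exists>n. R * real n < (\<Sum>i<n. g (x + real i * \<beta>))} \<le> mass / R)"
    if gi: "integrable circle_measure g" and gm: "integral\<^sup>L circle_measure g = mass"
      and gp: "\<And>x. 0 \<le> g x" and gf: "\<And>x. g (frac x) = g x" for g \<beta>
  proof -
    interpret r: pmpt circle_measure "\<lambda>x. frac (x + \<beta>)" by (rule pmpt_rotation)
    have es: "ergodic_sum (\<lambda>x. frac (x + \<beta>)) g n x = (\<Sum>i<n. g (x + real i * \<beta>))" if "x \<in> circle" for n x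
      unfolding ergodic_sum_def using that by (simp add: funpow_rotation gf)
    have eq: "{x \<in> circle. \<exists>n. R * real n < (\<Sum>i<n. g (x + real i * \<beta>))}
        = {x \<in> space circle_measure. \<exists>n. R * real n < ergodic_sum (\<lambda>x. frac (x + \<beta>)) g n x}"
      by (auto simp: es)
    have [measurable]: "g \<in> borel_measurable circle_measure" using gi by auto
    have "{x \<in> space circle_measure. \<exists>n. R * real n < ergodic_sum (\<lambda>x. frac (x + \<beta>)) g n x} \<in> sets circle_measure"
      by measurable
    then show ?thesis unfolding eq using r.maximal_inequality[OF gi] gp gm by auto
  qed
  define g where "g x = f (x - \<alpha>)" for x
  have gf: "g (frac x) = g x" for x using f_frac_add[of x "- \<alpha>"] by (simp add: g_def)
  interpret r: pmpt circle_measure "\<lambda>x. frac (x + (- \<alpha>))" by (rule pmpt_rotation)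
  have gT: "(\<lambda>x. f (frac (x + (- \<alpha>)))) = g" by (simp add: g_def fun_eq_iff)
  have gi: "integrable circle_measure g" using r.integrable_T[OF f_integrable] unfolding gT .
  have gm: "integral\<^sup>L circle_measure g = mass" using r.integral_T[of f] f_integrable unfolding gT mass_def by auto
  define E1 where "E1 = {x \<in> circle. \<exists>n. R * real n < (\<Sum>i<n. f (x + real i * \<alpha>))}"
  define E2 where "E2 = {x \<in> circle. \<exists>n. R * real n < (\<Sum>i<n. g (x + real i * (- \<alpha>)))}"
  have gs: "(\<Sum>i<n. g (x + real i * (- \<alpha>))) = - bsum (- int n) x" for n x
    unfolding bsum_backward by (simp add: g_def algebra_simps)
  have E: "escape R = E1 \<union> E2" unfolding escape_def E1_def E2_def gs bsum_forward by auto
  have k1: "E1 \<in> sets circle_measure \<and> (0 < R \<longrightarrow> measure circle_measure E1 \<le> mass / R)"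
    unfolding E1_def by (rule key) (use f_integrable pos in \<open>auto simp: mass_def intro: less_imp_le\<close>)
  have k2: "E2 \<in> sets circle_measure \<and> (0 < R \<longrightarrow> measure circle_measure E2 \<le> mass / R)"
    unfolding E2_def by (rule key[OF gi gm _ gf]) (simp add: g_def pos less_imp_le)
  show "escape R \<in> sets circle_measure" unfolding E using k1 k2 by (intro sets.Un) simp_all
  assume "0 < R"
  then have "measure circle_measure (E1 \<union> E2) \<le> mass / R + mass / R"
    using k1 k2 measure_Un_le[of E1 circle_measure E2] by linarith
  then show "measure circle_measure (escape R) \<le> 2 * mass / R" by (simp add: E)
qed

lemma escape_eventually_small:
  assumes "0 < \<epsilon>"
  shows "\<forall>\<^sub>F n::nat in sequentially. measure MF (over (escape (real (Suc n)))) < \<epsilon>"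
proof (rule over_small[OF escape_sets _ _ assms])
  interpret prob_space circle_measure by (rule prob_space_circle)
  show dec: "decseq (\<lambda>n. escape (real (Suc n)))"
    unfolding decseq_def escape_def
  proof (intro allI impI subsetI)
    fix m n :: nat and x assume mn: "m \<le> n"
      and "x \<in> {x \<in> circle. \<exists>l. real (Suc n) * real l < bsum (int l) x \<or> real (Suc n) * real l < - bsum (- int l) x}"
    then obtain l where l: "x \<in> circle" "real (Suc n) * real l < bsum (int l) x \<or> real (Suc n) * real l < - bsum (- int l) x"
      by blast
    have "real (Suc m) * real l \<le> real (Suc n) * real l" using mn by (intro mult_right_mono) auto
    then have "real (Suc m) * real l < bsum (int l) x \<or> real (Suc m) * real l < - bsum (- int l) x"
      using l(2) by linarith
    then show "x \<in> {x \<in> circle. \<exists>l. real (Suc m) * real l < bsum (int l) x \<or> real (Suc m) * real l < - bsum (- int l) x}"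
      using l(1) by blast
  qed
  have "(\<lambda>n. 2 * mass / real (Suc n)) \<longlonglongrightarrow> 0"
    by (rule LIMSEQ_Suc) (rule lim_const_over_n)
  moreover have "(\<lambda>n. measure circle_measure (escape (real (Suc n)))) \<longlonglongrightarrow> measure circle_measure (\<Inter>n. escape (real (Suc n)))"
    using dec escape_sets by (intro finite_Lim_measure_decseq) auto
  ultimately have "measure circle_measure (\<Inter>n. escape (real (Suc n))) \<le> 0"
    by (intro LIMSEQ_le[where Y = "\<lambda>n. 2 * mass / real (Suc n)"]) (use escape_small in \<open>auto intro!: exI[of _ 0]\<close>)
  then show "measure circle_measure (\<Inter>n. escape (real (Suc n))) = 0"
    using measure_nonneg[of circle_measure "\<Inter>n. escape (real (Suc n))"] by linarith
qed

end


lemma (in roof_flow) bsum_lower: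
  obtains c2 c :: real where "0 < c2" "0 < c"
    and "\<And>m n y. bsum m y + c2 * real n - c \<le> bsum (m + int n) y"
proof -
  obtain c Q where c: "0 < c" "0 < Q" "\<And>m j x. bsum m x + real j * c \<le> bsum (m + int (j * Q)) x"
    using bsum_growth by blast
  have "bsum m y + c / real Q * real n - c \<le> bsum (m + int n) y" for m n y
  proof -
    define j where "j = n div Q"
    have j: "j * Q \<le> n" "n < j * Q + Q" using c(2) by (simp_all add: j_def) (metis dividend_less_div_times mult.commute add.commute)
    have "real n \<le> (real j + 1) * real Q" using j(2) by (metis add.commute distrib_right less_imp_le mult_1 of_nat_1 of_nat_add of_nat_le_iff of_nat_mult)
    then have "c / real Q * real n \<le> c / real Q * ((real j + 1) * real Q)" using c by (intro mult_left_mono) auto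
    also have "\<dots> = real j * c + c" using c(2) by (simp add: algebra_simps)
    finally have "bsum m y + c / real Q * real n - c \<le> bsum m y + real j * c" by simp
    also have "\<dots> \<le> bsum (m + int (j * Q)) y" by (rule c(3))
    also have "\<dots> \<le> bsum (m + int n) y" using j(1) by (intro bsum_mono) (simp flip: of_nat_mult)
    finally show ?thesis .
  qed
  then show thesis using c by (intro that[of "c / real Q" c]) auto
qed

locale flow_setting = singular_rotation +
  assumes f_pos: "\<And>y. 0 < f y" and f_int: "integrable circle_measure f"

sublocale flow_setting \<subseteq> roof_flow \<alpha> q f "a ` {1..k}"
proof
  show "f (y + 1) = f y" for y using f_periodic[of y 1] by simp
  show "isCont f y" if "frac y \<notin> a ` {1..k}" for y using f_deriv[OF that] by (rule DERIV_isCont)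
qed (auto simp: f_pos f_int)

context flow_setting
begin

lemma close_small:
  "circle \<inter> close s \<in> sets circle_measure" "measure circle_measure (circle \<inter> close s) \<le> real k * ext s"
proof -
  have "circle \<inter> close s \<in> sets circle_measure \<and> measure circle_measure (circle \<inter> close s) \<le> real k * ext s"
  proof (cases "s \<in> K\<alpha>")
    case True
    then have "circle \<inter> close s = {}" by (auto simp: close_def)
    then show ?thesis by (simp add: ext_nonneg)
  next
    case False
    define X where "X = x s / (2 * C)"
    have X: "0 \<le> X" using x_pos[of s] C_gt by (simp add: X_def)
    define F where "F = (\<lambda>(b, j). {y \<in> circle. int_dist (y + (real b * \<alpha> - a j)) < X})"
    define I where "I = {..<q s} \<times> {1..k}"
    have F: "F i \<in> sets circle_measure" "measure circle_measure (F i) \<le> 2 * X" for i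
      using measure_near_point[OF X] by (auto simp: F_def split_beta)
    have eq: "circle \<inter> close s = (\<Union>i\<in>I. F i)"
      using False by (auto simp: close_def not_far F_def I_def X_def algebra_simps)
    have m: "(\<Union>i\<in>I. F i) \<in> sets circle_measure" using F(1) by (intro sets.finite_UN) (auto simp: I_def)
    have "measure circle_measure (\<Union>i\<in>I. F i) \<le> (\<Sum>i\<in>I. measure circle_measure (F i))"
      using F(1) by (intro measure_UNION_le) (auto simp: I_def)
    also have "\<dots> \<le> (\<Sum>i\<in>I. 2 * X)" using F(2) by (intro sum_mono) auto
    also have "\<dots> = real (q s) * real k * (x s / C)" by (simp add: I_def X_def card_cartesian_product)
    also have "\<dots> \<le> real (q s) * real k * x s"
      using x_pos[of s] C_gt by (intro mult_left_mono) (auto simp: divide_le_eq)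
    also have "\<dots> = real k * ext s" using False by (simp add: ext_def)
    finally show ?thesis using m unfolding eq by blast
  qed
  then show "circle \<inter> close s \<in> sets circle_measure" "measure circle_measure (circle \<inter> close s) \<le> real k * ext s"
    by auto
qed

lemma close_eventually_small:
  assumes "0 < \<epsilon>"
  shows "\<forall>\<^sub>F s0 in sequentially. measure MF (over (\<Union>s\<in>{s0..}. circle \<inter> close s)) < \<epsilon>"
proof (rule over_small[OF _ _ _ assms])
  interpret prob_space circle_measure by (rule prob_space_circle)
  show "(\<Union>s\<in>{s0..}. circle \<inter> close s) \<in> sets circle_measure" for s0
    using close_small(1) by (intro sets.countable_UN) auto
  show "decseq (\<lambda>s0. \<Union>s\<in>{s0..}. circle \<inter> close s)"
    by (auto simp: decseq_def intro: order_trans)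
  have "summable (\<lambda>s. measure circle_measure (circle \<inter> close s))"
    by (rule summable_comparison_test'[OF summable_mult[OF ext_summable, of "real k"]])
      (use close_small(2) in auto)
  then have "limsup (\<lambda>s. circle \<inter> close s) \<in> null_sets circle_measure"
    using close_small(1) by (intro borel_cantelli_limsup1) (auto simp: emeasure_eq_measure)
  moreover have "limsup (\<lambda>s. circle \<inter> close s) = (\<Inter>s0. \<Union>s\<in>{s0..}. circle \<inter> close s)"
    by (simp add: limsup_INF_SUP)
  ultimately show "measure circle_measure (\<Inter>s0. \<Union>s\<in>{s0..}. circle \<inter> close s) = 0"
    by (simp add: null_sets_def measure_def)
qed

lemma switchable:
  obtains P where "compact P" "0 \<notin> P"
    and "\<And>t0. 0 < t0 \<Longrightarrow> switchable_R MF (special_flow_dist circle_dist) Fl t0 P"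
proof -
  interpret MF: prob_space MF by (rule prob_space_MF)
  let ?d = "special_flow_dist circle_dist"
  obtain p1 p2 :: real where p1: "0 < p1"
    and dr0: "\<And>\<epsilon>. 0 < \<epsilon> \<Longrightarrow> \<exists>\<kappa>>0. \<forall>N::nat. \<exists>s00. \<forall>s0\<ge>s00. \<exists>\<delta>>0. \<forall>z v. v \<noteq> 0 \<longrightarrow> \<bar>v\<bar> < \<delta> \<longrightarrow> (\<forall>s\<ge>s0. z \<notin> close s) \<longrightarrow>
      (\<exists>(M::nat) (L::nat) p. N < M \<and> N < L \<and> \<kappa> * real M \<le> real L \<and> p1 \<le> \<bar>p\<bar> \<and> \<bar>p\<bar> \<le> p2 \<and>
        ((\<forall>n\<in>{M..M+L}. \<bar>(\<Sum>i<n. f (z + real i * \<alpha>) - f (z + v + real i * \<alpha>)) - p\<bar> < \<epsilon>) \<or>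
         (\<forall>n\<in>{M..M+L}. \<bar>(\<Sum>i<n. f (z + v - real (Suc i) * \<alpha>) - f (z - real (Suc i) * \<alpha>)) - p\<bar> < \<epsilon>)))"
    using drift by blast
  define DR where "DR \<kappa> \<epsilon> N z v \<longleftrightarrow>
      (\<exists>(M::nat) (L::nat) p. N < M \<and> N < L \<and> \<kappa> * real M \<le> real L \<and> p1 \<le> \<bar>p\<bar> \<and> \<bar>p\<bar> \<le> p2 \<and>
        ((\<forall>n\<in>{M..M+L}. \<bar>(\<Sum>i<n. f (z + real i * \<alpha>) - f (z + v + real i * \<alpha>)) - p\<bar> < \<epsilon>) \<or>
         (\<forall>n\<in>{M..M+L}. \<bar>(\<Sum>i<n. f (z + v - real (Suc i) * \<alpha>) - f (z - real (Suc i) * \<alpha>)) - p\<bar> < \<epsilon>)))"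
    for \<kappa> \<epsilon> :: real and N :: nat and z v :: real
  have dr: "\<And>\<epsilon>. 0 < \<epsilon> \<Longrightarrow> \<exists>\<kappa>>0. \<forall>N::nat. \<exists>s00. \<forall>s0\<ge>s00. \<exists>\<delta>>0. \<forall>z v. v \<noteq> 0 \<longrightarrow> \<bar>v\<bar> < \<delta> \<longrightarrow>
      (\<forall>s\<ge>s0. z \<notin> close s) \<longrightarrow> DR \<kappa> \<epsilon> N z v"
    unfolding DR_def by (rule dr0)
  obtain c2 c' where c2: "0 < c2" "0 < c'" and low: "\<And>m n y. bsum m y + c2 * real n - c' \<le> bsum (m + int n) y"
    using bsum_lower by blast
  define P where "P = {p. p1 \<le> \<bar>p\<bar> \<and> \<bar>p\<bar> \<le> p2}"
  have "closed P" unfolding P_def by (intro closed_Collect_conj closed_Collect_le continuous_intros)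
  moreover have "bounded P" unfolding bounded_iff P_def by auto
  ultimately have "compact P" by (simp add: compact_eq_bounded_closed)
  moreover have "0 \<notin> P" using p1 by (simp add: P_def)
  moreover have "switchable_R MF ?d Fl t0 P" if t0: "0 < t0" for t0
    unfolding switchable_R_def
  proof (intro allI impI)
    fix \<epsilon> :: real assume \<epsilon>: "0 < \<epsilon>"
    define e2 where "e2 = \<epsilon> / 8"
    have e2: "0 < e2" using \<epsilon> by (simp add: e2_def)
    have "0 < e2\<^sup>2 / 4" using e2 by simp
    then obtain \<eta> where \<eta>: "0 < \<eta>" "measure MF (edge \<eta>) < e2\<^sup>2 / 4" using edge_small by blast
    define \<epsilon>1 where "\<epsilon>1 = min (\<eta> / 2) (\<epsilon> / 4)"
    have \<epsilon>1: "0 < \<epsilon>1" "2 * \<epsilon>1 \<le> \<eta>" "3 * \<epsilon>1 < \<epsilon>" using \<eta> \<epsilon> by (auto simp: \<epsilon>1_def)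
    obtain \<kappa>1 where \<kappa>1: "0 < \<kappa>1" and dr1: "\<And>N::nat. \<exists>s00. \<forall>s0\<ge>s00. \<exists>\<delta>>0. \<forall>z v. v \<noteq> 0 \<longrightarrow> \<bar>v\<bar> < \<delta> \<longrightarrow>
        (\<forall>s\<ge>s0. z \<notin> close s) \<longrightarrow> DR \<kappa>1 \<epsilon>1 N z v"
      using dr[OF \<epsilon>1(1)] by blast
    obtain n0 where n0: "measure MF (over (escape (real (Suc n0)))) < e2"
      using escape_eventually_small[OF e2] by (auto simp: eventually_sequentially)
    define R where "R = real (Suc n0)"
    have R: "0 < R" by (simp add: R_def)
    define \<kappa> where "\<kappa> = c2 * \<kappa>1 / (6 * R)"
    have \<kappa>: "0 < \<kappa>" using c2 \<kappa>1 R by (simp add: \<kappa>_def)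
    have "\<exists>\<delta>>0. \<exists>Z\<in>sets MF. measure MF Z > 1 - \<epsilon> \<and>
        (\<forall>x\<in>Z. \<forall>y\<in>Z. ?d x y < \<delta> \<and> (\<forall>t. x \<noteq> Fl t y) \<longrightarrow>
           (\<exists>K L :: nat. \<exists>p\<in>P. K > N \<and> L > N \<and> real L / real K \<ge> \<kappa> \<and>
              (real (card {n \<in> {K..K + L}. ?d (Fl (real n * t0) x) (Fl (real n * t0 + p) y) < \<epsilon>})
                 / real L > 1 - \<epsilon> \<or>
               real (card {n \<in> {K..K + L}. ?d (Fl (- real n * t0) x) (Fl (- real n * t0 + p) y) < \<epsilon>})
                 / real L > 1 - \<epsilon>)))" for N :: nat
    proof -
      obtain N1 G1 where G1: "G1 \<in> sets MF" "measure MF G1 > 1 - e2"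
        and freq1: "\<And>z K L. z \<in> G1 \<Longrightarrow> N1 \<le> K \<Longrightarrow> \<kappa> * real K \<le> real L \<Longrightarrow>
            real (card {n \<in> {K..K + L}. (Fl t0 ^^ n) z \<in> edge \<eta>}) \<le> e2 * real L"
        using pmpt.window_frequency[OF pmpt_flow edge_sets e2 \<kappa> \<eta>(2), of t0] by blast
      obtain N2 G2 where G2: "G2 \<in> sets MF" "measure MF G2 > 1 - e2"
        and freq2: "\<And>z K L. z \<in> G2 \<Longrightarrow> N2 \<le> K \<Longrightarrow> \<kappa> * real K \<le> real L \<Longrightarrow>
            real (card {n \<in> {K..K + L}. (Fl (- t0) ^^ n) z \<in> edge \<eta>}) \<le> e2 * real L"
        using pmpt.window_frequency[OF pmpt_flow edge_sets e2 \<kappa> \<eta>(2), of "- t0"] by blast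
      define N' where "N' = max N (max N1 N2)"
      define c where "c = c' + R"
      obtain Nb1 :: nat where Nb1: "(2 * c + 6 * t0 + 2 * (t0 * (real N' + 1))) / c2 \<le> real Nb1" using real_arch_simple by blast
      obtain Nb2 :: nat where Nb2: "t0 / R \<le> real Nb2" using real_arch_simple by blast
      define Nb where "Nb = max Nb1 Nb2"
      have c0: "0 < c" using c2 R by (simp add: c_def)
      have tN: "0 \<le> t0 * (real N' + 1)" using t0 by simp
      have large: "c + t0 * (real N' + 1) \<le> c2 * real l" "2 * c + 6 * t0 \<le> c2 * real l"
        "2 * (t0 * (real N' + 1)) \<le> c2 * real l" "t0 \<le> R * real l" if "Nb < l" for l
      proof -
        have "(2 * c + 6 * t0 + 2 * (t0 * (real N' + 1))) / c2 \<le> real l" using Nb1 that by (simp add: Nb_def)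
        then have *: "2 * c + 6 * t0 + 2 * (t0 * (real N' + 1)) \<le> c2 * real l"
          using c2 by (simp add: pos_divide_le_eq mult.commute)
        show "c + t0 * (real N' + 1) \<le> c2 * real l" using * c0 t0 tN by linarith
        show "2 * c + 6 * t0 \<le> c2 * real l" using * tN by linarith
        show "2 * (t0 * (real N' + 1)) \<le> c2 * real l" using * c0 t0 by linarith
        have "t0 / R \<le> real l" using Nb2 that by (simp add: Nb_def)
        then show "t0 \<le> R * real l" using R by (simp add: pos_divide_le_eq mult.commute)
      qed
      obtain s00 where s00: "\<And>s0. s00 \<le> s0 \<Longrightarrow> \<exists>\<delta>>0. \<forall>z v. v \<noteq> 0 \<longrightarrow> \<bar>v\<bar> < \<delta> \<longrightarrow>
          (\<forall>s\<ge>s0. z \<notin> close s) \<longrightarrow> DR \<kappa>1 \<epsilon>1 Nb z v"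
        using dr1[of Nb] by blast
      obtain s1 where s1: "\<And>s0. s1 \<le> s0 \<Longrightarrow> measure MF (over (\<Union>s\<in>{s0..}. circle \<inter> close s)) < e2"
        using close_eventually_small[OF e2] unfolding eventually_sequentially by blast
      define s0 where "s0 = max s00 s1"
      have s0: "s00 \<le> s0" "measure MF (over (\<Union>s\<in>{s0..}. circle \<inter> close s)) < e2"
        by (simp add: s0_def, rule s1, simp add: s0_def)
      obtain \<delta>1 where \<delta>1: "0 < \<delta>1" and dr2: "\<And>z v. v \<noteq> 0 \<Longrightarrow> \<bar>v\<bar> < \<delta>1 \<Longrightarrow> (\<forall>s\<ge>s0. z \<notin> close s) \<Longrightarrow> DR \<kappa>1 \<epsilon>1 Nb z v"
        using s00[OF s0(1)] by blast
      define \<delta> where "\<delta> = min \<delta>1 \<epsilon>1"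
      have \<delta>: "0 < \<delta>" "\<delta> \<le> \<delta>1" "\<delta> \<le> \<epsilon>1" using \<delta>1 \<epsilon>1 by (auto simp: \<delta>_def)
      define O1 where "O1 = over (\<Union>s\<in>{s0..}. circle \<inter> close s)"
      define O2 where "O2 = over (escape R)"
      have O1: "O1 \<in> sets MF" "measure MF O1 < e2"
      proof -
        have "(\<Union>s\<in>{s0..}. circle \<inter> close s) \<in> sets circle_measure"
          by (rule sets.countable_UN', simp, rule image_subsetI, rule close_small(1))
        then show "O1 \<in> sets MF" unfolding O1_def by (rule over_sets)
        show "measure MF O1 < e2" unfolding O1_def by (rule s0(2))
      qed
      have O2: "O2 \<in> sets MF" "measure MF O2 < e2"
        unfolding O2_def using n0 escape_sets by (auto intro!: over_sets simp: R_def)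
      define Z where "Z = (G1 \<inter> G2) - (O1 \<union> O2)"
      have Zs: "Z \<in> sets MF" using G1 G2 O1 O2 by (auto simp: Z_def)
      have Zm: "measure MF Z > 1 - \<epsilon>"
      proof -
        have "measure MF (Xf - Z) \<le> measure MF ((Xf - G1) \<union> (Xf - G2) \<union> (O1 \<union> O2))"
          using G1 G2 O1 O2 sets.compl_sets[of G1 MF] sets.compl_sets[of G2 MF]
          by (intro MF.finite_measure_mono) (auto simp: Z_def)
        also have "\<dots> \<le> (measure MF (Xf - G1) + measure MF (Xf - G2)) + (measure MF O1 + measure MF O2)"
          using G1 G2 O1 O2 sets.compl_sets[of G1 MF] sets.compl_sets[of G2 MF]
          by (intro order_trans[OF measure_Un_le add_mono] measure_Un_le sets.Un) auto
        also have "\<dots> < (e2 + e2) + (e2 + e2)"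
          using G1 G2 O1 O2 MF.prob_compl[of G1] MF.prob_compl[of G2] by simp
        also have "\<dots> \<le> \<epsilon>" using \<epsilon> by (simp add: e2_def)
        finally show ?thesis using MF.prob_compl[OF Zs] by simp
      qed
      have main: "\<exists>K L :: nat. \<exists>p\<in>P. K > N \<and> L > N \<and> real L / real K \<ge> \<kappa> \<and>
              (real (card {n \<in> {K..K + L}. ?d (Fl (real n * t0) X) (Fl (real n * t0 + p) Y) < \<epsilon>})
                 / real L > 1 - \<epsilon> \<or>
               real (card {n \<in> {K..K + L}. ?d (Fl (- real n * t0) X) (Fl (- real n * t0 + p) Y) < \<epsilon>})
                 / real L > 1 - \<epsilon>)"
        if XZ: "X \<in> Z" and YZ: "Y \<in> Z" and XY: "?d X Y < \<delta>" "\<And>t. X \<noteq> Fl t Y" for X Y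
      proof -
        have ZX: "Z \<subseteq> Xf" using sets.sets_into_space[OF Zs] by simp
        obtain y s where X: "X = (y, s)" by (cases X)
        obtain y' s' where Y: "Y = (y', s')" by (cases Y)
        have Xin: "(y, s) \<in> Xf" and Yin: "(y', s') \<in> Xf" using XZ YZ ZX by (auto simp: X Y)
        have yc: "y \<in> circle" "y' \<in> circle" "0 \<le> s" "s < f y" using Xin Yin by (auto simp: Xf_iff)
        have dist: "int_dist (y - y') < \<delta>" "\<bar>s - s'\<bar> < \<delta>"
        proof -
          have "int_dist (y - y') + \<bar>s - s'\<bar> < \<delta>"
            using XY(1) by (simp add: X Y special_flow_dist_def circle_dist_def)
          then show "int_dist (y - y') < \<delta>" "\<bar>s - s'\<bar> < \<delta>"
            using int_dist_nonneg[of "y - y'"] by linarith+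
        qed
        define v where "v = y' - y - of_int (round (y' - y))"
        have v: "\<bar>v\<bar> = int_dist (y - y')" 
          unfolding int_dist_commute[of y y'] by (simp add: v_def int_dist_def)
        have yv: "y + v = y' + of_int (- round (y' - y))" by (simp add: v_def)
        have bv: "bsum n (y + v) = bsum n y'" for n unfolding yv by (rule bsum_add_int)
        have "y \<noteq> y'"
        proof
          assume "y = y'"
          then have "Fl (s - s') Y = X"
            using flow_vertical[OF Yin, of "s - s'"] yc by (simp add: X Y)
          then show False using XY(2) by metis
        qed
        have v0: "v \<noteq> 0"
        proof
          assume "v = 0"
          then have e: "y = y' + of_int (- round (y' - y))" using yv by simp
          have "frac y = frac y'" by (subst e) (rule frac_add_of_int_right)
          then show False using \<open>y \<noteq> y'\<close> yc by (simp add: frac_circle)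
        qed
        have zc: "\<forall>s\<ge>s0. y \<notin> close s"
          using XZ yc Xin by (auto simp: Z_def O1_def over_def X)
        have ne: "y \<notin> escape R" using XZ Xin by (auto simp: Z_def O2_def over_def X)
        have up: "bsum (int n) y \<le> R * real n" "- bsum (- int n) y \<le> R * real n" for n
          using ne yc by (auto simp: escape_def not_less)
        have sR: "s < R" using up(1)[of 1] bsum_Suc[of 0 y] yc by simp
        obtain M L :: nat and p where MLw: "Nb < M" "Nb < L" "\<kappa>1 * real M \<le> real L" "p1 \<le> \<bar>p\<bar>" "\<bar>p\<bar> \<le> p2"
          and alt: "(\<forall>n\<in>{M..M+L}. \<bar>(\<Sum>i<n. f (y + real i * \<alpha>) - f (y + v + real i * \<alpha>)) - p\<bar> < \<epsilon>1) \<or>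
           (\<forall>n\<in>{M..M+L}. \<bar>(\<Sum>i<n. f (y + v - real (Suc i) * \<alpha>) - f (y - real (Suc i) * \<alpha>)) - p\<bar> < \<epsilon>1)"
        proof -
          have "\<bar>v\<bar> < \<delta>1" using v dist(1) \<delta>(2) by linarith
          from dr2[OF v0 this zc] show thesis unfolding DR_def using that by blast
        qed
        have M1: "1 \<le> real M" using MLw(1) by simp
        have pP: "- p \<in> P" using MLw by (simp add: P_def)
        have count: "real (card {n \<in> {K..K + L'}. ?d (Fl (real n * \<tau>) X) (Fl (real n * \<tau> - p) Y) < \<epsilon>}) / real L' > 1 - \<epsilon>"
          if KL: "N' < K" "N' < L'" "\<kappa> * real K \<le> real L'"
            and fr: "real (card {n \<in> {K..K + L'}. (Fl \<tau> ^^ n) X \<in> edge \<eta>}) \<le> e2 * real L'"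
            and cl: "\<And>n. n \<in> {K..K+L'} \<Longrightarrow> Fl (real n * \<tau>) X \<notin> edge \<eta> \<Longrightarrow> ?d (Fl (real n * \<tau>) X) (Fl (real n * \<tau> - p) Y) < \<epsilon>"
          for K L' :: nat and \<tau>
        proof -
          define good where "good = {n \<in> {K..K + L'}. ?d (Fl (real n * \<tau>) X) (Fl (real n * \<tau> - p) Y) < \<epsilon>}"
          define bad where "bad = {n \<in> {K..K + L'}. (Fl \<tau> ^^ n) X \<in> edge \<eta>}"
          have "{K..K+L'} \<subseteq> good \<union> bad"
            using cl flow_funpow[of X] Xin by (auto simp: good_def bad_def X)
          then have "card {K..K+L'} \<le> card (good \<union> bad)" by (intro card_mono) (auto simp: good_def bad_def)
          also have "\<dots> \<le> card good + card bad" by (rule card_Un_le)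
          finally have "real L' + 1 \<le> real (card good) + real (card bad)" by simp
          then have "real L' + 1 - e2 * real L' \<le> real (card good)" using fr by (simp add: bad_def)
          moreover have "e2 * real L' \<le> \<epsilon> * real L'" using \<epsilon> by (intro mult_right_mono) (auto simp: e2_def)
          ultimately have "(1 - \<epsilon>) * real L' < real (card good)" by (simp add: left_diff_distrib)
          moreover have "0 < real L'" using KL(2) by simp
          ultimately show ?thesis by (simp add: good_def pos_less_divide_eq)
        qed
        have ratio: "\<kappa> \<le> real L' / real K" if "N' < K" "\<kappa> * real K \<le> real L'" for K L' :: nat
          using that by (simp add: pos_le_divide_eq)
        have XG: "X \<in> G1" "X \<in> G2" using XZ by (auto simp: Z_def)
        have NN: "N \<le> N'" "N1 \<le> N'" "N2 \<le> N'" by (auto simp: N'_def)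
        have near: "?d (Fl t X) (Fl (t - p) Y) < \<epsilon>"
          if "\<bar>bsum (idx y (t + s)) y - bsum (idx y (t + s)) y' - p\<bar> < \<epsilon>1"
             "\<bar>bsum (idx y (t + s) + 1) y - bsum (idx y (t + s) + 1) y' - p\<bar> < \<epsilon>1"
             "Fl t X \<notin> edge \<eta>" for t
        proof -
          have "?d (Fl t (y, s)) (Fl (t - p) (y', s')) < 3 * \<epsilon>1"
            by (rule flow_close[OF Xin Yin refl that(1,2)])
              (use dist \<delta> that(3) edge_mono[OF \<epsilon>1(2)] in \<open>auto simp: X\<close>)
          then show ?thesis using \<epsilon>1(3) by (simp add: X Y)
        qed
        from alt show ?thesis
        proof
          assume fw: "\<forall>n\<in>{M..M+L}. \<bar>(\<Sum>i<n. f (y + real i * \<alpha>) - f (y + v + real i * \<alpha>)) - p\<bar> < \<epsilon>1"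
          have D: "\<bar>bsum (int n) y - bsum (int n) y' - p\<bar> < \<epsilon>1" if "n \<in> {M..M+L}" for n
            using bspec[OF fw that] by (simp only: bv[symmetric] bsum_forward sum_subtractf)
          define lo where "lo = bsum (int M) y"
          define hi where "hi = bsum (int (M + L)) y - s"
          have "\<exists>K L'. N' < K \<and> N' < L' \<and> c2 * \<kappa>1 / (6 * R) * real K \<le> real L'
             \<and> (\<forall>n\<in>{K..K+L'}. lo < real n * t0 \<and> real n * t0 < hi)"
          proof (rule discretize[OF t0 c2(1) R])
            show "0 \<le> lo" using bsum_mono[of 0 "int M" y] by (simp add: lo_def)
            have "R * real M \<le> 2 * R * real M" using R by simp
            then show "lo \<le> 2 * R * real M" using up(1)[of M] by (simp add: lo_def)
            show "c2 * real M - c \<le> lo" using low[of 0 y M] R by (simp add: lo_def c_def)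
            show "c2 * real L - c \<le> hi - lo" using low[of "int M" y L] sR by (simp add: lo_def hi_def c_def)
          qed (rule less_imp_le[OF \<kappa>1] MLw(3) large[OF MLw(1)] large[OF MLw(2)])+
          then obtain K L' where KL: "N' < K" "N' < L'" "\<kappa> * real K \<le> real L'"
            and win: "\<And>n. n \<in> {K..K+L'} \<Longrightarrow> lo < real n * t0 \<and> real n * t0 < hi" unfolding \<kappa>_def by blast
          have "real (card {n \<in> {K..K + L'}. ?d (Fl (real n * t0) X) (Fl (real n * t0 - p) Y) < \<epsilon>}) / real L' > 1 - \<epsilon>"
          proof (rule count[OF KL])
            show "real (card {n \<in> {K..K + L'}. (Fl t0 ^^ n) X \<in> edge \<eta>}) \<le> e2 * real L'"
              using KL NN by (intro freq1 XG) auto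
            fix n assume n: "n \<in> {K..K+L'}" and ned: "Fl (real n * t0) X \<notin> edge \<eta>"
            define l where "l = idx y (real n * t0 + s)"
            have l: "bsum l y \<le> real n * t0 + s" "real n * t0 + s < bsum (l + 1) y"
              using idx[of y "real n * t0 + s"] by (simp_all add: l_def)
            have "bsum l y < bsum (int (M + L)) y" using l win[OF n] by (simp add: hi_def)
            then have 1: "l < int (M + L)" by (simp only: bsum_less_iff)
            have "bsum (int M) y < bsum (l + 1) y" using l win[OF n] yc by (simp add: lo_def)
            then have 2: "int M < l + 1" by (simp only: bsum_less_iff)
            define ln where "ln = nat l"
            have ln: "l = int ln" "l + 1 = int (Suc ln)" "ln \<in> {M..M+L}" "Suc ln \<in> {M..M+L}"
              using 1 2 by (auto simp: ln_def)
            have n1: "\<bar>bsum (idx y (real n * t0 + s)) y - bsum (idx y (real n * t0 + s)) y' - p\<bar> < \<epsilon>1"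
              using D[OF ln(3)] unfolding l_def[symmetric] ln(1)[symmetric] .
            have n2: "\<bar>bsum (idx y (real n * t0 + s) + 1) y - bsum (idx y (real n * t0 + s) + 1) y' - p\<bar> < \<epsilon>1"
              using D[OF ln(4)] unfolding l_def[symmetric] ln(2)[symmetric] .
            show "?d (Fl (real n * t0) X) (Fl (real n * t0 - p) Y) < \<epsilon>"
              by (rule near[OF n1 n2 ned])
          qed
          then show ?thesis using KL NN pP ratio[OF KL(1,3)]
            by (intro exI[of _ K] exI[of _ L'] bexI[of _ "- p"]) auto
        next
          assume bw: "\<forall>n\<in>{M..M+L}. \<bar>(\<Sum>i<n. f (y + v - real (Suc i) * \<alpha>) - f (y - real (Suc i) * \<alpha>)) - p\<bar> < \<epsilon>1"
          have D: "\<bar>bsum (- int n) y - bsum (- int n) y' - p\<bar> < \<epsilon>1" if "n \<in> {M..M+L}" for n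
          proof -
            have "(\<Sum>i<n. f (y + v - real (Suc i) * \<alpha>) - f (y - real (Suc i) * \<alpha>))
                = bsum (- int n) y - bsum (- int n) y'"
              by (simp only: bv[symmetric] bsum_backward sum_subtractf minus_diff_minus minus_diff_eq)
            then show ?thesis using bspec[OF bw that] by (simp only:)
          qed
          define lo where "lo = - bsum (- int M) y + s"
          define hi where "hi = - bsum (- int (M + L)) y"
          have "\<exists>K L'. N' < K \<and> N' < L' \<and> c2 * \<kappa>1 / (6 * R) * real K \<le> real L'
             \<and> (\<forall>n\<in>{K..K+L'}. lo < real n * t0 \<and> real n * t0 < hi)"
          proof (rule discretize[OF t0 c2(1) R])
            show "0 \<le> lo" using bsum_mono[of "- int M" 0 y] yc by (simp add: lo_def)
            have "R * 1 \<le> R * real M" using R M1 by (intro mult_left_mono) auto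
            then show "lo \<le> 2 * R * real M" using up(2)[of M] sR by (simp add: lo_def)
            show "c2 * real M - c \<le> lo" using low[of "- int M" y M] R yc by (simp add: lo_def c_def)
            show "c2 * real L - c \<le> hi - lo" using low[of "- int (M + L)" y L] sR by (simp add: lo_def hi_def c_def)
          qed (rule less_imp_le[OF \<kappa>1] MLw(3) large[OF MLw(1)] large[OF MLw(2)])+
          then obtain K L' where KL: "N' < K" "N' < L'" "\<kappa> * real K \<le> real L'"
            and win: "\<And>n. n \<in> {K..K+L'} \<Longrightarrow> lo < real n * t0 \<and> real n * t0 < hi" unfolding \<kappa>_def by blast
          have "real (card {n \<in> {K..K + L'}. ?d (Fl (real n * (- t0)) X) (Fl (real n * (- t0) - p) Y) < \<epsilon>}) / real L' > 1 - \<epsilon>"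
          proof (rule count[OF KL])
            show "real (card {n \<in> {K..K + L'}. (Fl (- t0) ^^ n) X \<in> edge \<eta>}) \<le> e2 * real L'"
              using KL NN by (intro freq2 XG) auto
            fix n assume n: "n \<in> {K..K+L'}" and ned: "Fl (real n * (- t0)) X \<notin> edge \<eta>"
            define l where "l = idx y (real n * (- t0) + s)"
            have l: "bsum l y \<le> real n * (- t0) + s" "real n * (- t0) + s < bsum (l + 1) y"
              using idx[of y "real n * (- t0) + s"] by (simp_all add: l_def)
            have "bsum l y < bsum (- int M) y" using l win[OF n] by (simp add: lo_def)
            then have 1: "l < - int M" by (simp only: bsum_less_iff)
            have "bsum (- int (M + L)) y < bsum (l + 1) y" using l win[OF n] yc by (simp add: hi_def)
            then have 2: "- int (M + L) < l + 1" by (simp only: bsum_less_iff)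
            define ln where "ln = nat (- l)"
            define lm where "lm = nat (- l - 1)"
            have ln: "l = - int ln" "l + 1 = - int lm" "ln \<in> {M..M+L}" "lm \<in> {M..M+L}"
              using 1 2 by (auto simp: ln_def lm_def)
            have n1: "\<bar>bsum (idx y (real n * (- t0) + s)) y - bsum (idx y (real n * (- t0) + s)) y' - p\<bar> < \<epsilon>1"
              using D[OF ln(3)] unfolding l_def[symmetric] ln(1)[symmetric] .
            have n2: "\<bar>bsum (idx y (real n * (- t0) + s) + 1) y - bsum (idx y (real n * (- t0) + s) + 1) y' - p\<bar> < \<epsilon>1"
              using D[OF ln(4)] unfolding l_def[symmetric] ln(2)[symmetric] .
            show "?d (Fl (real n * (- t0)) X) (Fl (real n * (- t0) - p) Y) < \<epsilon>"
              by (rule near[OF n1 n2 ned])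
          qed
          then show ?thesis using KL NN pP ratio[OF KL(1,3)]
            by (intro exI[of _ K] exI[of _ L'] bexI[of _ "- p"]) auto
        qed
      qed
      show ?thesis
      proof (intro exI[of _ \<delta>] conjI bexI[of _ Z] ballI impI)
        fix X Y assume "X \<in> Z" "Y \<in> Z" and XY: "?d X Y < \<delta> \<and> (\<forall>t. X \<noteq> Fl t Y)"
        show "\<exists>K L :: nat. \<exists>p\<in>P. K > N \<and> L > N \<and> real L / real K \<ge> \<kappa> \<and>
              (real (card {n \<in> {K..K + L}. ?d (Fl (real n * t0) X) (Fl (real n * t0 + p) Y) < \<epsilon>})
                 / real L > 1 - \<epsilon> \<or>
               real (card {n \<in> {K..K + L}. ?d (Fl (- real n * t0) X) (Fl (- real n * t0 + p) Y) < \<epsilon>})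
                 / real L > 1 - \<epsilon>)"
          by (rule main[OF \<open>X \<in> Z\<close> \<open>Y \<in> Z\<close> conjunct1[OF XY] spec[OF conjunct2[OF XY]]])
      qed (rule \<delta>(1) Zm Zs)+
    qed
    note all = this
    show "\<exists>\<kappa>>0. \<forall>N::nat. \<exists>\<delta>>0. \<exists>Z\<in>sets MF. measure MF Z > 1 - \<epsilon> \<and>
        (\<forall>x\<in>Z. \<forall>y\<in>Z. ?d x y < \<delta> \<and> (\<forall>t. x \<noteq> Fl t y) \<longrightarrow>
           (\<exists>K L :: nat. \<exists>p\<in>P. K > N \<and> L > N \<and> real L / real K \<ge> \<kappa> \<and>
              (real (card {n \<in> {K..K + L}. ?d (Fl (real n * t0) x) (Fl (real n * t0 + p) y) < \<epsilon>})
                 / real L > 1 - \<epsilon> \<or>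
               real (card {n \<in> {K..K + L}. ?d (Fl (- real n * t0) x) (Fl (- real n * t0 + p) y) < \<epsilon>})
                 / real L > 1 - \<epsilon>)))"
      by (rule exI[of _ \<kappa>], rule conjI[OF \<kappa>], rule allI, rule all)
  qed
  ultimately show thesis by (rule that)
qed

end


theorem theorem2:
  fixes \<alpha> C m\<^sub>0 :: real
    and q :: "nat \<Rightarrow> nat"
    and f h :: "real \<Rightarrow> real"
    and k :: nat
    and a A B :: "nat \<Rightarrow> real"
    and x :: "nat \<Rightarrow> real"
  assumes "\<alpha> \<notin> \<rat>"
    and "is_denominators \<alpha> q"
    and "a ` {1..k} \<subseteq> circle" and "inj_on a {1..k}"
    and "circle_C2_off f (a ` {1..k})"
    and "\<And>y. f y > 0"
    and "integrable circle_measure f"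
    and "singularity_type h"
    and "has_singularities f h k a A B"
    and "C > 1" and "badly_approximable \<alpha> q C (a ` {1..k})"
    and "(\<Sum>i\<in>{1..k}. A i) \<noteq> (\<Sum>i\<in>{1..k}. B i)"
    and "m\<^sub>0 > 0"
    and "\<And>s. 0 < x s" and "\<And>s. x s < 1 / real (q s)"
    and "(\<lambda>s. deriv h (x s / (4 * C)) / (real (q s) * h (1 / (2 * real (q s))))) \<longlonglongrightarrow> 0"
    and "filterlim (\<lambda>s. x s * real (q s) * h (1 / (2 * real (q s)))) at_top sequentially"
    and "(\<lambda>i. real (q i) * x i) summable_on (- {s. real (q (Suc s)) < 1 / x s})"
    and "\<And>s. h (1 / (2 * real (q s))) / h (1 / (2 * real (q (Suc s)))) > m\<^sub>0"
  shows "SWR_property (special_flow_measure circle_measure f)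
           (special_flow_dist circle_dist)
           (special_flow circle (rotation \<alpha>) f)"
proof -
  interpret flow_setting \<alpha> q f h k a A B C m\<^sub>0 x
    by (intro flow_setting.intro singular_rotation.intro denominators.intro
        singular_rotation_axioms.intro flow_setting_axioms.intro) (rule assms)+
  obtain P where P: "compact P" "0 \<notin> P"
    and sw: "\<And>t0. 0 < t0 \<Longrightarrow> switchable_R MF (special_flow_dist circle_dist) Fl t0 P"
    using switchable by blast
  have sub: "{0<..<1} \<subseteq> {t\<^sub>0. t\<^sub>0 > 0 \<and> switchable_R MF (special_flow_dist circle_dist) Fl t\<^sub>0 P}"
  proof (intro subsetI CollectI conjI)
    fix t :: real assume "t \<in> {0<..<1}"
    then show "0 < t" by simp
    then show "switchable_R MF (special_flow_dist circle_dist) Fl t P" by (rule sw)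
  qed
  have unc: "uncountable {t\<^sub>0. t\<^sub>0 > 0 \<and> switchable_R MF (special_flow_dist circle_dist) Fl t\<^sub>0 P}"
  proof
    assume "countable {t\<^sub>0. t\<^sub>0 > 0 \<and> switchable_R MF (special_flow_dist circle_dist) Fl t\<^sub>0 P}"
    then have "countable {0<..<1::real}" by (rule countable_subset[OF sub])
    then show False using uncountable_open_interval[of 0 "1 :: real"] by simp
  qed
  show ?thesis
    unfolding SWR_property_def
  proof (intro conjI exI[of _ P])
    show "Metric_space (space MF) (special_flow_dist circle_dist)"
      unfolding space_MF by (rule metric_flow)
  qed (rule standard_borel_MF flow_ergodic P unc)+
qed

end
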